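(* Let $X$ be a Banach space and $(T(t))_{t\ge 0}$ a $C_0$-semigroup on $X$. Assume that $t_0>0$ and $c>0$ are such that $\lVert T(t_0)x\rVert\ge c\,\lVert x\rVert$ for all $x\in X$. Then the following hold. (a) For every $\alpha>1$ there exists $m>0$ such that \[ \lVert T(t)x\rVert\ge m\,e^{\nu t}\,\lVert x\rVert\qquad\text{for all } x\in X,\ t>0, \] where $\nu=\frac{1}{t_0}\ln\!\big(\frac{c}{\alpha}\big)$. (b) There exist a larger Banach space $Y\supseteq X$, containing $X$ as a closed subspace, and a $C_0$-group $(S(t))_{t\in\mathbb{R}}$ on $Y$ such that $T(t)=S(t)$ on $X$ for all $t\ge 0$. Moreover, one can achieve that $Y$ is reflexive if $X$ is reflexive and that $Y$ is UMD if $X$ is UMD.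
   Context: A Banach space $X$ is UMD if the Hilbert transform extends to a bounded operator on $L^p(\mathbb{R};X)$ for some (equivalently, all) $1<p<\infty$. In (b), "$Y$ contains $X$ as a closed subspace" is understood up to isomorphism: there is a bounded linear map $\iota:X\to Y$ that is an isomorphism onto its closed range, $X$ is identified with $\iota(X)$, and "$T(t)=S(t)$ on $X$" means $S(t)\iota=\iota T(t)$. *)

theory Defs
  imports "HOL-Analysis.Analysis" "HOL-Algebra.Module"
begin

text \<open>
  HOL cannot quantify existentially over types, and the extension space is asserted to exist.
  Banach spaces are therefore structures on carrier sets: modules in the sense of HOL-Algebra
  over the field of scalars, together with a norm.
\<close>

section \<open>Scalars\<close>

text \<open>
  The scalar field is the real or the complex field.
\<close>

class real_or_complex = real_normed_field +
  assumes real_or_complex: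
    "\<exists>\<phi>::'a \<Rightarrow> complex. (\<forall>x y. \<phi> (x + y) = \<phi> x + \<phi> y) \<and> (\<forall>x y. \<phi> (x * y) = \<phi> x * \<phi> y)
       \<and> (\<forall>r x. \<phi> (r *\<^sub>R x) = r *\<^sub>R \<phi> x) \<and> (\<forall>x. norm (\<phi> x) = norm x)
       \<and> (range \<phi> = \<real> \<or> range \<phi> = UNIV)"

instance real :: real_or_complex
  by standard (rule exI[of _ complex_of_real], simp add: Reals_def scaleR_conv_of_real)

instance complex :: real_or_complex
  by standard (rule exI[of _ "\<lambda>x. x"], simp)

definition scalar_ring :: "'k::real_or_complex ring" where
  "scalar_ring = \<lparr>carrier = UNIV, mult = (*), one = 1, zero = 0, add = (+)\<rparr>"


section \<open>Banach spaces\<close>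

text \<open>
  The fields \<open>mult\<close> and \<open>one\<close>, inherited from the record of rings, are irrelevant for modules.
\<close>

record ('k, 'a) normed_module = "('k, 'a) module" +
  nrm :: "'a \<Rightarrow> real"

locale banach_space = module scalar_ring X
  for X :: "('k::real_or_complex, 'a) normed_module" (structure) +
  assumes nrm_nonneg: "x \<in> carrier X \<Longrightarrow> 0 \<le> nrm X x"
    and nrm_eq_0_iff: "x \<in> carrier X \<Longrightarrow> nrm X x = 0 \<longleftrightarrow> x = \<zero>\<^bsub>X\<^esub>"
    and nrm_triangle: "x \<in> carrier X \<Longrightarrow> y \<in> carrier X \<Longrightarrow> nrm X (x \<oplus>\<^bsub>X\<^esub> y) \<le> nrm X x + nrm X y"
    and nrm_smult: "x \<in> carrier X \<Longrightarrow> nrm X (a \<odot>\<^bsub>X\<^esub> x) = norm a * nrm X x"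
    and complete:
      "range u \<subseteq> carrier X \<Longrightarrow>
       (\<forall>e>0. \<exists>N. \<forall>m\<ge>N. \<forall>n\<ge>N. nrm X (u m \<ominus>\<^bsub>X\<^esub> u n) < e) \<Longrightarrow>
       \<exists>x\<in>carrier X. (\<lambda>n::nat. nrm X (u n \<ominus>\<^bsub>X\<^esub> x)) \<longlonglongrightarrow> 0"

lemma banach_space_UNIV:
  "banach_space \<lparr>carrier = UNIV, mult = undefined, one = undefined, zero = 0, add = (+),
     smult = scaleR, nrm = (norm :: 'a::banach \<Rightarrow> real)\<rparr>" (is "banach_space ?X")
proof -
  have "cring (scalar_ring :: real ring)"
    by (rule cringI; (rule abelian_groupI comm_monoidI)?)
       (auto simp: scalar_ring_def algebra_simps intro: exI[of _ "- _"])
  moreover have grp: "abelian_group ?X"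
    by (rule abelian_groupI) (auto simp: algebra_simps intro: exI[of _ "- _"])
  ultimately have "module scalar_ring ?X"
    by (rule moduleI) (auto simp: scalar_ring_def algebra_simps)
  moreover have minus: "x \<ominus>\<^bsub>?X\<^esub> y = x - y" for x y :: 'a
  proof -
    have "\<ominus>\<^bsub>?X\<^esub> y = - y"
      using abelian_group.minus_equality[OF grp, of "- y" y] by simp
    then show ?thesis
      by (simp add: a_minus_def)
  qed
  moreover have "\<exists>x. (\<lambda>n. norm (u n - x)) \<longlonglongrightarrow> 0"
    if "\<forall>e>0. \<exists>N. \<forall>m\<ge>N. \<forall>n\<ge>N. norm (u m - u n) < e" for u :: "nat \<Rightarrow> 'a"
  proof -
    have "Cauchy u"
      using that by (auto simp: Cauchy_def dist_norm)
    then obtain x where "u \<longlonglongrightarrow> x"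
      by (auto simp: Cauchy_convergent_iff convergent_def)
    then show ?thesis
      by (intro exI tendsto_norm_zero LIM_zero)
  qed
  ultimately show ?thesis
    by (intro banach_space.intro banach_space_axioms.intro)
       (auto simp: norm_triangle_ineq)
qed

definition bounded_ops ::
    "('k::real_or_complex, 'a) normed_module \<Rightarrow> ('k, 'b) normed_module \<Rightarrow> ('a \<Rightarrow> 'b) set" where
  "bounded_ops X Y = {A \<in> carrier X \<rightarrow> carrier Y.
     (\<forall>x\<in>carrier X. \<forall>y\<in>carrier X. A (x \<oplus>\<^bsub>X\<^esub> y) = A x \<oplus>\<^bsub>Y\<^esub> A y) \<and>
     (\<forall>a. \<forall>x\<in>carrier X. A (a \<odot>\<^bsub>X\<^esub> x) = a \<odot>\<^bsub>Y\<^esub> A x) \<and>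
     (\<exists>C. \<forall>x\<in>carrier X. nrm Y (A x) \<le> C * nrm X x)}"

definition closed_subset :: "('k, 'a) normed_module \<Rightarrow> 'a set \<Rightarrow> bool" where
  "closed_subset X V \<longleftrightarrow> V \<subseteq> carrier X \<and>
     (\<forall>u. \<forall>x\<in>carrier X. range u \<subseteq> V \<longrightarrow> (\<lambda>n::nat. nrm X (u n \<ominus>\<^bsub>X\<^esub> x)) \<longlonglongrightarrow> 0 \<longrightarrow> x \<in> V)"

text \<open>Isomorphisms onto a closed subspace; the last conjunct bounds the inverse.\<close>

definition closed_embedding ::
    "('k::real_or_complex, 'a) normed_module \<Rightarrow> ('k, 'b) normed_module \<Rightarrow> ('a \<Rightarrow> 'b) \<Rightarrow> bool" where
  "closed_embedding X Y \<iota> \<longleftrightarrow> \<iota> \<in> bounded_ops X Y \<and> inj_on \<iota> (carrier X) \<and>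
     closed_subset Y (\<iota> ` carrier X) \<and>
     (\<exists>C. \<forall>x\<in>carrier X. nrm X x \<le> C * nrm Y (\<iota> x))"


section \<open>Reflexivity\<close>

definition scalar_space :: "('k::real_or_complex, 'k) normed_module" where
  "scalar_space = \<lparr>carrier = UNIV, mult = (*), one = 1, zero = 0, add = (+), smult = (*), nrm = norm\<rparr>"

text \<open>
  Functionals are extensional, so that equality in the dual is equality on \<open>carrier X\<close>.
\<close>

definition dual_space ::
    "('k::real_or_complex, 'a) normed_module \<Rightarrow> ('k, 'a \<Rightarrow> 'k) normed_module" where
  "dual_space X = \<lparr>
     carrier = bounded_ops X scalar_space \<inter> extensional (carrier X),
     mult = undefined, one = undefined,
     zero = (\<lambda>x\<in>carrier X. 0),
     add = (\<lambda>f g. \<lambda>x\<in>carrier X. f x + g x),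
     smult = (\<lambda>a f. \<lambda>x\<in>carrier X. a * f x),
     nrm = (\<lambda>f. SUP x\<in>{x \<in> carrier X. nrm X x \<le> 1}. norm (f x))\<rparr>"

definition reflexive :: "('k::real_or_complex, 'a) normed_module \<Rightarrow> bool" where
  "reflexive X \<longleftrightarrow> (\<forall>\<Phi>\<in>carrier (dual_space (dual_space X)).
     \<exists>x\<in>carrier X. \<Phi> = (\<lambda>f\<in>carrier (dual_space X). f x))"


section \<open>UMD spaces\<close>

text \<open>
  Elements of \<open>L\<^sup>p(\<real>;X)\<close> are represented by functions; identification up to null sets is made
  explicit where it matters.
\<close>

definition strongly_measurable :: "('k, 'a) normed_module \<Rightarrow> (real \<Rightarrow> 'a) \<Rightarrow> bool" where
  "strongly_measurable X f \<longleftrightarrow> range f \<subseteq> carrier X \<and>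
     (\<exists>s. (\<forall>n::nat. simple_function lebesgue (s n) \<and> range (s n) \<subseteq> carrier X) \<and>
          (AE t in lebesgue. (\<lambda>n. nrm X (s n t \<ominus>\<^bsub>X\<^esub> f t)) \<longlonglongrightarrow> 0))"

definition Lp :: "real \<Rightarrow> ('k, 'a) normed_module \<Rightarrow> (real \<Rightarrow> 'a) set" where
  "Lp p X = {f. strongly_measurable X f \<and> integrable lebesgue (\<lambda>t. nrm X (f t) powr p)}"

definition Lp_norm :: "real \<Rightarrow> ('k, 'a) normed_module \<Rightarrow> (real \<Rightarrow> 'a) \<Rightarrow> real" where
  "Lp_norm p X f = (LINT t|lebesgue. nrm X (f t) powr p) powr (1 / p)"

definition test_function :: "(real \<Rightarrow> real) \<Rightarrow> bool" where
  "test_function \<phi> \<longleftrightarrow> (\<forall>k::nat. (deriv ^^ k) \<phi> differentiable_on UNIV) \<and>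
     (\<exists>R. \<forall>t. \<bar>t\<bar> > R \<longrightarrow> \<phi> t = 0)"

text \<open>The principal value integral, which converges at every point for a test function.\<close>

definition hilbert_transform :: "(real \<Rightarrow> real) \<Rightarrow> real \<Rightarrow> real" where
  "hilbert_transform \<phi> t =
     Lim (at_right 0) (\<lambda>\<epsilon>. 1 / pi * (LINT s:{s. \<bar>t - s\<bar> > \<epsilon>}|lebesgue. \<phi> s / (t - s)))"

text \<open>
  The Hilbert transform acts on the functions \<open>\<Sum>i. \<phi>\<^sub>i \<otimes> x\<^sub>i\<close> by \<open>\<Sum>i. H \<phi>\<^sub>i \<otimes> x\<^sub>i\<close>. These functions are
  dense in \<open>L\<^sup>p(\<real>;X)\<close>, with real-valued \<open>\<phi>\<^sub>i\<close> also if the scalars are complex, and by linearity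
  the extension \<open>H\<close> is only prescribed on the functions \<open>\<phi> \<otimes> x\<close>. The property does not depend on
  \<open>p\<close> in the range \<open>1 < p < \<infinity>\<close>.
\<close>

definition UMD :: "('k::real_or_complex, 'a) normed_module \<Rightarrow> bool" where
  "UMD X \<longleftrightarrow> (\<exists>p>1. \<exists>H. H \<in> Lp p X \<rightarrow> Lp p X \<and>
     (\<forall>f\<in>Lp p X. \<forall>g\<in>Lp p X. AE t in lebesgue. H (\<lambda>s. f s \<oplus>\<^bsub>X\<^esub> g s) t = H f t \<oplus>\<^bsub>X\<^esub> H g t) \<and>
     (\<forall>a. \<forall>f\<in>Lp p X. AE t in lebesgue. H (\<lambda>s. a \<odot>\<^bsub>X\<^esub> f s) t = a \<odot>\<^bsub>X\<^esub> H f t) \<and>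
     (\<exists>C. \<forall>f\<in>Lp p X. Lp_norm p X (H f) \<le> C * Lp_norm p X f) \<and>
     (\<forall>\<phi>. \<forall>x\<in>carrier X. test_function \<phi> \<longrightarrow>
        (AE t in lebesgue. H (\<lambda>s. of_real (\<phi> s) \<odot>\<^bsub>X\<^esub> x) t = of_real (hilbert_transform \<phi> t) \<odot>\<^bsub>X\<^esub> x)))"


section \<open>Semigroups and groups\<close>

definition C0_semigroup ::
    "('k::real_or_complex, 'a) normed_module \<Rightarrow> (real \<Rightarrow> 'a \<Rightarrow> 'a) \<Rightarrow> bool" where
  "C0_semigroup X T \<longleftrightarrow> (\<forall>t\<ge>0. T t \<in> bounded_ops X X) \<and>
     (\<forall>x\<in>carrier X. T 0 x = x) \<and>
     (\<forall>s\<ge>0. \<forall>t\<ge>0. \<forall>x\<in>carrier X. T (s + t) x = T s (T t x)) \<and>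
     (\<forall>x\<in>carrier X. ((\<lambda>t. nrm X (T t x \<ominus>\<^bsub>X\<^esub> x)) \<longlongrightarrow> 0) (at_right 0))"

definition C0_group ::
    "('k::real_or_complex, 'a) normed_module \<Rightarrow> (real \<Rightarrow> 'a \<Rightarrow> 'a) \<Rightarrow> bool" where
  "C0_group X S \<longleftrightarrow> (\<forall>t. S t \<in> bounded_ops X X) \<and>
     (\<forall>x\<in>carrier X. S 0 x = x) \<and>
     (\<forall>s t. \<forall>x\<in>carrier X. S (s + t) x = S s (S t x)) \<and>
     (\<forall>x\<in>carrier X. ((\<lambda>t. nrm X (S t x \<ominus>\<^bsub>X\<^esub> x)) \<longlongrightarrow> 0) (at 0))"

end

theory Submission
  imports Defs
begin

text \<open>
  Part (a) follows from the local boundedness of the semigroup, because \<open>T(n t\<^sub>0) = T(s) T(t)\<close>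
  with \<open>0 \<le> s \<le> t\<^sub>0\<close>.

  For part (b), elements of \<open>Y\<close> are thought of as sums \<open>\<Sum>n. S(-n t\<^sub>0) x\<^sub>n\<close>: with weights
  \<open>w\<^sub>n = (2/c)\<^sup>n\<close>, \<open>Y\<close> is the quotient of the weighted sequence space \<open>Z = \<ell>\<^sup>p(w; X)\<close> by the
  range \<open>N\<close> of \<open>J = 1 - R A\<close>, where \<open>R\<close> is the right shift and \<open>A = T(t\<^sub>0)\<close> acts coordinatewise.
  Since \<open>\<parallel>R A u\<parallel> \<ge> 2 \<parallel>u\<parallel>\<close>, the operator \<open>J\<close> is bounded below, hence \<open>N\<close> is closed and \<open>X\<close>
  embeds into \<open>Y\<close> in the zeroth coordinate. Modulo \<open>N\<close> the shift \<open>R\<close> inverts \<open>A\<close>, which turns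
  the coordinatewise semigroup into a group.

  Reflexivity passes to \<open>Z\<close> and to quotients by the Hahn--Banach theorem. For UMD, \<open>p\<close> is the exponent for
  which the Hilbert transform of \<open>X\<close> is bounded. It acts coordinatewise on \<open>L\<^sup>p(\<real>; Z)\<close>, it commutes with \<open>A\<close> by
  density of the test functions and so preserves \<open>N = J Z\<close>, and functions in \<open>L\<^sup>p(\<real>; Y)\<close> lift to
  \<open>L\<^sup>p(\<real>; Z)\<close> with control of the norm.
\<close>

section \<open>Modules with a norm\<close>

text \<open>The ratio \<open>2 / c\<close> of consecutive weights is tuned to the hypothesis: the
  shift multiplies norms by \<open>2 / c\<close> and \<open>T t0\<close> by at least
  \<open>c\<close>. Of the resulting factor 2 the identity in \<open>J\<close> uses up 1, so
  \<open>J\<close> is bounded below with constant 1. Any ratio above \<open>1 / c\<close> would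
  serve, with other constants.

  The exponent of the sequences agrees with the exponent of integration so that, by Tonelli, the
  p-th power of the norm in L^p(R; Z) is a sum over coordinates; the bound of the Hilbert transform
  on X then transfers with the same constant. If X is not UMD, the exponent is 2.

  Elements of L^p are represented by functions, and the Hilbert transform is linear only almost
  everywhere. On Y it is defined through an arbitrarily chosen lift to Z. Two lifts of the same
  function differ almost everywhere by a function with values in N, and the coordinatewise transform
  keeps such a function in N almost everywhere. This gives both independence of the lift and
  linearity.\<close>

lemma scalar_ring_simps [simp]:
  "carrier scalar_ring = UNIV" "mult scalar_ring = (*)" "one scalar_ring = 1"
  "zero scalar_ring = 0" "add scalar_ring = (+)"
  by (simp_all add: scalar_ring_def)

lemma cring_scalar_ring: "cring (scalar_ring :: 'k::real_or_complex ring)"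
  by (rule cringI; (rule abelian_groupI comm_monoidI)?)
     (auto simp: algebra_simps intro: exI[of _ "- _"])

lemma scalar_ring_minus [simp]: "\<ominus>\<^bsub>scalar_ring\<^esub> (a :: 'k::real_or_complex) = - a"
proof -
  interpret cring "scalar_ring :: 'k ring" by (rule cring_scalar_ring)
  show ?thesis using minus_equality[of "-a" a] by simp
qed

text \<open>The axioms of \<open>banach_space\<close> without completeness. Duals are used only as
  normed spaces, and sequence spaces and quotients are normed before they are shown to be
  complete.\<close>

locale normed_mod = module scalar_ring X
  for X :: "('k::real_or_complex, 'a) normed_module" (structure) +
  assumes norm_ge0: "x \<in> carrier X \<Longrightarrow> 0 \<le> nrm X x"
    and norm_0_iff: "x \<in> carrier X \<Longrightarrow> nrm X x = 0 \<longleftrightarrow> x = \<zero>"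
    and norm_triangle: "x \<in> carrier X \<Longrightarrow> y \<in> carrier X \<Longrightarrow> nrm X (x \<oplus> y) \<le> nrm X x + nrm X y"
    and norm_smult: "x \<in> carrier X \<Longrightarrow> nrm X (a \<odot> x) = norm a * nrm X x"

sublocale banach_space \<subseteq> normed_mod
  by unfold_locales (fact nrm_nonneg nrm_eq_0_iff nrm_triangle nrm_smult)+


context normed_mod begin
lemma minus_smult: "x \<in> carrier X \<Longrightarrow> y \<in> carrier X \<Longrightarrow> x \<ominus> y = x \<oplus> (-1) \<odot> y"
  using smult_l_minus[of 1 y] smult_one[of y] by (simp add: a_minus_def)
lemma minus_eq_0_iff: "x \<in> carrier X \<Longrightarrow> y \<in> carrier X \<Longrightarrow> x \<ominus> y = \<zero> \<longleftrightarrow> x = y"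
  by (metis M.minus_equality M.minus_minus M.add.inv_closed a_minus_def M.r_neg)
lemma add_minus_add: "\<lbrakk>x \<in> carrier X; y \<in> carrier X; x' \<in> carrier X; y' \<in> carrier X\<rbrakk> \<Longrightarrow> 
  (x \<oplus> y) \<ominus> (x' \<oplus> y') = (x \<ominus> x') \<oplus> (y \<ominus> y')"
  by (simp add: a_minus_def M.minus_add M.a_ac)
lemma add_diff_self: "\<lbrakk>x \<in> carrier X; y \<in> carrier X\<rbrakk> \<Longrightarrow> y \<oplus> (x \<ominus> y) = x"
  by (simp add: a_minus_def M.a_lcomm M.r_neg)
lemma diff_add_self: "\<lbrakk>x \<in> carrier X; y \<in> carrier X\<rbrakk> \<Longrightarrow> (x \<ominus> y) \<oplus> y = x"
  by (simp add: a_minus_def M.a_assoc M.l_neg)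
lemma diff_split: "\<lbrakk>x \<in> carrier X; y \<in> carrier X; z \<in> carrier X\<rbrakk> \<Longrightarrow> x \<ominus> z = (x \<ominus> y) \<oplus> (y \<ominus> z)"
  by (simp add: a_minus_def M.a_assoc M.r_neg1)
lemma add_diff_cancel: "\<lbrakk>x \<in> carrier X; y \<in> carrier X\<rbrakk> \<Longrightarrow> (x \<oplus> y) \<ominus> y = x"
  by (simp add: a_minus_def M.a_assoc M.r_neg)
lemma diff_self: "x \<in> carrier X \<Longrightarrow> x \<ominus> x = \<zero>"
  by (simp add: a_minus_def M.r_neg)
lemma diff_zero: "x \<in> carrier X \<Longrightarrow> x \<ominus> \<zero> = x"
  by (simp add: a_minus_def)
lemma smult_diff: "x \<in> carrier X \<Longrightarrow> y \<in> carrier X \<Longrightarrow> a \<odot> (x \<ominus> y) = a \<odot> x \<ominus> a \<odot> y"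
  by (simp add: minus_smult smult_r_distr smult_assoc1[symmetric, simplified])
lemma smult_minus_left: "x \<in> carrier X \<Longrightarrow> (a - b) \<odot> x = a \<odot> x \<ominus> b \<odot> x"
  by (simp add: minus_smult smult_assoc1[symmetric, simplified] smult_l_distr[symmetric, simplified])
lemma norm_zero [simp]: "nrm X \<zero> = 0"
  by (simp add: norm_0_iff)
lemma norm_minus_commute: "x \<in> carrier X \<Longrightarrow> y \<in> carrier X \<Longrightarrow> nrm X (x \<ominus> y) = nrm X (y \<ominus> x)"
  using norm_smult[of "x \<ominus> y" "-1"] by (simp add: smult_diff) 
  (simp add: minus_smult smult_assoc1[symmetric, simplified] smult_one[simplified] M.a_comm)
end

section \<open>Bounded operators and uniform boundedness\<close>

lemmas (in normed_mod) smult_assoc = smult_assoc1[symmetric, simplified]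
lemmas (in normed_mod) smult_add_left = smult_l_distr[simplified]
lemmas (in normed_mod) smult_add_right = smult_r_distr[simplified]
lemmas (in normed_mod) one_smult [simp] = smult_one[simplified]
lemmas (in normed_mod) zero_smult [simp] = smult_l_null[simplified]
lemmas (in normed_mod) smult_zero [simp] = smult_r_null[simplified]
lemmas (in normed_mod) smult_cl [simp, intro] = smult_closed[simplified]

section \<open>Sequential limits and completeness through rapidly converging sequences\<close>

definition tends :: "('k, 'a) normed_module \<Rightarrow> (nat \<Rightarrow> 'a) \<Rightarrow> 'a \<Rightarrow> bool" where
  "tends X u x \<longleftrightarrow> (\<lambda>n. nrm X (u n \<ominus>\<^bsub>X\<^esub> x)) \<longlonglongrightarrow> 0"

lemma LIMSEQ_0_lessD: "f \<longlonglongrightarrow> (0::real) \<Longrightarrow> 0 < e \<Longrightarrow> \<exists>N. \<forall>n\<ge>N. f n < e"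
  using order_tendstoD(2)[of f 0 sequentially e] by (simp add: eventually_sequentially)

context normed_mod begin

lemma norm_diff_le: "x \<in> carrier X \<Longrightarrow> y \<in> carrier X \<Longrightarrow> nrm X (x \<ominus> y) \<le> nrm X x + nrm X y"
  using norm_triangle[of x "(-1) \<odot> y"] norm_smult[of y "-1"] by (simp add: minus_smult)

lemma norm_diff_triangle:
  "\<lbrakk>x \<in> carrier X; y \<in> carrier X; z \<in> carrier X\<rbrakk> \<Longrightarrow> nrm X (x \<ominus> z) \<le> nrm X (x \<ominus> y) + nrm X (y \<ominus> z)"
  using norm_triangle[of "x \<ominus> y" "y \<ominus> z"] diff_split[of x y z] by simp

lemma abs_norm_diff_le:
  assumes "x \<in> carrier X" "y \<in> carrier X"
  shows "\<bar>nrm X x - nrm X y\<bar> \<le> nrm X (x \<ominus> y)"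
  using norm_triangle[of y "x \<ominus> y"] norm_triangle[of x "y \<ominus> x"] assms norm_minus_commute[of x y]
  by (simp add: add_diff_self)

lemma norm_le_add_diff:
  assumes "x \<in> carrier X" "y \<in> carrier X"
  shows "nrm X x \<le> nrm X y + nrm X (x \<ominus> y)"
  using abs_norm_diff_le[OF assms] by linarith

lemma tends_norm:
  assumes "tends X u x" "range u \<subseteq> carrier X" "x \<in> carrier X"
  shows "(\<lambda>n. nrm X (u n)) \<longlonglongrightarrow> nrm X x"
proof -
  have "(\<lambda>n. nrm X (u n) - nrm X x) \<longlonglongrightarrow> 0"
    by (rule Lim_null_comparison[OF _ assms(1)[unfolded tends_def]])
      (use assms abs_norm_diff_le in \<open>auto intro!: always_eventually simp: image_subset_iff\<close>)
  then show ?thesis by (simp add: LIM_zero_iff)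
qed

lemma tends_unique:
  assumes "tends X u x" "tends X u y" "range u \<subseteq> carrier X" "x \<in> carrier X" "y \<in> carrier X"
  shows "x = y"
proof -
  have "(\<lambda>n. nrm X (u n \<ominus> x) + nrm X (u n \<ominus> y)) \<longlonglongrightarrow> 0 + 0"
    using assms(1,2) unfolding tends_def by (rule tendsto_add)
  moreover have "nrm X (x \<ominus> y) \<le> nrm X (u n \<ominus> x) + nrm X (u n \<ominus> y)" for n
    using norm_diff_triangle[of x "u n" y] norm_minus_commute[of x "u n"] assms by auto
  ultimately have "nrm X (x \<ominus> y) \<le> 0"
    by (intro LIMSEQ_le_const) auto
  then show ?thesis using norm_ge0[of "x \<ominus> y"] norm_0_iff[of "x \<ominus> y"] minus_eq_0_iff assms by auto
qed

lemma tends_cmp: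
  assumes "\<And>n. nrm X (u n \<ominus> x) \<le> f n" "f \<longlonglongrightarrow> 0" "range u \<subseteq> carrier X" "x \<in> carrier X"
  shows "tends X u x"
  unfolding tends_def
  by (rule Lim_null_comparison[OF _ assms(2)])
    (use assms(1,3,4) norm_ge0 in \<open>auto intro!: always_eventually simp: image_subset_iff\<close>)

lemma tends_add:
  assumes "tends X u x" "tends X v y" "range u \<subseteq> carrier X" "range v \<subseteq> carrier X" "x \<in> carrier X" "y \<in> carrier X"
  shows "tends X (\<lambda>n. u n \<oplus> v n) (x \<oplus> y)"
proof (rule tends_cmp)
  show "(\<lambda>n. nrm X (u n \<ominus> x) + nrm X (v n \<ominus> y)) \<longlonglongrightarrow> 0"
    using tendsto_add[OF assms(1,2)[unfolded tends_def]] by simp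
  show "nrm X (u n \<oplus> v n \<ominus> (x \<oplus> y)) \<le> nrm X (u n \<ominus> x) + nrm X (v n \<ominus> y)" for n
  proof -
    have "u n \<in> carrier X" "v n \<in> carrier X" using assms(3,4) by auto
    then show ?thesis using assms(5,6) by (simp add: add_minus_add norm_triangle)
  qed
qed (use assms in auto)

lemma tends_smult:
  assumes "tends X u x" "range u \<subseteq> carrier X" "x \<in> carrier X"
  shows "tends X (\<lambda>n. a \<odot> u n) (a \<odot> x)"
proof -
  have "nrm X (a \<odot> u n \<ominus> a \<odot> x) = norm a * nrm X (u n \<ominus> x)" for n
  proof -
    have "u n \<in> carrier X" using assms(2) by auto
    then show ?thesis using assms(3) by (simp add: smult_diff[symmetric] norm_smult)
  qed
  then show ?thesis using tendsto_mult_right_zero[OF assms(1)[unfolded tends_def]]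
    by (simp add: tends_def)
qed

lemma fast_dist:
  assumes u: "range u \<subseteq> carrier X" and \<rho>: "0 < \<rho>" "\<rho> < 1"
    and step: "\<And>n. nrm X (u (Suc n) \<ominus> u n) \<le> K * \<rho> ^ n"
  shows "nrm X (u (n + k) \<ominus> u n) \<le> K * \<rho> ^ n / (1 - \<rho>)"
proof -
  have uc: "u i \<in> carrier X" for i using u by auto
  have "0 \<le> K" using step[of 0] norm_ge0[of "u (Suc 0) \<ominus> u 0"] uc by auto
  \<comment> \<open>The induction on \<open>k\<close> runs with the exact partial geometric sum; the
    final bound with \<open>1 / (1 - \<rho>)\<close> is not inductive.\<close>
  have "nrm X (u (n + k) \<ominus> u n) \<le> K * \<rho> ^ n * ((1 - \<rho> ^ k) / (1 - \<rho>))"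
  proof (induction k)
    case 0 then show ?case using uc by (simp add: diff_self)
  next
    case (Suc k)
    have "nrm X (u (n + Suc k) \<ominus> u n) \<le> K * \<rho> ^ (n + k) + nrm X (u (n + k) \<ominus> u n)"
      using norm_diff_triangle[OF uc uc uc, of "Suc (n + k)" n "n + k"] step[of "n + k"] by simp
    also have "\<dots> \<le> K * \<rho> ^ n * (\<rho> ^ k + (1 - \<rho> ^ k) / (1 - \<rho>))"
      using Suc by (simp add: power_add algebra_simps)
    also have "\<rho> ^ k + (1 - \<rho> ^ k) / (1 - \<rho>) = (1 - \<rho> ^ Suc k) / (1 - \<rho>)"
      using \<rho> by (simp add: field_simps)
    finally show ?case .
  qed
  also have "\<dots> \<le> K * \<rho> ^ n * (1 / (1 - \<rho>))"
    using \<rho> \<open>0 \<le> K\<close> by (intro mult_left_mono divide_right_mono) auto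
  finally show ?thesis by simp
qed

text \<open>Every Cauchy sequence has a subsequence with increments below \<open>(1/2) ^ n\<close>,
  and a limit of a subsequence is a limit of the whole Cauchy sequence.\<close>

lemma banach_spaceI_fast:
  assumes "\<And>u. range u \<subseteq> carrier X \<Longrightarrow> (\<And>n. nrm X (u (Suc n) \<ominus> u n) \<le> (1/2) ^ n) \<Longrightarrow>
    \<exists>x\<in>carrier X. tends X u x"
  shows "banach_space X"
proof unfold_locales
  fix u :: "nat \<Rightarrow> _" assume u: "range u \<subseteq> carrier X"
    and c: "\<forall>e>0. \<exists>N. \<forall>m\<ge>N. \<forall>n\<ge>N. nrm X (u m \<ominus> u n) < e"
  have uc: "u i \<in> carrier X" for i using u by auto
  have "\<forall>k. \<exists>N. \<forall>m\<ge>N. \<forall>n\<ge>N. nrm X (u m \<ominus> u n) < (1/2)^k" using c by simp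
  then obtain N where N: "\<And>k m n. m \<ge> N k \<Longrightarrow> n \<ge> N k \<Longrightarrow> nrm X (u m \<ominus> u n) < (1/2)^k" by metis
  \<comment> \<open>The maximum puts both \<open>M k\<close> and \<open>M (Suc k)\<close> beyond the
    threshold \<open>N k\<close>; the summand \<open>k\<close> makes the indices unbounded.\<close>
  define M where "M k = k + Max (N ` {..k})" for k
  have M: "N k \<le> M k" "k \<le> M k" "N k \<le> M (Suc k)" for k
  proof -
    have "N k \<le> Max (N ` {..j})" if "k \<le> j" for j using that by (intro Max_ge) auto
    from this[of k] this[of "Suc k"] show "N k \<le> M k" "k \<le> M k" "N k \<le> M (Suc k)"
      unfolding M_def by linarith+
  qed
  have "\<exists>x\<in>carrier X. tends X (\<lambda>k. u (M k)) x"
    using uc less_imp_le[OF N[OF M(3) M(1)]] by (intro assms) auto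
  then obtain x where x: "x \<in> carrier X" "tends X (\<lambda>k. u (M k)) x" by auto
  have "tends X u x" unfolding tends_def
  proof (rule LIMSEQ_I)
    fix e :: real assume "e > 0"
    obtain N1 where N1: "\<And>m n. m \<ge> N1 \<Longrightarrow> n \<ge> N1 \<Longrightarrow> nrm X (u m \<ominus> u n) < e/2"
      using c \<open>e > 0\<close> by (meson half_gt_zero)
    obtain K where K: "\<And>k. k \<ge> K \<Longrightarrow> nrm X (u (M k) \<ominus> x) < e/2"
      using LIMSEQ_0_lessD[OF x(2)[unfolded tends_def], of "e/2"] \<open>e > 0\<close> by auto
    have "nrm X (u n \<ominus> x) < e" if "n \<ge> N1" for n
      using norm_diff_triangle[OF uc uc x(1), of n "M (max K N1)"] K[of "max K N1"]
        N1[OF that, of "M (max K N1)"] M(2)[of "max K N1"] by auto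
    then show "\<exists>n0. \<forall>n\<ge>n0. norm (nrm X (u n \<ominus> x) - 0) < e"
      using uc x(1) norm_ge0 by (intro exI[of _ N1]) auto
  qed
  then show "\<exists>x\<in>carrier X. (\<lambda>n. nrm X (u n \<ominus> x)) \<longlonglongrightarrow> 0" using x(1) unfolding tends_def by auto
qed (fact norm_ge0 norm_0_iff norm_triangle norm_smult)+

end

text \<open>Letting the second index tend to infinity in \<open>fast_dist\<close> keeps the
  geometric error bound. That bound controls the tail in the gliding hump and the norm of the lifts
  from the quotient.\<close>

lemma (in banach_space) complete_fast:
  assumes uc: "\<And>n. u n \<in> carrier X" and \<rho>: "0 < \<rho>" "\<rho> < 1"
    and step: "\<And>n. nrm X (u (Suc n) \<ominus> u n) \<le> K * \<rho> ^ n"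
  shows "\<exists>x\<in>carrier X. tends X u x \<and> (\<forall>n. nrm X (u n \<ominus> x) \<le> K * \<rho> ^ n / (1 - \<rho>))"
proof -
  have u: "range u \<subseteq> carrier X" using uc by auto
  note d = fast_dist[OF u \<rho> step]
  have "K \<ge> 0" using step[of 0] norm_ge0[of "u (Suc 0) \<ominus> u 0"] uc by auto
  have lim0: "(\<lambda>n. K * \<rho> ^ n / (1 - \<rho>)) \<longlonglongrightarrow> 0"
    using \<rho> by (auto intro!: tendsto_eq_intros LIMSEQ_realpow_zero)
  have "\<exists>x\<in>carrier X. (\<lambda>n. nrm X (u n \<ominus> x)) \<longlonglongrightarrow> 0"
  proof (rule complete[OF u], intro allI impI)
    fix e :: real assume "e > 0"
    obtain N where N: "K * \<rho> ^ N / (1 - \<rho>) < e / 2"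
      using LIMSEQ_0_lessD[OF lim0, of "e/2"] \<open>e > 0\<close> by auto
    have "nrm X (u m \<ominus> u n) < e" if "m \<ge> N" "n \<ge> N" for m n
      using d[of N "m - N"] d[of N "n - N"] norm_diff_triangle[OF uc uc uc, of m n N]
        norm_minus_commute[OF uc uc, of N n] N that
      unfolding le_add_diff_inverse[OF that(1)] le_add_diff_inverse[OF that(2)] by linarith
    then show "\<exists>N. \<forall>m\<ge>N. \<forall>n\<ge>N. nrm X (u m \<ominus> u n) < e" by blast
  qed
  then obtain x where x: "x \<in> carrier X" "tends X u x" unfolding tends_def by auto
  moreover have "nrm X (u n \<ominus> x) \<le> K * \<rho> ^ n / (1 - \<rho>)" for n
  proof -
    have "(\<lambda>k. nrm X (u (n + k) \<ominus> x)) \<longlonglongrightarrow> 0"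
      using LIMSEQ_ignore_initial_segment[OF x(2)[unfolded tends_def], of n] by (simp add: add.commute)
    then have "(\<lambda>k. K * \<rho> ^ n / (1 - \<rho>) + nrm X (u (n + k) \<ominus> x)) \<longlonglongrightarrow> K * \<rho> ^ n / (1 - \<rho>) + 0"
      by (intro tendsto_intros)
    moreover have "nrm X (u n \<ominus> x) \<le> K * \<rho> ^ n / (1 - \<rho>) + nrm X (u (n + k) \<ominus> x)" for k
      using norm_diff_triangle[OF uc uc x(1), of n "n + k"] d[of n k] norm_minus_commute[OF uc uc, of n "n + k"]
      by linarith
    ultimately show ?thesis by (intro LIMSEQ_le_const) auto
  qed
  ultimately show ?thesis by blast
qed

section \<open>Bounded operators and their norms\<close>

lemma bounded_opsI:
  assumes "\<And>x. x \<in> carrier X \<Longrightarrow> A x \<in> carrier Y"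
    "\<And>x y. x \<in> carrier X \<Longrightarrow> y \<in> carrier X \<Longrightarrow> A (x \<oplus>\<^bsub>X\<^esub> y) = A x \<oplus>\<^bsub>Y\<^esub> A y"
    "\<And>a x. x \<in> carrier X \<Longrightarrow> A (a \<odot>\<^bsub>X\<^esub> x) = a \<odot>\<^bsub>Y\<^esub> A x"
    "\<And>x. x \<in> carrier X \<Longrightarrow> nrm Y (A x) \<le> C * nrm X x"
  shows "A \<in> bounded_ops X Y"
  using assms unfolding bounded_ops_def by blast

lemma bounded_ops_cl: "A \<in> bounded_ops X Y \<Longrightarrow> x \<in> carrier X \<Longrightarrow> A x \<in> carrier Y"
  and bounded_ops_add: "A \<in> bounded_ops X Y \<Longrightarrow> x \<in> carrier X \<Longrightarrow> y \<in> carrier X \<Longrightarrow> A (x \<oplus>\<^bsub>X\<^esub> y) = A x \<oplus>\<^bsub>Y\<^esub> A y"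
  and bounded_ops_smult: "A \<in> bounded_ops X Y \<Longrightarrow> x \<in> carrier X \<Longrightarrow> A (a \<odot>\<^bsub>X\<^esub> x) = a \<odot>\<^bsub>Y\<^esub> A x"
  by (auto simp: bounded_ops_def)

lemma bounded_ops_comp:
  assumes "A \<in> bounded_ops X Y" "B \<in> bounded_ops Y Z" "\<And>y. y \<in> carrier Y \<Longrightarrow> 0 \<le> nrm Y y"
  shows "(\<lambda>x. B (A x)) \<in> bounded_ops X Z"
proof -
  obtain C where C: "\<And>x. x \<in> carrier X \<Longrightarrow> nrm Y (A x) \<le> C * nrm X x"
    using assms(1) unfolding bounded_ops_def by blast
  obtain D where D: "\<And>x. x \<in> carrier Y \<Longrightarrow> nrm Z (B x) \<le> D * nrm Y x"
    using assms(2) unfolding bounded_ops_def by blast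
  show ?thesis
  proof (rule bounded_opsI)
    fix x assume x: "x \<in> carrier X"
    have "nrm Z (B (A x)) \<le> D * nrm Y (A x)" using D bounded_ops_cl[OF assms(1) x] by auto
    \<comment> \<open>The sign of a bounding constant is not prescribed, and the next estimate
      multiplies by it.\<close>
    also have "\<dots> \<le> \<bar>D\<bar> * nrm Y (A x)"
      using assms(3)[OF bounded_ops_cl[OF assms(1) x]] by (intro mult_right_mono) auto
    also have "\<dots> \<le> \<bar>D\<bar> * (C * nrm X x)" using C x by (intro mult_left_mono) auto
    finally show "nrm Z (B (A x)) \<le> (\<bar>D\<bar> * C) * nrm X x" by (simp add: mult.assoc)
  qed (use assms in \<open>auto simp: bounded_ops_add bounded_ops_smult bounded_ops_cl\<close>)
qed

locale op = X: normed_mod X + Y: normed_mod Y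
  for X :: "('k::real_or_complex, 'a) normed_module" and Y :: "('k, 'b) normed_module" +
  fixes A assumes A: "A \<in> bounded_ops X Y"
begin

lemmas cl [simp] = bounded_ops_cl[OF A]
lemmas add = bounded_ops_add[OF A]
lemmas smult = bounded_ops_smult[OF A]

lemma zero: "A \<zero>\<^bsub>X\<^esub> = \<zero>\<^bsub>Y\<^esub>"
  using smult[of "\<zero>\<^bsub>X\<^esub>" 0] by simp

lemma diff: "x \<in> carrier X \<Longrightarrow> y \<in> carrier X \<Longrightarrow> A (x \<ominus>\<^bsub>X\<^esub> y) = A x \<ominus>\<^bsub>Y\<^esub> A y"
  by (simp add: X.minus_smult Y.minus_smult add smult)

lemma bound: "\<exists>C>0. \<forall>x\<in>carrier X. nrm Y (A x) \<le> C * nrm X x"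
proof -
  obtain C where C: "\<And>x. x \<in> carrier X \<Longrightarrow> nrm Y (A x) \<le> C * nrm X x"
    using A unfolding bounded_ops_def by blast
  have "nrm Y (A x) \<le> (\<bar>C\<bar> + 1) * nrm X x" if "x \<in> carrier X" for x
    using C[OF that] mult_right_mono[of C "\<bar>C\<bar> + 1" "nrm X x"] X.norm_ge0[OF that] by linarith
  then show ?thesis by (intro exI[of _ "\<bar>C\<bar> + 1"]) auto
qed

lemma tends:
  assumes "tends X u x" "range u \<subseteq> carrier X" "x \<in> carrier X"
  shows "tends Y (\<lambda>n. A (u n)) (A x)"
proof -
  obtain C where C: "C > 0" "\<And>x. x \<in> carrier X \<Longrightarrow> nrm Y (A x) \<le> C * nrm X x"
    using bound by metis
  show ?thesis
  proof (rule Y.tends_cmp)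
    show "nrm Y (A (u n) \<ominus>\<^bsub>Y\<^esub> A x) \<le> C * nrm X (u n \<ominus>\<^bsub>X\<^esub> x)" for n
      using C(2)[of "u n \<ominus>\<^bsub>X\<^esub> x"] assms(2,3) by (subst diff[symmetric]) auto
    show "(\<lambda>n. C * nrm X (u n \<ominus>\<^bsub>X\<^esub> x)) \<longlonglongrightarrow> 0"
      using tendsto_mult_right_zero[OF assms(1)[unfolded tends_def]] by simp
  qed (use assms in auto)
qed

text \<open>The formula is the one in \<open>dual_space\<close>; with scalar values the following
  facts become the norm estimates of the dual.\<close>

definition opnrm :: real where "opnrm = (SUP x\<in>{x \<in> carrier X. nrm X x \<le> 1}. nrm Y (A x))"

lemma opnrm_upper1:
  assumes "x \<in> carrier X" "nrm X x \<le> 1"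
  shows "nrm Y (A x) \<le> opnrm"
proof -
  obtain C where C: "C > 0" "\<And>x. x \<in> carrier X \<Longrightarrow> nrm Y (A x) \<le> C * nrm X x"
    using bound by metis
  show ?thesis unfolding opnrm_def
  proof (rule cSUP_upper)
    show "bdd_above ((\<lambda>x. nrm Y (A x)) ` {x \<in> carrier X. nrm X x \<le> 1})"
    proof (rule bdd_aboveI2[of _ _ C])
      fix x assume x: "x \<in> {x \<in> carrier X. nrm X x \<le> 1}"
      have "C * nrm X x \<le> C * 1" using x C(1) by (intro mult_left_mono) auto
      then show "nrm Y (A x) \<le> C" using C(2)[of x] x by simp
    qed
  qed (use assms in auto)
qed

lemma opnrm_ge0: "0 \<le> opnrm"
  using opnrm_upper1[of "\<zero>\<^bsub>X\<^esub>"] zero by simp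

lemma opnrm_bound:
  assumes x: "x \<in> carrier X"
  shows "nrm Y (A x) \<le> opnrm * nrm X x"
proof (cases "nrm X x = 0")
  case True
  then show ?thesis using X.norm_0_iff[OF x] zero by simp
next
  case False
  then have n: "nrm X x > 0" using X.norm_ge0[OF x] by simp
  have "nrm Y (A (of_real (1 / nrm X x) \<odot>\<^bsub>X\<^esub> x)) \<le> opnrm"
    by (rule opnrm_upper1) (use x n in \<open>auto simp: X.norm_smult norm_divide\<close>)
  then show ?thesis using x n by (simp add: smult Y.norm_smult norm_divide field_simps)
qed

lemma opnrm_least: "(\<And>x. x \<in> carrier X \<Longrightarrow> nrm X x \<le> 1 \<Longrightarrow> nrm Y (A x) \<le> C) \<Longrightarrow> opnrm \<le> C"
  unfolding opnrm_def by (rule cSUP_least) (auto intro!: exI[of _ "\<zero>\<^bsub>X\<^esub>"])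

end

text \<open>
  Gliding hump: steps \<open>v k\<close> of size \<open>4\<^sup>-\<^sup>k\<close> are added whenever \<open>A (i k)\<close> is not yet large at the current point;
  the remaining steps are too small to undo this.
\<close>

theorem uniform_boundedness:
  fixes X :: "('k::real_or_complex, 'a) normed_module" and Y :: "('k, 'b) normed_module"
    and A :: "'i \<Rightarrow> 'a \<Rightarrow> 'b"
  assumes "banach_space X" "normed_mod Y"
    and A: "\<And>i. i \<in> I \<Longrightarrow> A i \<in> bounded_ops X Y"
    and pw: "\<And>x. x \<in> carrier X \<Longrightarrow> \<exists>B. \<forall>i\<in>I. nrm Y (A i x) \<le> B"
  shows "\<exists>C>0. \<forall>i\<in>I. \<forall>x\<in>carrier X. nrm Y (A i x) \<le> C * nrm X x"
proof (rule ccontr)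
  assume neg: "\<not> ?thesis"
  interpret X: banach_space X by fact
  interpret Y: normed_mod Y by fact
  define \<nu> where "\<nu> = op.opnrm X Y"
  have op: "op X Y (A i)" if "i \<in> I" for i
    using A[OF that] by unfold_locales
  \<comment> \<open>The operator norm exceeds \<open>8 ^ k\<close> while the step has size
    \<open>(1/4) ^ k\<close>, so step \<open>k\<close> contributes a value of order
    \<open>2 ^ k\<close>. The factor 9/10 replaces a maximizer on the unit ball, which need not
    exist.\<close>
  have ex: "\<exists>i v. i \<in> I \<and> \<nu> (A i) > 8 ^ k \<and> v \<in> carrier X \<and> nrm X v \<le> (1/4) ^ k
     \<and> nrm Y (A i v) \<ge> 9/10 * (1/4)^k * \<nu> (A i)" for k :: nat
  proof -
    obtain i x where i: "i \<in> I" and x: "x \<in> carrier X" "nrm Y (A i x) > 8 ^ k * nrm X x"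
    proof -
      have "(8::real) ^ k > 0" by simp
      then have "\<not> (\<forall>i\<in>I. \<forall>x\<in>carrier X. nrm Y (A i x) \<le> 8 ^ k * nrm X x)"
        using neg by blast
      then show ?thesis using that by (auto simp: not_le)
    qed
    interpret op X Y "A i" by (rule op[OF i])
    have "8 ^ k * nrm X x < opnrm * nrm X x"
      using opnrm_bound[OF x(1)] x(2) by linarith
    then have big: "opnrm > 8 ^ k" using X.norm_ge0[OF x(1)] by (simp add: mult_less_cancel_right)
    then have "9/10 * opnrm < opnrm" using less_trans[OF zero_less_power[of "8::real" k] big] by simp
    then obtain v where v: "v \<in> carrier X" "nrm X v \<le> 1" "nrm Y (A i v) > 9/10 * opnrm"
    proof -
      have "\<exists>v. v \<in> carrier X \<and> nrm X v \<le> 1 \<and> nrm Y (A i v) > 9/10 * opnrm"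
      proof (rule ccontr)
        assume "\<not> ?thesis"
        then have "opnrm \<le> 9/10 * opnrm" by (intro opnrm_least) (auto simp: not_less)
        then show False using \<open>9/10 * opnrm < opnrm\<close> by linarith
      qed
      then show ?thesis using that by blast
    qed
    define q where "q = (1/4::real) ^ k"
    have q: "q > 0" unfolding q_def by simp
    have "nrm X (of_real q \<odot>\<^bsub>X\<^esub> v) \<le> q"
      using v q by (simp add: X.norm_smult)
    moreover have "nrm Y (A i (of_real q \<odot>\<^bsub>X\<^esub> v)) = q * nrm Y (A i v)"
      using v q by (simp add: smult Y.norm_smult)
    moreover have "q * nrm Y (A i v) \<ge> q * (9/10 * opnrm)"
      using v q by (intro mult_left_mono) auto
    ultimately have "i \<in> I \<and> \<nu> (A i) > 8 ^ k \<and> of_real q \<odot>\<^bsub>X\<^esub> v \<in> carrier X \<and> nrm X (of_real q \<odot>\<^bsub>X\<^esub> v) \<le> q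
     \<and> nrm Y (A i (of_real q \<odot>\<^bsub>X\<^esub> v)) \<ge> 9/10 * q * \<nu> (A i)"
      using i big v(1) unfolding \<nu>_def by (auto simp: algebra_simps)
    then show ?thesis unfolding q_def by blast
  qed
  define Q where "Q k p \<longleftrightarrow> fst p \<in> I \<and> \<nu> (A (fst p)) > 8 ^ k \<and> snd p \<in> carrier X \<and> nrm X (snd p) \<le> (1/4) ^ k
     \<and> nrm Y (A (fst p) (snd p)) \<ge> 9/10 * (1/4)^k * \<nu> (A (fst p))" for k p
  have "\<exists>p. Q k p" for k
  proof -
    obtain i v where "i \<in> I \<and> \<nu> (A i) > 8 ^ k \<and> v \<in> carrier X \<and> nrm X v \<le> (1/4) ^ k
     \<and> nrm Y (A i v) \<ge> 9/10 * (1/4)^k * \<nu> (A i)" using ex[of k] by (elim exE)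
    then have "Q k (i, v)" unfolding Q_def fst_conv snd_conv .
    then show ?thesis by (rule exI)
  qed
  then have p: "Q k (SOME p. Q k p)" for k by (rule someI_ex)
  define p where "p k = (SOME p. Q k p)" for k
  note p = p[folded p_def]
  define i v where "i k = fst (p k)" and "v k = snd (p k)" for k
  have i: "\<And>k. i k \<in> I" and big: "\<And>k. \<nu> (A (i k)) > 8 ^ k" and v: "\<And>k. v k \<in> carrier X"
    "\<And>k. nrm X (v k) \<le> (1/4) ^ k" and Av: "\<And>k. nrm Y (A (i k) (v k)) \<ge> 9/10 * (1/4)^k * \<nu> (A (i k))"
    using p[unfolded Q_def] unfolding i_def v_def by simp_all
  define u where "u = rec_nat \<zero>\<^bsub>X\<^esub> (\<lambda>k x. if nrm Y (A (i k) x) \<ge> nrm Y (A (i k) (v k)) / 2 then x else x \<oplus>\<^bsub>X\<^esub> v k)"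
  have u_Suc: "u (Suc k) = (if nrm Y (A (i k) (u k)) \<ge> nrm Y (A (i k) (v k)) / 2 then u k else u k \<oplus>\<^bsub>X\<^esub> v k)" for k
    by (simp add: u_def)
  have uc: "u k \<in> carrier X" for k
  proof (induction k)
    case 0 show ?case by (simp add: u_def)
  next
    case (Suc k) then show ?case using v by (simp add: u_Suc)
  qed
  have Au: "nrm Y (A (i k) (u (Suc k))) \<ge> 9/20 * (1/4)^k * \<nu> (A (i k))" for k
  proof -
    interpret op X Y "A (i k)" by (rule op[OF i])
    \<comment> \<open>As \<open>v k\<close> is the difference of \<open>u k \<oplus> v k\<close> and
      \<open>u k\<close>, the image of one of these has at least half the norm of the image of
      \<open>v k\<close>.\<close>
    have "nrm Y (A (i k) (v k)) \<le> nrm Y (A (i k) (u k)) + nrm Y (A (i k) (u k \<oplus>\<^bsub>X\<^esub> v k))"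
      using Y.norm_diff_le[of "A (i k) (u k \<oplus>\<^bsub>X\<^esub> v k)" "A (i k) (u k)"] uc[of k] v(1)[of k]
      by (simp add: add Y.M.a_comm[of "A (i k) (u k)"] Y.add_diff_cancel)
    then show ?thesis using Av[of k] by (auto simp: u_Suc)
  qed
  have step: "nrm X (u (Suc k) \<ominus>\<^bsub>X\<^esub> u k) \<le> 1 * (1/4) ^ k" for k
    using v[of k] uc[of k] by (simp add: u_Suc X.diff_self X.M.a_comm[of "u k"] X.add_diff_cancel del: power_divide)
  obtain x where x: "x \<in> carrier X" "\<And>n. nrm X (u n \<ominus>\<^bsub>X\<^esub> x) \<le> 1 * (1/4) ^ n / (1 - 1/4)"
    using X.complete_fast[OF uc _ _ step] by auto
  obtain B where B: "\<And>j. j \<in> I \<Longrightarrow> nrm Y (A j x) \<le> B" using pw[OF x(1)] by blast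
  have "1/10 * 2 ^ k \<le> B" for k
  proof -
    interpret op X Y "A (i k)" by (rule op[OF i])
    have "nrm Y (A (i k) (u (Suc k) \<ominus>\<^bsub>X\<^esub> x)) \<le> \<nu> (A (i k)) * nrm X (u (Suc k) \<ominus>\<^bsub>X\<^esub> x)"
      unfolding \<nu>_def using x(1) uc by (intro opnrm_bound) auto
    \<comment> \<open>The steps after the k-th sum to at most \<open>(1/4)^(k+1) * 4/3\<close>, that
      is \<open>(1/4)^k / 3\<close>. Subtracting 1/3 from 9/20 leaves 7/60, more than the 1/10
      claimed.\<close>
    also have "\<dots> \<le> \<nu> (A (i k)) * ((1/4)^k / 3)"
      using x(2)[of "Suc k"] opnrm_ge0 unfolding \<nu>_def by (intro mult_left_mono) auto
    finally have "nrm Y (A (i k) (u (Suc k)) \<ominus>\<^bsub>Y\<^esub> A (i k) x) \<le> \<nu> (A (i k)) * ((1/4)^k / 3)"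
      using uc x(1) by (simp add: diff)
    then have "nrm Y (A (i k) (u (Suc k))) \<le> B + \<nu> (A (i k)) * ((1/4)^k / 3)"
      using Y.norm_le_add_diff[of "A (i k) (u (Suc k))" "A (i k) x"] B[OF i, of k] uc x(1) by auto
    moreover define P where "P = (1/4)^k * \<nu> (A (i k))"
    moreover have "P \<ge> 0" unfolding P_def \<nu>_def using opnrm_ge0 by simp
    ultimately have "P * (1/10) \<le> B" using Au[of k] by (simp add: mult_ac)
    then have "(1/4)^k * \<nu> (A (i k)) * (1/10) \<le> B" by (simp only: P_def)
    moreover have "(1/4)^k * 8^k \<le> (1/4)^k * \<nu> (A (i k))"
      using big[of k] by (intro mult_left_mono) auto
    moreover have "(1/4)^k * 8^k = (2::real)^k" by (simp add: power_mult_distrib[symmetric])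
    ultimately show ?thesis by auto
  qed
  moreover obtain k where "10 * B < 2 ^ k" using real_arch_pow[of 2 "10 * B"] by auto
  ultimately show False using \<open>\<And>k. 1/10 * 2 ^ k \<le> B\<close>[of k] by simp
qed

text \<open>A lower bound pulls a convergent sequence of values back to a Cauchy sequence, whose
  limit is mapped to the limit of the values. This serves both for the subspace \<open>N\<close> and
  for the embedding of X.\<close>

lemma closed_range:
  assumes "banach_space X" "op X Y A"
    and low: "\<And>x. x \<in> carrier X \<Longrightarrow> nrm X x \<le> C * nrm Y (A x)"
  shows "closed_subset Y (A ` carrier X)" "inj_on A (carrier X)"
proof -
  interpret X: banach_space X by fact
  interpret op X Y A by fact
  define D where "D = \<bar>C\<bar> + 1"
  have low: "nrm X x \<le> D * nrm Y (A x)" if "x \<in> carrier X" for x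
    using low[OF that] mult_right_mono[of C D "nrm Y (A x)"] Y.norm_ge0[of "A x"] that unfolding D_def by fastforce
  have D: "D > 0" unfolding D_def by simp
  show "inj_on A (carrier X)"
  proof (rule inj_onI)
    fix x y assume xy: "x \<in> carrier X" "y \<in> carrier X" "A x = A y"
    then have "nrm X (x \<ominus>\<^bsub>X\<^esub> y) \<le> 0" using low[of "x \<ominus>\<^bsub>X\<^esub> y"] by (simp add: diff Y.diff_self)
    then show "x = y" using xy X.norm_ge0[of "x \<ominus>\<^bsub>X\<^esub> y"] X.norm_0_iff[of "x \<ominus>\<^bsub>X\<^esub> y"] X.minus_eq_0_iff by auto
  qed
  show "closed_subset Y (A ` carrier X)" unfolding closed_subset_def
  proof (intro conjI allI impI ballI)
    show "A ` carrier X \<subseteq> carrier Y" by auto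
    fix w y assume y: "y \<in> carrier Y" and w: "range w \<subseteq> A ` carrier X"
      and lim: "(\<lambda>n. nrm Y (w n \<ominus>\<^bsub>Y\<^esub> y)) \<longlonglongrightarrow> 0"
    have "\<forall>n. \<exists>x. x \<in> carrier X \<and> w n = A x" using w by blast
    then obtain u where u: "\<And>n. u n \<in> carrier X" "\<And>n. w n = A (u n)" by metis
    have wc: "w n \<in> carrier Y" for n using u by simp
    have "\<exists>x\<in>carrier X. (\<lambda>n. nrm X (u n \<ominus>\<^bsub>X\<^esub> x)) \<longlonglongrightarrow> 0"
    proof (rule X.complete, use u in blast, intro allI impI)
      fix e :: real assume "e > 0"
      then obtain N where N: "\<And>n. n \<ge> N \<Longrightarrow> nrm Y (w n \<ominus>\<^bsub>Y\<^esub> y) < e / (2 * D)"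
        using LIMSEQ_0_lessD[OF lim, of "e / (2 * D)"] D by auto
      have "nrm X (u m \<ominus>\<^bsub>X\<^esub> u n) < e" if "m \<ge> N" "n \<ge> N" for m n
      proof -
        have "nrm X (u m \<ominus>\<^bsub>X\<^esub> u n) \<le> D * nrm Y (w m \<ominus>\<^bsub>Y\<^esub> w n)"
          using low[of "u m \<ominus>\<^bsub>X\<^esub> u n"] u by (simp add: diff)
        also have "nrm Y (w m \<ominus>\<^bsub>Y\<^esub> w n) < e / (2 * D) + e / (2 * D)"
          using Y.norm_diff_triangle[OF wc y wc, of m n] N[OF that(1)] N[OF that(2)]
            Y.norm_minus_commute[OF y wc, of n] by linarith
        finally show ?thesis using D by (simp add: field_simps)
      qed
      then show "\<exists>N. \<forall>m\<ge>N. \<forall>n\<ge>N. nrm X (u m \<ominus>\<^bsub>X\<^esub> u n) < e" by blast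
    qed
    then obtain x where x: "x \<in> carrier X" "tends X u x" unfolding tends_def by blast
    have "tends Y (\<lambda>n. A (u n)) (A x)" by (rule tends[OF x(2) _ x(1)]) (use u in auto)
    moreover have "tends Y (\<lambda>n. A (u n)) y" using lim u unfolding tends_def by simp
    ultimately have "A x = y" using Y.tends_unique u(1) x(1) y by (metis cl image_subsetI)
    then show "y \<in> A ` carrier X" using x by auto
  qed
qed

section \<open>The Hahn--Banach theorem and dual spaces\<close>

text \<open>
  Partial linear functionals are represented by their graphs. That \<open>G\<close> is single-valued need not be
  required: \<open>(\<zero>, r) \<in> G\<close> forces \<open>r = 0\<close> by the bound applied to \<open>r\<close> and \<open>-r\<close>.
\<close>

definition dominated_graph :: "('k::real_or_complex, 'a) normed_module \<Rightarrow> real \<Rightarrow> ('a \<times> real) set \<Rightarrow> bool" where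
  "dominated_graph W K G \<longleftrightarrow> G \<subseteq> carrier W \<times> UNIV \<and> (\<zero>\<^bsub>W\<^esub>, 0) \<in> G \<and>
     (\<forall>x r y s. (x, r) \<in> G \<longrightarrow> (y, s) \<in> G \<longrightarrow> (x \<oplus>\<^bsub>W\<^esub> y, r + s) \<in> G) \<and>
     (\<forall>a x r. (x, r) \<in> G \<longrightarrow> (of_real a \<odot>\<^bsub>W\<^esub> x, a * r) \<in> G) \<and>
     (\<forall>x r. (x, r) \<in> G \<longrightarrow> r \<le> K * nrm W x)"

lemma dominated_graphD:
  assumes "dominated_graph W K G"
  shows "(x, r) \<in> G \<Longrightarrow> x \<in> carrier W" "(\<zero>\<^bsub>W\<^esub>, 0) \<in> G"
    "(x, r) \<in> G \<Longrightarrow> (y, s) \<in> G \<Longrightarrow> (x \<oplus>\<^bsub>W\<^esub> y, r + s) \<in> G"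
    "(x, r) \<in> G \<Longrightarrow> (of_real a \<odot>\<^bsub>W\<^esub> x, a * r) \<in> G"
    "(x, r) \<in> G \<Longrightarrow> r \<le> K * nrm W x"
  using assms unfolding dominated_graph_def by blast+

context normed_mod begin

text \<open>The value \<xi> at \<open>z\<close> must lie above all
  \<open>r - K * nrm X (x \<ominus> z)\<close> and below all
  \<open>K * nrm X (y \<oplus> z) - s\<close>. The triangle inequality for
  \<open>x \<oplus> y = (x \<ominus> z) \<oplus> (y \<oplus> z)\<close> makes this possible, and the
  supremum of the lower bounds is taken.\<close>

lemma dominated_graph_extend:
  assumes G: "dominated_graph X K G" and K: "K \<ge> 0" and z: "z \<in> carrier X"
  shows "\<exists>G' \<xi>. dominated_graph X K G' \<and> G \<subseteq> G' \<and> (z, \<xi>) \<in> G'"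
proof -
  note D = dominated_graphD[OF G]
  define E where "E = {r - K * nrm X (x \<ominus> z) | x r. (x, r) \<in> G}"
  have ub: "e \<le> K * nrm X (y \<oplus> z) - s" if "e \<in> E" "(y, s) \<in> G" for e y s
  proof -
    from that(1) obtain x r where x: "(x, r) \<in> G" "e = r - K * nrm X (x \<ominus> z)" unfolding E_def by blast
    have xy: "x \<in> carrier X" "y \<in> carrier X" using x(1) that(2) D(1) by auto
    have "r + s \<le> K * nrm X (x \<oplus> y)" using D(3,5) x(1) that(2) by blast
    also have "x \<oplus> y = (x \<ominus> z) \<oplus> (y \<oplus> z)"
      using xy z by (simp add: a_minus_def M.a_ac M.r_neg)
    also have "K * nrm X ((x \<ominus> z) \<oplus> (y \<oplus> z)) \<le> K * (nrm X (x \<ominus> z) + nrm X (y \<oplus> z))"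
      using xy z K by (intro mult_left_mono norm_triangle) auto
    finally show ?thesis using x(2) by (simp add: algebra_simps)
  qed
  have ne: "E \<noteq> {}" using D(2) unfolding E_def by blast
  have bdd: "bdd_above E" using ub[OF _ D(2)] by (intro bdd_aboveI)
  define \<xi> where "\<xi> = Sup E"
  have up: "\<xi> \<le> K * nrm X (y \<oplus> z) - s" if "(y, s) \<in> G" for y s
    unfolding \<xi>_def by (intro cSup_least ne ub that)
  have lo: "r - K * nrm X (x \<ominus> z) \<le> \<xi>" if "(x, r) \<in> G" for x r
    unfolding \<xi>_def by (intro cSup_upper bdd) (use that in \<open>auto simp: E_def\<close>)
  define G' where "G' = {(x \<oplus> of_real t \<odot> z, r + t * \<xi>) | x r t. (x, r) \<in> G}"
  have GI: "(x \<oplus> of_real t \<odot> z, r + t * \<xi>) \<in> G'" if "(x, r) \<in> G" for x r t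
    using that unfolding G'_def by blast
  have GE: "\<exists>x' r' t. x = x' \<oplus> of_real t \<odot> z \<and> r = r' + t * \<xi> \<and> (x', r') \<in> G \<and> x' \<in> carrier X"
    if "(x, r) \<in> G'" for x r using that D(1) unfolding G'_def by blast
  have sub: "G \<subseteq> G'"
  proof
    fix q assume q: "q \<in> G"
    then obtain x r where xr: "q = (x, r)" by force
    show "q \<in> G'" using GI[of x r 0] q D(1)[of x r] z unfolding xr by simp
  qed
  have "dominated_graph X K G'" unfolding dominated_graph_def
  proof (intro conjI allI impI)
    show "G' \<subseteq> carrier X \<times> UNIV" using D(1) z unfolding G'_def by auto
    show "(\<zero>, 0) \<in> G'" using sub D(2) by auto
    fix x r assume xr: "(x, r) \<in> G'"
    obtain x' r' t where x': "x = x' \<oplus> of_real t \<odot> z" "r = r' + t * \<xi>" "(x', r') \<in> G" "x' \<in> carrier X"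
      using GE[OF xr] by blast
    show "(of_real a \<odot> x, a * r) \<in> G'" for a
      using GI[OF D(4)[OF x'(3), of a], of "a * t"] x' z
      by (simp add: smult_add_right smult_assoc algebra_simps)
    show "(x \<oplus> y, r + s) \<in> G'" if ys: "(y, s) \<in> G'" for y s
    proof -
      obtain y' s' u where y': "y = y' \<oplus> of_real u \<odot> z" "s = s' + u * \<xi>" "(y', s') \<in> G" "y' \<in> carrier X"
        using GE[OF ys] by blast
      show ?thesis using GI[OF D(3)[OF x'(3) y'(3)], of "t + u"] x' y' z
        by (simp add: smult_add_left algebra_simps M.a_ac)
    qed
    \<comment> \<open>Dividing by the absolute value of \<open>t\<close> reduces to coefficient 1 or
      -1 of \<open>z\<close>, where \<open>up\<close> and \<open>lo\<close> are exactly the required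
      bounds; for \<open>t = 0\<close> the bound is that of \<open>G\<close>.\<close>
    show "r \<le> K * nrm X x"
    proof (cases t "0::real" rule: linorder_cases)
      case equal
      then show ?thesis using x' D(5)[OF x'(3)] z by simp
    next
      case greater
      have "\<xi> \<le> K * nrm X (of_real (1/t) \<odot> x' \<oplus> z) - (1/t) * r'"
        using up[OF D(4)[OF x'(3), of "1/t"]] .
      then have "t * \<xi> \<le> t * (K * nrm X (of_real (1/t) \<odot> x' \<oplus> z) - (1/t) * r')"
        using greater by (intro mult_left_mono) auto
      then have "t * \<xi> + r' \<le> K * (t * nrm X (of_real (1/t) \<odot> x' \<oplus> z))"
        using greater by (simp add: algebra_simps)
      also have "t * nrm X (of_real (1/t) \<odot> x' \<oplus> z) = nrm X (of_real t \<odot> (of_real (1/t) \<odot> x' \<oplus> z))"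
        using x'(4) z greater by (subst norm_smult) auto
      also have "of_real t \<odot> (of_real (1/t) \<odot> x' \<oplus> z) = x"
        using x'(1,4) z greater by (simp add: smult_add_right smult_assoc of_real_mult[symmetric] del: of_real_mult)
      finally show ?thesis using x'(2) by simp
    next
      case less
      define s where "s = - t"
      have s: "s > 0" using less s_def by simp
      have "(1/s) * r' - K * nrm X (of_real (1/s) \<odot> x' \<ominus> z) \<le> \<xi>"
        using lo[OF D(4)[OF x'(3), of "1/s"]] .
      then have "s * ((1/s) * r' - K * nrm X (of_real (1/s) \<odot> x' \<ominus> z)) \<le> s * \<xi>"
        using s by (intro mult_left_mono) auto
      then have "r' - s * \<xi> \<le> K * (s * nrm X (of_real (1/s) \<odot> x' \<ominus> z))"
        using s by (simp add: algebra_simps)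
      also have "s * nrm X (of_real (1/s) \<odot> x' \<ominus> z) = nrm X (of_real s \<odot> (of_real (1/s) \<odot> x' \<ominus> z))"
        using x'(4) z s by (subst norm_smult) auto
      also have "of_real s \<odot> (of_real (1/s) \<odot> x' \<ominus> z) = x"
        using x'(1,4) z s by (simp add: smult_diff smult_assoc of_real_mult[symmetric] del: of_real_mult)
          (simp add: minus_smult smult_assoc s_def)
      finally show ?thesis using x'(2) by (simp add: s_def)
    qed
  qed
  moreover have "(z, \<xi>) \<in> G'" using GI[OF D(2), of 1] z by simp
  ultimately show ?thesis using sub by blast
qed

text \<open>Zorn's lemma gives a maximal dominated graph above \<open>G0\<close>; by the one-step
  extension it is defined everywhere.\<close>

lemma real_hahn_banach:
  assumes G0: "dominated_graph X K G0" and K: "K \<ge> 0"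
  shows "\<exists>u. (\<forall>x\<in>carrier X. \<forall>y\<in>carrier X. u (x \<oplus> y) = u x + u y) \<and>
    (\<forall>a. \<forall>x\<in>carrier X. u (of_real a \<odot> x) = a * u x) \<and>
    (\<forall>x\<in>carrier X. u x \<le> K * nrm X x) \<and> (\<forall>x r. (x, r) \<in> G0 \<longrightarrow> u x = r)"
proof -
  let ?A = "{G. dominated_graph X K G \<and> G0 \<subseteq> G}"
  have "\<exists>G\<in>?A. \<forall>H\<in>?A. G \<subseteq> H \<longrightarrow> H = G"
  proof (rule subset_Zorn_nonempty)
    show "?A \<noteq> {}" using G0 by blast
    fix \<C> assume ne: "\<C> \<noteq> {}" and ch: "subset.chain ?A \<C>"
    have dg: "\<And>G. G \<in> \<C> \<Longrightarrow> dominated_graph X K G" "\<And>G. G \<in> \<C> \<Longrightarrow> G0 \<subseteq> G"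
      using ch unfolding subset_chain_def by blast+
    note D = dominated_graphD[OF dg(1)]
    have two: "\<exists>G\<in>\<C>. a \<in> G \<and> b \<in> G" if "a \<in> \<Union>\<C>" "b \<in> \<Union>\<C>" for a b
      using that ch unfolding subset_chain_def by blast
    have "dominated_graph X K (\<Union>\<C>)" unfolding dominated_graph_def
    proof (intro conjI allI impI)
      show "\<Union>\<C> \<subseteq> carrier X \<times> UNIV" using dg(1) unfolding dominated_graph_def by blast
      show "(\<zero>, 0) \<in> \<Union>\<C>" using D(2) ne by blast
      show "(x \<oplus> y, r + s) \<in> \<Union>\<C>" if xs: "(x, r) \<in> \<Union>\<C>" "(y, s) \<in> \<Union>\<C>" for x y r s
      proof -
        obtain G where "G \<in> \<C>" "(x, r) \<in> G" "(y, s) \<in> G" using two[OF xs] by blast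
        then show ?thesis using D(3) by (intro UnionI[of G]) auto
      qed
      show "(of_real a \<odot> x, a * r) \<in> \<Union>\<C>" if xr: "(x, r) \<in> \<Union>\<C>" for a x r
      proof -
        obtain G where "G \<in> \<C>" "(x, r) \<in> G" using xr by blast
        then show ?thesis using D(4) by (intro UnionI[of G]) auto
      qed
      show "r \<le> K * nrm X x" if xr: "(x, r) \<in> \<Union>\<C>" for x r
      proof -
        obtain G where "G \<in> \<C>" "(x, r) \<in> G" using xr by blast
        then show ?thesis by (rule D(5))
      qed
    qed
    then show "\<Union>\<C> \<in> ?A" using dg(2) ne by blast
  qed
  then obtain G where GA: "G \<in> ?A" and mx: "\<forall>H\<in>?A. G \<subseteq> H \<longrightarrow> H = G" by (rule bexE)
  then have G: "dominated_graph X K G" "G0 \<subseteq> G" by simp_all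
  have max: "H = G" if "dominated_graph X K H" "G \<subseteq> H" for H
    using bspec[OF mx, of H] that G(2) by simp
  note D = dominated_graphD[OF G(1)]
  have ex: "\<exists>r. (x, r) \<in> G" if xX: "x \<in> carrier X" for x
    
  proof -
    obtain H r where "dominated_graph X K H" "G \<subseteq> H" "(x, r) \<in> H"
      using dominated_graph_extend[OF G(1) K xX] by (elim exE conjE)
    then show ?thesis using max[of H] by auto
  qed
  have le: "r \<le> s" if "(x, r) \<in> G" "(x, s) \<in> G" for x r s
  proof -
    have "(x \<oplus> of_real (-1) \<odot> x, r + (-1) * s) \<in> G" using that D(3,4) by blast
    then have "r - s \<le> K * nrm X (x \<oplus> (-1) \<odot> x)" using D(5) by fastforce
    then show ?thesis using D(1)[OF that(1)] by (simp add: minus_smult[symmetric] diff_self)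
  qed
  define u where "u x = (THE r. (x, r) \<in> G)" for x
  have u: "u x = r" if "(x, r) \<in> G" for x r
    unfolding u_def using that le by (intro the_equality) (auto intro: antisym)
  have uG: "(x, u x) \<in> G" if "x \<in> carrier X" for x using ex[OF that] u by blast
  show ?thesis
  proof (intro exI[of _ u] conjI ballI allI impI)
    show "u (x \<oplus> y) = u x + u y" if "x \<in> carrier X" "y \<in> carrier X" for x y
      by (intro u D(3) uG that)
    show "u (of_real a \<odot> x) = a * u x" if "x \<in> carrier X" for a x
      by (intro u D(4) uG that)
    show "u x \<le> K * nrm X x" if "x \<in> carrier X" for x by (intro D(5) uG that)
    show "u x = r" if "(x, r) \<in> G0" for x r using u that G(2) by blast
  qed
qed

end

text \<open>\<open>\<phi> 1\<close> is an idempotent of norm 1, hence equal to 1, so \<phi> fixes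
  the reals; an additive isometry is injective. Statements about scalars can thus be checked in the
  complex numbers, with a case distinction on the range.\<close>

lemma scalar_cases:
  "\<exists>\<phi> :: 'k::real_or_complex \<Rightarrow> complex. (\<forall>x y. \<phi> (x + y) = \<phi> x + \<phi> y) \<and> (\<forall>x y. \<phi> (x * y) = \<phi> x * \<phi> y) \<and>
    (\<forall>x. norm (\<phi> x) = norm x) \<and> (\<forall>r. \<phi> (of_real r) = of_real r) \<and> inj \<phi> \<and> (range \<phi> = \<real> \<or> range \<phi> = UNIV)"
proof -
  obtain \<phi> :: "'k \<Rightarrow> complex" where p: "\<And>x y. \<phi> (x + y) = \<phi> x + \<phi> y"
    "\<And>x y. \<phi> (x * y) = \<phi> x * \<phi> y" "\<And>r x. \<phi> (r *\<^sub>R x) = r *\<^sub>R \<phi> x" "\<And>x. norm (\<phi> x) = norm x"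
    "range \<phi> = \<real> \<or> range \<phi> = UNIV"
    using real_or_complex[where 'a='k] by blast
  have "\<phi> 1 * \<phi> 1 = \<phi> 1" using p(2)[of 1 1] by simp
  moreover have "\<phi> 1 \<noteq> 0" using p(4)[of 1] by auto
  ultimately have one: "\<phi> 1 = 1" by (metis mult_cancel_left1)
  have "\<phi> (of_real r) = of_real r" for r
    using p(3)[of r 1] one by (simp add: of_real_def)
  moreover have "inj \<phi>"
  proof (rule injI)
    fix x y assume "\<phi> x = \<phi> y"
    moreover have "\<phi> (- y) = - \<phi> y" using p(3)[of "-1" y] by simp
    ultimately have "\<phi> (x + - y) = 0" using p(1)[of x "-y"] by simp
    then show "x = y" using p(4)[of "x + - y"] by simp
  qed
  ultimately show ?thesis using p by (intro exI[of _ \<phi>]) blast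
qed

lemma scalar_space_simps [simp]: "carrier scalar_space = UNIV" "add scalar_space = (+)"
  "zero scalar_space = 0" "smult scalar_space = (*)" "nrm scalar_space = norm"
  by (auto simp: scalar_space_def)

lemma scalar_space_normed: "normed_mod (scalar_space :: ('k::real_or_complex, 'k) normed_module)"
proof -
  have "module scalar_ring (scalar_space :: ('k, 'k) normed_module)"
    by (intro moduleI cring_scalar_ring abelian_groupI)
      (auto simp: algebra_simps intro: exI[of _ "- _"])
  then show ?thesis
    by (intro normed_mod.intro normed_mod_axioms.intro) (auto simp: norm_mult norm_triangle_ineq)
qed

interpretation SS: normed_mod scalar_space by (rule scalar_space_normed)

text \<open>The real part of \<open>f\<close> is extended as a real functional \<open>u\<close>. For
  complex scalars the extension is recovered as \<open>u x - j * u (j \<odot> x)\<close>, where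
  \<open>j\<close> is the imaginary unit, and a rotation turns the bound for the real part into a
  bound for the modulus.\<close>

lemma (in normed_mod) hahn_banach:
  fixes V :: "'a set" and f :: "'a \<Rightarrow> 'k"
  assumes V: "V \<subseteq> carrier X" "\<zero> \<in> V" "\<And>x y. x \<in> V \<Longrightarrow> y \<in> V \<Longrightarrow> x \<oplus> y \<in> V"
      "\<And>a x. x \<in> V \<Longrightarrow> a \<odot> x \<in> V"
    and f: "\<And>x y. x \<in> V \<Longrightarrow> y \<in> V \<Longrightarrow> f (x \<oplus> y) = f x + f y" "\<And>a x. x \<in> V \<Longrightarrow> f (a \<odot> x) = a * f x"
      "\<And>x. x \<in> V \<Longrightarrow> norm (f x) \<le> K * nrm X x"
    and K: "K \<ge> 0"
  shows "\<exists>F. F \<in> bounded_ops X scalar_space \<and> (\<forall>x\<in>V. F x = f x) \<and> (\<forall>x\<in>carrier X. norm (F x) \<le> K * nrm X x)"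
proof -
  from scalar_cases[where 'k='k] obtain \<phi> :: "'k \<Rightarrow> complex" where ph: "(\<forall>x y. \<phi> (x + y) = \<phi> x + \<phi> y) \<and> (\<forall>x y. \<phi> (x * y) = \<phi> x * \<phi> y) \<and>
    (\<forall>x. norm (\<phi> x) = norm x) \<and> (\<forall>r. \<phi> (of_real r) = of_real r) \<and> inj \<phi> \<and> (range \<phi> = \<real> \<or> range \<phi> = UNIV)"
    by (rule exE)
  note p = ph[THEN conjunct1, rule_format] ph[THEN conjunct2, THEN conjunct1, rule_format]
    ph[THEN conjunct2, THEN conjunct2, THEN conjunct1, rule_format]
    ph[THEN conjunct2, THEN conjunct2, THEN conjunct2, THEN conjunct1, rule_format]
    ph[THEN conjunct2, THEN conjunct2, THEN conjunct2, THEN conjunct2, THEN conjunct1]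
    ph[THEN conjunct2, THEN conjunct2, THEN conjunct2, THEN conjunct2, THEN conjunct2]
  have p0: "\<phi> 0 = 0" using p(4)[of 0] by simp
  have pm: "\<phi> (x - y) = \<phi> x - \<phi> y" for x y
    using p(1)[of "x - y" y] by simp
  define G0 where "G0 = {(x, Re (\<phi> (f x))) | x. x \<in> V}"
  have f0: "f \<zero> = 0" using f(2)[OF V(2), of 0] V(2) by simp
  have "dominated_graph X K G0" unfolding dominated_graph_def
  proof (intro conjI allI impI)
    show "G0 \<subseteq> carrier X \<times> UNIV" using V unfolding G0_def by auto
    show "(\<zero>, 0) \<in> G0" unfolding G0_def using V(2) f0 p0 by force
    show "(x \<oplus> y, r + s) \<in> G0" if "(x, r) \<in> G0" "(y, s) \<in> G0" for x y r s
      using that V(3)[of x y] f(1)[of x y] unfolding G0_def by (auto simp: p)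
    show "(of_real a \<odot> x, a * r) \<in> G0" if "(x, r) \<in> G0" for a x r
      using that V(4)[of x "of_real a"] f(2)[of x "of_real a"] unfolding G0_def by (auto simp: p)
    show "r \<le> K * nrm X x" if "(x, r) \<in> G0" for x r
      using that f(3)[of x] complex_Re_le_cmod[of "\<phi> (f x)"] unfolding G0_def by (auto simp: p)
  qed
  from real_hahn_banach[OF this K] obtain u where
    u: "\<And>x y. x \<in> carrier X \<Longrightarrow> y \<in> carrier X \<Longrightarrow> u (x \<oplus> y) = u x + u y"
      "\<And>a x. x \<in> carrier X \<Longrightarrow> u (of_real a \<odot> x) = a * u x"
      "\<And>x. x \<in> carrier X \<Longrightarrow> u x \<le> K * nrm X x" and uG: "\<And>x r. (x, r) \<in> G0 \<Longrightarrow> u x = r" by blast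
  have uf: "u x = Re (\<phi> (f x))" if "x \<in> V" for x using that uG unfolding G0_def by blast
  have "\<exists>F. (\<forall>x\<in>carrier X. \<forall>y\<in>carrier X. F (x \<oplus> y) = F x + F y) \<and> (\<forall>a. \<forall>x\<in>carrier X. F (a \<odot> x) = a * F x) \<and>
     (\<forall>x\<in>carrier X. Re (\<phi> (F x)) = u x) \<and> (\<forall>x\<in>V. F x = f x)"
    using p(6)
  proof
    assume R: "range \<phi> = \<real>"
    have rep: "a = of_real (Re (\<phi> a))" for a
    proof -
      have "\<phi> a \<in> \<real>" using R by blast
      then have "\<phi> a = \<phi> (of_real (Re (\<phi> a)))" by (simp add: p(4))
      then show ?thesis using p(5) by (simp add: inj_eq)
    qed
    show ?thesis
    proof (intro exI[of _ "\<lambda>x. of_real (u x)"] conjI ballI allI)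
      show "of_real (u (a \<odot> x)) = a * of_real (u x)" if "x \<in> carrier X" for a x
        using u(2)[OF that, of "Re (\<phi> a)"] rep[of a] by (metis of_real_mult)
      show "of_real (u x) = f x" if "x \<in> V" for x using uf[OF that] rep[of "f x"] by simp
    qed (simp_all add: u p)
  next
    assume "range \<phi> = UNIV"
    then obtain j where j: "\<phi> j = \<i>" by (metis UNIV_I imageE)
    have jj: "j * j = -1"
    proof -
      have "\<phi> (j * j) = \<phi> (of_real (-1))" unfolding p(4) by (simp add: p j)
      then show ?thesis using p(5) by (simp add: inj_eq)
    qed
    \<comment> \<open>Multiplication by \<open>j\<close> turns the real part into minus the
      imaginary part. Hence a scalar, and likewise a linear functional, is determined by its real
      part.\<close>
    have rep: "a = of_real (Re (\<phi> a)) - j * of_real (Re (\<phi> (j * a)))" for a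
    proof -
      have "\<phi> a = \<phi> (of_real (Re (\<phi> a)) - j * of_real (Re (\<phi> (j * a))))"
        by (simp add: pm p j complex_eq_iff)
      then show ?thesis using p(5) by (simp add: inj_eq)
    qed
    define F where "F x = of_real (u x) - j * of_real (u (j \<odot> x))" for x
    have Fa: "F (x \<oplus> y) = F x + F y" if "x \<in> carrier X" "y \<in> carrier X" for x y
      using that by (simp add: F_def u smult_add_right algebra_simps)
    have Fr: "F (of_real a \<odot> x) = of_real a * F x" if "x \<in> carrier X" for a x
    proof -
      have "j \<odot> (of_real a \<odot> x) = of_real a \<odot> (j \<odot> x)"
        using that by (simp add: smult_assoc mult.commute)
      then show ?thesis using that by (simp add: F_def u algebra_simps)
    qed
    have Fj: "F (j \<odot> x) = j * F x" if "x \<in> carrier X" for x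
    proof -
      have "j \<odot> (j \<odot> x) = of_real (-1) \<odot> x" using that jj by (simp add: smult_assoc)
      then have "u (j \<odot> (j \<odot> x)) = - u x" using u(2)[OF that, of "-1"] by simp
      moreover have "j * (j * of_real (u (j \<odot> x))) = - of_real (u (j \<odot> x))"
        using jj by (metis mult.assoc mult_minus1)
      ultimately show ?thesis by (simp add: F_def algebra_simps)
    qed
    show ?thesis
    proof (intro exI[of _ F] conjI ballI allI)
      show "F (a \<odot> x) = a * F x" if x: "x \<in> carrier X" for a x
      proof -
        define s t where "s = Re (\<phi> a)" and "t = - Re (\<phi> (j * a))"
        have a: "a = of_real s + j * of_real t" using rep[of a] unfolding s_def t_def by simp
        have "F (a \<odot> x) = F (of_real s \<odot> x \<oplus> j \<odot> (of_real t \<odot> x))"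
          using x unfolding a by (simp add: smult_add_left smult_assoc)
        also have "\<dots> = a * F x" using x unfolding a by (simp add: Fa Fr Fj algebra_simps)
        finally show ?thesis .
      qed
      show "F x = f x" if x: "x \<in> V" for x
        using rep[of "f x"] uf[OF x] uf[OF V(4)[OF x, of j]] f(2)[OF x, of j] by (simp add: F_def)
    qed (simp_all add: Fa, simp add: F_def pm p j)
  qed
  then obtain F where F: "\<And>x y. x \<in> carrier X \<Longrightarrow> y \<in> carrier X \<Longrightarrow> F (x \<oplus> y) = F x + F y"
    "\<And>a x. x \<in> carrier X \<Longrightarrow> F (a \<odot> x) = a * F x"
    "\<And>x. x \<in> carrier X \<Longrightarrow> Re (\<phi> (F x)) = u x" "\<And>x. x \<in> V \<Longrightarrow> F x = f x" by blast
  have bd: "norm (F x) \<le> K * nrm X x" if x: "x \<in> carrier X" for x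
  proof (cases "F x = 0")
    case True then show ?thesis using K norm_ge0[OF x] by simp
  next
    case False
    \<comment> \<open>A scalar of modulus 1 that rotates \<open>F x\<close> onto the positive real
      axis, so that the modulus of \<open>F x\<close> is a value of \<open>u\<close>.\<close>
    define b where "b = of_real (norm (F x)) / F x"
    have b: "norm b = 1" using False by (simp add: b_def norm_divide)
    have "b * F x = of_real (norm (F x))" using False unfolding b_def by simp
    then have "F (b \<odot> x) = of_real (norm (F x))" using F(2)[OF x, of b] by (simp only:)
    then have "norm (F x) = u (b \<odot> x)" using F(3)[of "b \<odot> x"] x p(4)[of "norm (F x)"] by simp
    also have "\<dots> \<le> K * nrm X x" using u(3)[of "b \<odot> x"] x b by (simp add: norm_smult)
    finally show ?thesis .
  qed
  have "F \<in> bounded_ops X scalar_space"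
    by (rule bounded_opsI[of _ _ _ K]) (use F bd in auto)
  then show ?thesis using F(4) bd by blast
qed

text \<open>Hahn--Banach applied to the functional sending \<open>a \<odot> x\<close> to
  \<open>a * nrm X x\<close> on the line through \<open>x\<close>. For \<open>x = \<zero>\<close>
  the coefficient \<open>a\<close> is not determined, and the zero functional serves.\<close>

lemma (in normed_mod) norming_functional:
  assumes x: "x \<in> carrier X"
  shows "\<exists>F. F \<in> bounded_ops X scalar_space \<and> F x = of_real (nrm X x) \<and> (\<forall>y\<in>carrier X. norm (F y) \<le> nrm X y)"
proof (cases "x = \<zero>")
  case True
  have "(\<lambda>_. 0) \<in> bounded_ops X scalar_space" by (rule bounded_opsI[of _ _ _ 0]) auto
  with True show ?thesis using norm_ge0 by (intro exI[of _ "\<lambda>_. 0"]) auto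
next
  case False
  then have nx: "nrm X x > 0" using norm_ge0[OF x] norm_0_iff[OF x] by fastforce
  have inj: "a = b" if "a \<odot> x = b \<odot> x" for a b
  proof -
    have "(a - b) \<odot> x = \<zero>" using that x by (simp add: smult_minus_left diff_self)
    then have "norm (a - b) * nrm X x = 0" using norm_smult[OF x, of "a - b"] by simp
    then show ?thesis using nx by simp
  qed
  define f where "f y = (THE a. y = a \<odot> x) * of_real (nrm X x)" for y
  have f: "f (a \<odot> x) = a * of_real (nrm X x)" for a
  proof -
    have "(THE b. a \<odot> x = b \<odot> x) = a" using inj by (intro the_equality) auto
    then show ?thesis by (simp add: f_def)
  qed
  have "\<exists>F. F \<in> bounded_ops X scalar_space \<and> (\<forall>y\<in>range (\<lambda>a. a \<odot> x). F y = f y) \<and> (\<forall>y\<in>carrier X. norm (F y) \<le> 1 * nrm X y)"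
  proof (rule hahn_banach)
    show "range (\<lambda>a. a \<odot> x) \<subseteq> carrier X" using x by auto
    show "\<zero> \<in> range (\<lambda>a. a \<odot> x)" by (rule image_eqI[of _ _ 0]) (use x in auto)
    fix y assume "y \<in> range (\<lambda>a. a \<odot> x)"
    then obtain b where b: "y = b \<odot> x" by blast
    show "a \<odot> y \<in> range (\<lambda>a. a \<odot> x)" for a using x unfolding b by (simp add: smult_assoc)
    show "f (a \<odot> y) = a * f y" for a using x unfolding b by (simp add: smult_assoc f)
    show "norm (f y) \<le> 1 * nrm X y" using x nx unfolding b by (simp add: f norm_mult norm_smult)
    fix z assume "z \<in> range (\<lambda>a. a \<odot> x)"
    then obtain d where d: "z = d \<odot> x" by blast
    show "y \<oplus> z \<in> range (\<lambda>a. a \<odot> x)" using x unfolding b d by (simp add: smult_add_left[symmetric])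
    show "f (y \<oplus> z) = f y + f z" using x unfolding b d by (simp add: smult_add_left[symmetric] f algebra_simps)
  qed simp
  then obtain F where F: "F \<in> bounded_ops X scalar_space" "\<And>y. y \<in> range (\<lambda>a. a \<odot> x) \<Longrightarrow> F y = f y"
    "\<And>y. y \<in> carrier X \<Longrightarrow> norm (F y) \<le> nrm X y" by auto
  have "f x = of_real (nrm X x)" using f[of 1] x by simp
  moreover have "x \<in> range (\<lambda>a. a \<odot> x)" by (rule image_eqI[of _ _ 1]) (use x in auto)
  ultimately show ?thesis using F by (intro exI[of _ F]) auto
qed

section \<open>Dual spaces, bidual functionals and adjoints\<close>

context normed_mod begin

lemma dual_carrier: "carrier (dual_space X) = bounded_ops X scalar_space \<inter> extensional (carrier X)"
  by (simp add: dual_space_def)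

lemma dual_simps:
  "add (dual_space X) f g = (\<lambda>x\<in>carrier X. f x + g x)" "zero (dual_space X) = (\<lambda>x\<in>carrier X. 0)"
  "smult (dual_space X) a f = (\<lambda>x\<in>carrier X. a * f x)"
  by (simp_all add: dual_space_def)

lemma dual_eqI:
  assumes "f \<in> carrier (dual_space X)" "g \<in> carrier (dual_space X)" "\<And>x. x \<in> carrier X \<Longrightarrow> f x = g x"
  shows "f = g"
  using assms by (intro extensionalityI[of _ "carrier X"]) (auto simp: dual_carrier)

lemma dual_restrict:
  assumes "F \<in> bounded_ops X scalar_space" shows "restrict F (carrier X) \<in> carrier (dual_space X)"
  using assms by (auto simp: dual_carrier bounded_ops_def)

lemma dual_op: "f \<in> carrier (dual_space X) \<Longrightarrow> op X scalar_space f"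
  by (intro op.intro op_axioms.intro) (auto simp: dual_carrier scalar_space_normed normed_mod_axioms)

lemma dual_add: "f \<in> carrier (dual_space X) \<Longrightarrow> x \<in> carrier X \<Longrightarrow> y \<in> carrier X \<Longrightarrow> f (x \<oplus> y) = f x + f y"
  and dual_smult: "f \<in> carrier (dual_space X) \<Longrightarrow> x \<in> carrier X \<Longrightarrow> f (a \<odot> x) = a * f x"
  by (auto simp: dual_carrier bounded_ops_def)

lemma dual_norm_eq: "f \<in> carrier (dual_space X) \<Longrightarrow> nrm (dual_space X) f = op.opnrm X scalar_space f"
  by (simp add: op.opnrm_def[OF dual_op] dual_space_def)

lemma dual_bound:
  "f \<in> carrier (dual_space X) \<Longrightarrow> x \<in> carrier X \<Longrightarrow> norm (f x) \<le> nrm (dual_space X) f * nrm X x"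
  using op.opnrm_bound[OF dual_op, of f x] by (simp add: dual_norm_eq)

lemma dual_least:
  assumes "f \<in> carrier (dual_space X)" "\<And>x. x \<in> carrier X \<Longrightarrow> nrm X x \<le> 1 \<Longrightarrow> norm (f x) \<le> B"
  shows "nrm (dual_space X) f \<le> B"
  using op.opnrm_least[OF dual_op[OF assms(1)], of B] assms by (simp add: dual_norm_eq)

lemma dual_norm_ge0: "f \<in> carrier (dual_space X) \<Longrightarrow> 0 \<le> nrm (dual_space X) f"
  using op.opnrm_ge0[OF dual_op, of f] by (simp add: dual_norm_eq)

lemma dual_add_cl:
  assumes f: "f \<in> carrier (dual_space X)" and g: "g \<in> carrier (dual_space X)"
  shows "(\<lambda>x\<in>carrier X. f x + g x) \<in> carrier (dual_space X)"
proof (rule dual_restrict, rule bounded_opsI)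
  fix x assume x: "x \<in> carrier X"
  show "nrm scalar_space (f x + g x) \<le> (nrm (dual_space X) f + nrm (dual_space X) g) * nrm X x"
    using norm_triangle_le[OF add_mono[OF dual_bound[OF f x] dual_bound[OF g x]]] by (simp add: algebra_simps)
qed (auto simp: dual_add[OF f] dual_add[OF g] dual_smult[OF f] dual_smult[OF g] algebra_simps)

lemma dual_smult_cl:
  assumes f: "f \<in> carrier (dual_space X)"
  shows "(\<lambda>x\<in>carrier X. a * f x) \<in> carrier (dual_space X)"
proof (rule dual_restrict, rule bounded_opsI)
  fix x assume x: "x \<in> carrier X"
  show "nrm scalar_space (a * f x) \<le> (norm a * nrm (dual_space X) f) * nrm X x"
    using mult_left_mono[OF dual_bound[OF f x] norm_ge_zero[of a]] by (simp add: norm_mult mult.assoc)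
qed (auto simp: dual_add[OF f] dual_smult[OF f] algebra_simps)

lemma dual_zero_cl: "(\<lambda>x\<in>carrier X. 0) \<in> carrier (dual_space X)"
  by (rule dual_restrict, rule bounded_opsI[of _ _ _ 0]) auto

lemma dual_normed: "normed_mod (dual_space X)"
proof (intro normed_mod.intro moduleI cring_scalar_ring abelian_groupI normed_mod_axioms.intro)
  fix f assume f: "f \<in> carrier (dual_space X)"
  show "\<exists>g\<in>carrier (dual_space X). g \<oplus>\<^bsub>dual_space X\<^esub> f = \<zero>\<^bsub>dual_space X\<^esub>"
    by (rule bexI[OF _ dual_smult_cl[OF f, of "-1"]]) (auto simp: dual_simps fun_eq_iff restrict_def)
  show "\<zero>\<^bsub>dual_space X\<^esub> \<oplus>\<^bsub>dual_space X\<^esub> f = f" "\<one>\<^bsub>scalar_ring\<^esub> \<odot>\<^bsub>dual_space X\<^esub> f = f"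
    using f by (auto simp: dual_simps dual_carrier fun_eq_iff restrict_def extensional_def)
  show "0 \<le> nrm (dual_space X) f" using f by (rule dual_norm_ge0)
  show "nrm (dual_space X) f = 0 \<longleftrightarrow> f = \<zero>\<^bsub>dual_space X\<^esub>"
  proof
    assume "nrm (dual_space X) f = 0"
    then show "f = \<zero>\<^bsub>dual_space X\<^esub>"
      using dual_bound[OF f] by (intro dual_eqI[OF f]) (auto simp: dual_simps dual_zero_cl)
  next
    assume "f = \<zero>\<^bsub>dual_space X\<^esub>"
    then have "nrm (dual_space X) f \<le> 0" by (intro dual_least[OF f]) (simp add: dual_simps)
    then show "nrm (dual_space X) f = 0" using dual_norm_ge0[OF f] by simp
  qed
  \<comment> \<open>Only this inequality is proved directly. Applied to the inverse scalar it yields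
    the reverse one; the same trick returns for sequence spaces and quotients.\<close>
  have le: "nrm (dual_space X) (a \<odot>\<^bsub>dual_space X\<^esub> g) \<le> norm a * nrm (dual_space X) g"
    if g: "g \<in> carrier (dual_space X)" for a g
  proof (rule dual_least)
    show "a \<odot>\<^bsub>dual_space X\<^esub> g \<in> carrier (dual_space X)" by (simp add: dual_simps dual_smult_cl g)
    fix x assume x: "x \<in> carrier X" "nrm X x \<le> 1"
    have "norm (g x) \<le> nrm (dual_space X) g * 1"
      using dual_bound[OF g x(1)] mult_left_mono[OF x(2) dual_norm_ge0[OF g]] by linarith
    then show "norm ((a \<odot>\<^bsub>dual_space X\<^esub> g) x) \<le> norm a * nrm (dual_space X) g"
      using x mult_left_mono[of "norm (g x)" _ "norm a"] by (simp add: dual_simps norm_mult)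
  qed
  show "nrm (dual_space X) (a \<odot>\<^bsub>dual_space X\<^esub> f) = norm a * nrm (dual_space X) f" for a
  proof (cases "a = 0")
    case True
    then show ?thesis using le[OF f, of a] dual_norm_ge0[OF dual_smult_cl[OF f, of a]] by (simp add: dual_simps)
  next
    case False
    have "inverse a \<odot>\<^bsub>dual_space X\<^esub> (a \<odot>\<^bsub>dual_space X\<^esub> f) = f"
      using f False by (auto simp: dual_simps dual_carrier fun_eq_iff restrict_def extensional_def)
    then have "nrm (dual_space X) f \<le> norm (inverse a) * nrm (dual_space X) (a \<odot>\<^bsub>dual_space X\<^esub> f)"
      using le[of "a \<odot>\<^bsub>dual_space X\<^esub> f" "inverse a"] dual_smult_cl[OF f] by (simp add: dual_simps)
    then have "norm a * nrm (dual_space X) f \<le> norm a * (norm (inverse a) * nrm (dual_space X) (a \<odot>\<^bsub>dual_space X\<^esub> f))"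
      by (intro mult_left_mono) auto
    also have "\<dots> = nrm (dual_space X) (a \<odot>\<^bsub>dual_space X\<^esub> f)"
      using False by (simp add: nonzero_norm_inverse[OF False] mult.assoc[symmetric])
    finally show ?thesis using le[OF f, of a] by linarith
  qed
  fix g assume g: "g \<in> carrier (dual_space X)"
  show "f \<oplus>\<^bsub>dual_space X\<^esub> g = g \<oplus>\<^bsub>dual_space X\<^esub> f" by (simp add: dual_simps add.commute)
  show "nrm (dual_space X) (f \<oplus>\<^bsub>dual_space X\<^esub> g) \<le> nrm (dual_space X) f + nrm (dual_space X) g"
  proof (rule dual_least)
    show "f \<oplus>\<^bsub>dual_space X\<^esub> g \<in> carrier (dual_space X)" by (simp add: dual_simps dual_add_cl f g)
    fix x assume x: "x \<in> carrier X" "nrm X x \<le> 1"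
    have "norm (h x) \<le> nrm (dual_space X) h" if h: "h \<in> carrier (dual_space X)" for h
      using dual_bound[OF h x(1)] mult_left_mono[OF x(2) dual_norm_ge0[OF h]] by linarith
    from norm_triangle_le[OF add_mono[OF this[OF f] this[OF g]]]
    show "norm ((f \<oplus>\<^bsub>dual_space X\<^esub> g) x) \<le> nrm (dual_space X) f + nrm (dual_space X) g"
      using x by (simp add: dual_simps)
  qed
qed (auto simp: dual_simps dual_add_cl[unfolded restrict_def] dual_smult_cl[unfolded restrict_def]
    dual_zero_cl[unfolded restrict_def] fun_eq_iff restrict_def algebra_simps)

text \<open>Together with \<open>reflexiveI\<close> this removes extensionality from the definition:
  \<Phi> may be any bounded functional on the dual, whatever it does off the carrier.\<close>

lemma reflexiveD:
  assumes "reflexive X" "\<Phi> \<in> bounded_ops (dual_space X) scalar_space"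
  shows "\<exists>x\<in>carrier X. \<forall>f\<in>carrier (dual_space X). \<Phi> f = f x"
proof -
  interpret D: normed_mod "dual_space X" by (rule dual_normed)
  from bspec[OF assms(1)[unfolded reflexive_def] D.dual_restrict[OF assms(2)]]
  obtain x where x: "x \<in> carrier X"
    "restrict \<Phi> (carrier (dual_space X)) = (\<lambda>f\<in>carrier (dual_space X). f x)"
    by (rule bexE)
  have "\<Phi> f = f x" if "f \<in> carrier (dual_space X)" for f
    using fun_cong[OF x(2), of f] that by simp
  then show ?thesis using x(1) by (intro bexI[of _ x] ballI)
qed

lemma reflexiveI:
  assumes "\<And>\<Phi>. \<Phi> \<in> bounded_ops (dual_space X) scalar_space \<Longrightarrow> \<exists>x\<in>carrier X. \<forall>f\<in>carrier (dual_space X). \<Phi> f = f x"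
  shows "reflexive X" unfolding reflexive_def
proof
  interpret D: normed_mod "dual_space X" by (rule dual_normed)
  fix \<Phi> assume \<Phi>: "\<Phi> \<in> carrier (dual_space (dual_space X))"
  then obtain x where "x \<in> carrier X" "\<forall>f\<in>carrier (dual_space X). \<Phi> f = f x"
    using assms[of \<Phi>] by (auto simp: D.dual_carrier)
  moreover then have "\<Phi> = (\<lambda>f\<in>carrier (dual_space X). f x)"
    using \<Phi> by (auto simp: D.dual_carrier fun_eq_iff restrict_def extensional_def)
  ultimately show "\<exists>x\<in>carrier X. \<Phi> = (\<lambda>f\<in>carrier (dual_space X). f x)" by blast
qed

end

text \<open>The adjoint of \<open>A\<close>, which inherits the bound of \<open>A\<close>. It is
  needed for the quotient map, the coordinate maps and the coordinate embeddings.\<close>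

lemma dual_pullback:
  assumes "normed_mod X" "normed_mod Y" "A \<in> bounded_ops X Y"
  shows "(\<lambda>f. \<lambda>x\<in>carrier X. f (A x)) \<in> bounded_ops (dual_space Y) (dual_space X)"
proof -
  interpret op X Y A using assms by (intro op.intro op_axioms.intro)
  obtain C where C: "C > 0" "\<And>x. x \<in> carrier X \<Longrightarrow> nrm Y (A x) \<le> C * nrm X x" using bound by blast
  have cl': "(\<lambda>x\<in>carrier X. f (A x)) \<in> carrier (dual_space X)" if f: "f \<in> carrier (dual_space Y)" for f
    using f bounded_ops_comp[OF A, of f scalar_space] by (intro X.dual_restrict) (auto simp: Y.dual_carrier Y.norm_ge0)
  show ?thesis
  proof (rule bounded_opsI)
    fix f assume f: "f \<in> carrier (dual_space Y)"
    show "nrm (dual_space X) (\<lambda>x\<in>carrier X. f (A x)) \<le> C * nrm (dual_space Y) f"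
    proof (rule X.dual_least[OF cl'[OF f]])
      fix x assume x: "x \<in> carrier X" "nrm X x \<le> 1"
      have "C * nrm X x \<le> C * 1" using C(1) x by (intro mult_left_mono) auto
      then have "nrm Y (A x) \<le> C" using C(2)[OF x(1)] by simp
      then have "nrm (dual_space Y) f * nrm Y (A x) \<le> nrm (dual_space Y) f * C"
        using Y.dual_norm_ge0[OF f] by (rule mult_left_mono)
      then show "norm ((\<lambda>x\<in>carrier X. f (A x)) x) \<le> C * nrm (dual_space Y) f"
        using Y.dual_bound[OF f, of "A x"] x by (simp add: mult.commute)
    qed
  qed (use cl' in \<open>auto simp: X.dual_simps Y.dual_simps fun_eq_iff restrict_def\<close>)
qed

section \<open>Weighted sequence spaces and quotients\<close>

text \<open>For positive arguments this is convexity; if one argument is 0, it reduces to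
  \<open>\<mu> powr p \<le> \<mu>\<close> for \<mu> between 0 and 1.\<close>

lemma powr_convex_nonneg:
  fixes p l x y :: real
  assumes "p \<ge> 1" "0 \<le> l" "l \<le> 1" "x \<ge> 0" "y \<ge> 0"
  shows "((1 - l) * x + l * y) powr p \<le> (1 - l) * x powr p + l * y powr p"
proof -
  have z: "(\<mu> * u) powr p \<le> \<mu> * u powr p" if "0 \<le> \<mu>" "\<mu> \<le> 1" "u \<ge> 0" for \<mu> u :: real
  proof -
    have "\<mu> powr p \<le> \<mu> powr 1" using that assms(1) powr_mono'[of 1 p \<mu>] by simp
    then show ?thesis using that by (simp add: powr_mult mult_right_mono)
  qed
  consider "x = 0" | "y = 0" | "x > 0" "y > 0" using assms by linarith
  then show ?thesis
  proof cases
    case 1 then show ?thesis using z[of l y] assms by simp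
  next
    case 2 then show ?thesis using z[of "1 - l" x] assms by simp
  next
    case 3
    then show ?thesis using convex_onD[OF powr_convex[OF assms(1)], of l x y] assms by simp
  qed
qed

text \<open>\<open>a + b\<close> is \<open>s + t\<close> times the convex combination of
  \<open>a / s\<close> and \<open>b / t\<close> with weights \<open>s / (s + t)\<close> and
  \<open>t / (s + t)\<close>. Summed over coordinates whose p-th powers total at most
  \<open>s powr p\<close> and \<open>t powr p\<close>, the right-hand side becomes
  \<open>(s + t) powr p\<close>; this is the pointwise form of Minkowski's inequality.\<close>

lemma powr_add_le:
  fixes p a b s t :: real
  assumes "p \<ge> 1" "a \<ge> 0" "b \<ge> 0" "s > 0" "t > 0"
  shows "(a + b) powr p \<le> (s + t) powr p * (s / (s + t) * (a powr p / s powr p) + t / (s + t) * (b powr p / t powr p))"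
proof -
  define l where "l = t / (s + t)"
  have l: "0 \<le> l" "l \<le> 1" "1 - l = s / (s + t)" using assms by (auto simp: l_def field_simps)
  have "a + b = (s + t) * ((1 - l) * (a / s) + l * (b / t))"
  proof -
    have "(1 - l) * (a / s) = a / (s + t)" "l * (b / t) = b / (s + t)"
      unfolding l(3) unfolding l_def using assms by simp_all
    then show ?thesis using assms by (simp add: add_divide_distrib[symmetric])
  qed
  then have "(a + b) powr p = (s + t) powr p * ((1 - l) * (a / s) + l * (b / t)) powr p"
    using assms l by (simp add: powr_mult)
  also have "\<dots> \<le> (s + t) powr p * ((1 - l) * (a / s) powr p + l * (b / t) powr p)"
    using assms l by (intro mult_left_mono powr_convex_nonneg) auto
  finally show ?thesis using assms l by (simp add: powr_divide l_def)
qed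

lemma (in normed_mod) diff_diff_cancel:
  "\<lbrakk>x \<in> carrier X; y \<in> carrier X; z \<in> carrier X\<rbrakk> \<Longrightarrow> (x \<ominus> z) \<ominus> (y \<ominus> z) = x \<ominus> y"
  by (subst a_minus_def[of X x z], subst a_minus_def[of X y z]) (simp add: add_minus_add diff_self)

text \<open>The weight stands inside the p-th power, so that a shift changes the norm by the ratio
  of consecutive weights, whatever \<open>p\<close> is.\<close>

definition ellp :: "('k::real_or_complex, 'a) normed_module \<Rightarrow> real \<Rightarrow> (nat \<Rightarrow> real) \<Rightarrow> ('k, nat \<Rightarrow> 'a) normed_module" where
  "ellp X p w = \<lparr>
     carrier = {x. (\<forall>n. x n \<in> carrier X) \<and> summable (\<lambda>n. (w n * nrm X (x n)) powr p)},
     mult = undefined, one = undefined,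
     zero = (\<lambda>_. \<zero>\<^bsub>X\<^esub>), add = (\<lambda>x y n. x n \<oplus>\<^bsub>X\<^esub> y n), smult = (\<lambda>a x n. a \<odot>\<^bsub>X\<^esub> x n),
     nrm = (\<lambda>x. (\<Sum>n. (w n * nrm X (x n)) powr p) powr (1 / p))\<rparr>"

locale weighted_ellp = banach_space X for X :: "('k::real_or_complex, 'a) normed_module" (structure) +
  fixes p :: real and w :: "nat \<Rightarrow> real"
  assumes p: "p > 1" and w: "\<And>n. w n > 0"
begin

abbreviation "Z \<equiv> ellp X p w"
definition pw :: "(nat \<Rightarrow> 'a) \<Rightarrow> nat \<Rightarrow> real" where "pw x n = (w n * nrm X (x n)) powr p"

lemma carrier_Z: "carrier Z = {x. (\<forall>n. x n \<in> carrier X) \<and> summable (pw x)}"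
  by (simp add: ellp_def pw_def[abs_def])

lemma Z_simps: "zero Z = (\<lambda>_. \<zero>)" "add Z x y = (\<lambda>n. x n \<oplus> y n)" "smult Z a x = (\<lambda>n. a \<odot> x n)"
  "nrm Z x = (suminf (pw x)) powr (1 / p)"
  by (simp_all add: ellp_def pw_def[abs_def])

lemma Z_coord: "x \<in> carrier Z \<Longrightarrow> x n \<in> carrier X"
  and Z_summable: "x \<in> carrier Z \<Longrightarrow> summable (pw x)"
  by (auto simp: carrier_Z)

lemma pw_ge0: "0 \<le> pw x n"
  by (simp add: pw_def)

lemma suminf_pw_ge0: "x \<in> carrier Z \<Longrightarrow> 0 \<le> suminf (pw x)"
  by (intro suminf_nonneg Z_summable pw_ge0)

lemma Z_norm_ge0: "0 \<le> nrm Z x"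
  by (simp add: Z_simps)

lemma Z_norm_powr: "x \<in> carrier Z \<Longrightarrow> nrm Z x powr p = suminf (pw x)"
  using p suminf_pw_ge0[of x] by (simp add: Z_simps powr_powr)

text \<open>All terms are nonnegative, so a bound on partial sums gives membership and the norm
  estimate at once. Later estimates therefore only concern finite sums.\<close>

lemma Z_I:
  assumes "\<And>n. x n \<in> carrier X" "\<And>m. (\<Sum>n<m. pw x n) \<le> B powr p" "B \<ge> 0"
  shows "x \<in> carrier Z" "nrm Z x \<le> B"
proof -
  have s: "summable (pw x)" by (rule summableI_nonneg_bounded[OF pw_ge0 assms(2)])
  show "x \<in> carrier Z" using s assms(1) by (simp add: carrier_Z)
  have "suminf (pw x) \<le> B powr p" by (rule suminf_le_const[OF s assms(2)])
  moreover have "0 \<le> suminf (pw x)" by (intro suminf_nonneg s pw_ge0)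
  ultimately have "suminf (pw x) powr (1/p) \<le> (B powr p) powr (1/p)" using p by (intro powr_mono2) auto
  then show "nrm Z x \<le> B" using p assms(3) by (simp add: Z_simps powr_powr)
qed

lemma Z_partial:
  assumes "x \<in> carrier Z" "finite F"
  shows "(\<Sum>n\<in>F. pw x n) \<le> nrm Z x powr p"
  unfolding Z_norm_powr[OF assms(1)] by (rule sum_le_suminf[OF Z_summable[OF assms(1)] assms(2)]) (simp add: pw_ge0)

lemma Z_coord_le:
  assumes "x \<in> carrier Z"
  shows "w n * nrm X (x n) \<le> nrm Z x"
proof (rule ccontr)
  assume "\<not> ?thesis"
  then have "nrm Z x powr p < (w n * nrm X (x n)) powr p"
    using p Z_norm_ge0 by (intro powr_less_mono2) auto
  then show False using Z_partial[OF assms, of "{n}"] by (simp add: pw_def)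
qed

text \<open>Monotonicity of the norm in the coordinates. Scalar multiples, truncations and operators
  acting coordinatewise are all bounded through it.\<close>

lemma Z_dominated:
  assumes "x \<in> carrier Z" "\<And>n. y n \<in> carrier X" "\<And>n. nrm X (y n) \<le> K * nrm X (x n)" "K \<ge> 0"
  shows "y \<in> carrier Z" "nrm Z y \<le> K * nrm Z x"
proof -
  have "pw y n \<le> K powr p * pw x n" for n
  proof -
    have "pw y n \<le> (K * (w n * nrm X (x n))) powr p" unfolding pw_def
      using w[of n] p assms(2,3)[of n] norm_ge0[OF assms(2)] mult_left_mono[of "nrm X (y n)" "K * nrm X (x n)" "w n"]
      by (intro powr_mono2) (auto simp: mult_ac less_imp_le)
    then show ?thesis using assms(4) w[of n] norm_ge0[OF Z_coord[OF assms(1)]] unfolding pw_def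
      by (simp add: powr_mult)
  qed
  then have "(\<Sum>n<m. pw y n) \<le> K powr p * (\<Sum>n<m. pw x n)" for m
    by (simp add: sum_distrib_left sum_mono)
  then have "(\<Sum>n<m. pw y n) \<le> (K * nrm Z x) powr p" for m
    using mult_left_mono[OF Z_partial[OF assms(1), of "{..<m}"], of "K powr p"] assms(4) Z_norm_ge0[of x]
    by (auto simp: powr_mult intro: order_trans)
  from Z_I[OF assms(2) this] show "y \<in> carrier Z" "nrm Z y \<le> K * nrm Z x"
    using assms(4) Z_norm_ge0 by auto
qed

lemma Z_smult_cl:
  assumes "x \<in> carrier Z"
  shows "(\<lambda>n. a \<odot> x n) \<in> carrier Z" "nrm Z (\<lambda>n. a \<odot> x n) = norm a * nrm Z x"
proof -
  have le: "(\<lambda>n. a \<odot> x n) \<in> carrier Z \<and> nrm Z (\<lambda>n. a \<odot> x n) \<le> norm a * nrm Z x" if "x \<in> carrier Z" for a x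
    using Z_dominated[OF that, of "\<lambda>n. a \<odot> x n" "norm a"] that by (auto simp: Z_coord norm_smult)
  show "(\<lambda>n. a \<odot> x n) \<in> carrier Z" using le assms by blast
  show "nrm Z (\<lambda>n. a \<odot> x n) = norm a * nrm Z x"
  proof (cases "a = 0")
    case True
    then show ?thesis using le[OF assms, of a] Z_norm_ge0[of "\<lambda>n. a \<odot> x n"] by simp
  next
    case False
    have "nrm Z (\<lambda>n. inverse a \<odot> (a \<odot> x n)) \<le> norm (inverse a) * nrm Z (\<lambda>n. a \<odot> x n)"
      using le[of "\<lambda>n. a \<odot> x n" "inverse a"] le[OF assms, of a] by blast
    moreover have "(\<lambda>n. inverse a \<odot> (a \<odot> x n)) = x"
      using False Z_coord[OF assms] by (simp add: smult_assoc)
    ultimately have "norm a * nrm Z x \<le> norm a * (norm (inverse a) * nrm Z (\<lambda>n. a \<odot> x n))"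
      by (intro mult_left_mono) auto
    also have "\<dots> = nrm Z (\<lambda>n. a \<odot> x n)"
      using False by (simp add: nonzero_norm_inverse[OF False] mult.assoc[symmetric])
    finally show ?thesis using le[OF assms, of a] by linarith
  qed
qed

text \<open>Minkowski's inequality, from \<open>powr_add_le\<close> with \<open>s\<close> and
  \<open>t\<close> strictly larger than the two norms. Strictness keeps the denominators positive;
  shrinking \<open>s\<close> and \<open>t\<close> gives the triangle inequality.\<close>

lemma Z_add_cl:
  assumes x: "x \<in> carrier Z" and y: "y \<in> carrier Z"
  shows "(\<lambda>n. x n \<oplus> y n) \<in> carrier Z" "nrm Z (\<lambda>n. x n \<oplus> y n) \<le> nrm Z x + nrm Z y"
proof -
  have *: "(\<lambda>n. x n \<oplus> y n) \<in> carrier Z \<and> nrm Z (\<lambda>n. x n \<oplus> y n) \<le> s + t" if s: "s > nrm Z x" and t: "t > nrm Z y" for s t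
  proof -
    have st: "s > 0" "t > 0" using s t Z_norm_ge0 le_less_trans by blast+
    have "(\<Sum>n<m. pw (\<lambda>n. x n \<oplus> y n) n) \<le> (s + t) powr p" for m
    proof -
      have "pw (\<lambda>n. x n \<oplus> y n) n \<le> (s + t) powr p * (s / (s + t) * (pw x n / s powr p) + t / (s + t) * (pw y n / t powr p))" for n
      proof -
        have "pw (\<lambda>n. x n \<oplus> y n) n \<le> (w n * nrm X (x n) + w n * nrm X (y n)) powr p" unfolding pw_def
          using p w[of n] norm_triangle[OF Z_coord[OF x] Z_coord[OF y], of n n]
          by (intro powr_mono2) (auto simp: less_imp_le norm_ge0 Z_coord x y distrib_left[symmetric])
        also have "\<dots> \<le> (s + t) powr p * (s / (s + t) * (pw x n / s powr p) + t / (s + t) * (pw y n / t powr p))"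
          unfolding pw_def using w[of n] p st
          by (intro powr_add_le) (auto simp: norm_ge0 Z_coord x y less_imp_le)
        finally show ?thesis .
      qed
      then have "(\<Sum>n<m. pw (\<lambda>n. x n \<oplus> y n) n) \<le>
         (\<Sum>n<m. (s + t) powr p * (s / (s + t) * (pw x n / s powr p) + t / (s + t) * (pw y n / t powr p)))"
        by (intro sum_mono)
      also have "\<dots> = (s + t) powr p * (s / (s + t) * ((\<Sum>n<m. pw x n) / s powr p) + t / (s + t) * ((\<Sum>n<m. pw y n) / t powr p))"
        by (induction m) (simp_all add: algebra_simps add_divide_distrib)
      also have "\<dots> \<le> (s + t) powr p * (s / (s + t) * 1 + t / (s + t) * 1)"
      proof (intro mult_left_mono add_mono)
        have "(\<Sum>n<m. pw x n) \<le> s powr p"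
          using Z_partial[OF x, of "{..<m}"] powr_mono2[of p "nrm Z x" s] s p Z_norm_ge0 by fastforce
        then show "(\<Sum>n<m. pw x n) / s powr p \<le> 1" using st by (simp add: divide_le_eq)
        have "(\<Sum>n<m. pw y n) \<le> t powr p"
          using Z_partial[OF y, of "{..<m}"] powr_mono2[of p "nrm Z y" t] t p Z_norm_ge0 by fastforce
        then show "(\<Sum>n<m. pw y n) / t powr p \<le> 1" using st by (simp add: divide_le_eq)
      qed (use st in auto)
      also have "\<dots> = (s + t) powr p" using st by (simp add: add_divide_distrib[symmetric])
      finally show ?thesis .
    qed
    from Z_I[OF _ this] show ?thesis using st x y by (auto simp: Z_coord)
  qed
  show "(\<lambda>n. x n \<oplus> y n) \<in> carrier Z" using *[of "nrm Z x + 1" "nrm Z y + 1"] by simp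
  show "nrm Z (\<lambda>n. x n \<oplus> y n) \<le> nrm Z x + nrm Z y"
  proof (rule field_le_epsilon)
    fix e :: real assume "e > 0"
    then show "nrm Z (\<lambda>n. x n \<oplus> y n) \<le> nrm Z x + nrm Z y + e" using *[of "nrm Z x + e/2" "nrm Z y + e/2"] by simp
  qed
qed

lemma Z_zero_cl: "(\<lambda>_. \<zero>) \<in> carrier Z"
  by (simp add: carrier_Z pw_def[abs_def])

lemma Z_normed: "normed_mod Z"
proof (intro normed_mod.intro moduleI cring_scalar_ring abelian_groupI normed_mod_axioms.intro)
  fix x assume x: "x \<in> carrier Z"
  show "\<exists>y\<in>carrier Z. y \<oplus>\<^bsub>Z\<^esub> x = \<zero>\<^bsub>Z\<^esub>"
  proof (rule bexI[OF _ Z_smult_cl(1)[OF x, of "-1"]])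
    have "(-1) \<odot> x n \<oplus> x n = \<zero>" for n
      using Z_coord[OF x, of n] by (simp add: M.a_comm[of "(-1) \<odot> x n"] minus_smult[symmetric] diff_self)
    then show "(\<lambda>n. (-1) \<odot> x n) \<oplus>\<^bsub>Z\<^esub> x = \<zero>\<^bsub>Z\<^esub>" by (simp add: Z_simps)
  qed
  show "nrm Z x = 0 \<longleftrightarrow> x = \<zero>\<^bsub>Z\<^esub>"
  proof
    assume "nrm Z x = 0"
    then have "nrm X (x n) \<le> 0" for n using Z_coord_le[OF x, of n] w[of n] by (simp add: mult_le_0_iff)
    then have "x n = \<zero>" for n using norm_ge0[OF Z_coord[OF x]] norm_0_iff[OF Z_coord[OF x]] by (simp add: order_antisym)
    then show "x = \<zero>\<^bsub>Z\<^esub>" by (auto simp: Z_simps)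
  next
    assume "x = \<zero>\<^bsub>Z\<^esub>" then show "nrm Z x = 0" by (simp add: Z_simps pw_def[abs_def])
  qed
  show "0 \<le> nrm Z x" by (rule Z_norm_ge0)
  show "nrm Z (a \<odot>\<^bsub>Z\<^esub> x) = norm a * nrm Z x" for a using Z_smult_cl(2)[OF x] by (simp add: Z_simps)
  fix y assume y: "y \<in> carrier Z"
  show "nrm Z (x \<oplus>\<^bsub>Z\<^esub> y) \<le> nrm Z x + nrm Z y" using Z_add_cl(2)[OF x y] by (simp add: Z_simps)
qed (auto simp: Z_simps Z_add_cl Z_smult_cl Z_zero_cl Z_coord M.a_ac smult_add_left smult_add_right smult_assoc)

sublocale Z: normed_mod Z by (rule Z_normed)

lemma Z_diff: "x \<in> carrier Z \<Longrightarrow> y \<in> carrier Z \<Longrightarrow> x \<ominus>\<^bsub>Z\<^esub> y = (\<lambda>n. x n \<ominus> y n)"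
  by (simp add: Z.minus_smult Z_simps minus_smult Z_coord)

text \<open>The coordinates converge because each coordinate map is bounded. Passing to the limit in
  finitely many coordinates at a time, as in Fatou's lemma, preserves the Cauchy bound; so the
  difference to \<open>u 0\<close> lies in Z, and with it the limit.\<close>

lemma Z_banach: "banach_space Z"
proof (rule Z.banach_spaceI_fast)
  fix u assume u: "range u \<subseteq> carrier Z" and st: "\<And>n. nrm Z (u (Suc n) \<ominus>\<^bsub>Z\<^esub> u n) \<le> (1/2) ^ n"
  have uc: "u n \<in> carrier Z" for n using u by auto
  have st1: "nrm Z (u (Suc n) \<ominus>\<^bsub>Z\<^esub> u n) \<le> 1 * (1/2) ^ n" for n using st by simp
  note fd = Z.fast_dist[OF u _ _ st1]
  have "\<exists>y. y \<in> carrier X \<and> tends X (\<lambda>n. u n k) y" for k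
  proof -
    have "nrm X (u (Suc n) k \<ominus> u n k) \<le> (1 / w k) * (1/2) ^ n" for n
      using order_trans[OF Z_coord_le[OF Z.M.minus_closed[OF uc uc]] st, of k n] w[of k]
      by (simp add: Z_diff uc field_simps)
    from complete_fast[OF Z_coord[OF uc] _ _ this] show ?thesis by auto
  qed
  then obtain x where x: "\<And>k. x k \<in> carrier X" "\<And>k. tends X (\<lambda>n. u n k) (x k)" by metis
  have d: "(\<lambda>k. x k \<ominus> u n k) \<in> carrier Z \<and> nrm Z (\<lambda>k. x k \<ominus> u n k) \<le> 2 * (1/2) ^ n" for n
  proof -
    have "(\<Sum>k<m. pw (\<lambda>k. x k \<ominus> u n k) k) \<le> (2 * (1/2)^n) powr p" for m
    proof (rule LIMSEQ_le_const2)
      have "(\<lambda>j. nrm X (u (n + j) k \<ominus> u n k)) \<longlonglongrightarrow> nrm X (x k \<ominus> u n k)" for k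
      proof -
        have sub: "tends X (\<lambda>j. u (n + j) k) (x k)"
          using LIMSEQ_ignore_initial_segment[OF x(2)[of k, unfolded tends_def], of n] by (simp add: tends_def add.commute)
        have "tends X (\<lambda>j. u (n + j) k \<ominus> u n k) (x k \<ominus> u n k)"
          using sub Z_coord[OF uc] x(1) unfolding tends_def by (simp add: diff_diff_cancel)
        then show ?thesis by (rule tends_norm) (use Z_coord[OF uc] x(1) in auto)
      qed
      then show "(\<lambda>j. \<Sum>k<m. pw (\<lambda>k. u (n + j) k \<ominus> u n k) k) \<longlonglongrightarrow> (\<Sum>k<m. pw (\<lambda>k. x k \<ominus> u n k) k)"
        unfolding pw_def using p by (intro tendsto_sum tendsto_powr2 tendsto_intros)
          (auto intro!: always_eventually mult_nonneg_nonneg less_imp_le[OF w] norm_ge0 simp: Z_coord uc)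
      have "(\<Sum>k<m. pw (\<lambda>k. u (n + j) k \<ominus> u n k) k) \<le> (2 * (1/2)^n) powr p" for j
      proof -
        have "(\<Sum>k<m. pw (\<lambda>k. u (n + j) k \<ominus> u n k) k) \<le> nrm Z (u (n + j) \<ominus>\<^bsub>Z\<^esub> u n) powr p"
          using Z_partial[OF Z.M.minus_closed[OF uc uc], of "{..<m}" "n + j" n] by (simp add: Z_diff uc)
        also have "\<dots> \<le> (2 * (1/2)^n) powr p"
          using fd[of n j] p Z_norm_ge0 by (intro powr_mono2) auto
        finally show ?thesis .
      qed
      then show "\<exists>N. \<forall>j\<ge>N. (\<Sum>k<m. pw (\<lambda>k. u (n + j) k \<ominus> u n k) k) \<le> (2 * (1/2)^n) powr p" by blast
    qed
    from Z_I[OF _ this] show ?thesis using x(1) Z_coord[OF uc] by auto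
  qed
  have xZ: "x \<in> carrier Z"
  proof -
    have "u 0 \<oplus>\<^bsub>Z\<^esub> (\<lambda>k. x k \<ominus> u 0 k) \<in> carrier Z" using d[of 0] uc by blast
    moreover have "u 0 \<oplus>\<^bsub>Z\<^esub> (\<lambda>k. x k \<ominus> u 0 k) = x"
      using x(1) Z_coord[OF uc] by (simp add: Z_simps add_diff_self)
    ultimately show ?thesis by simp
  qed
  have "tends Z u x"
  proof (rule Z.tends_cmp)
    show "nrm Z (u n \<ominus>\<^bsub>Z\<^esub> x) \<le> 2 * (1/2)^n" for n
      using d[of n] Z.norm_minus_commute[OF xZ uc, of n] by (simp add: Z_diff xZ uc)
    show "(\<lambda>n. 2 * (1/2)^n) \<longlonglongrightarrow> (0::real)" by (auto intro!: tendsto_eq_intros LIMSEQ_realpow_zero)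
  qed (use u xZ in auto)
  then show "\<exists>x\<in>carrier Z. tends Z u x" using xZ by blast
qed

sublocale Z: banach_space Z by (rule Z_banach)

definition single :: "nat \<Rightarrow> 'a \<Rightarrow> nat \<Rightarrow> 'a" where
  "single n x = (\<lambda>k. if k = n then x else \<zero>)"

lemma pw_single: "pw (single n x) k = (if k = n then (w n * nrm X x) powr p else 0)"
  by (simp add: pw_def single_def)

lemma single_Z:
  assumes "x \<in> carrier X"
  shows "single n x \<in> carrier Z" "nrm Z (single n x) = w n * nrm X x"
proof -
  have "summable (pw (single n x))" by (rule summable_finite[of "{n}"]) (auto simp: pw_single)
  then show "single n x \<in> carrier Z" using assms by (simp add: carrier_Z) (simp add: single_def)
  have "suminf (pw (single n x)) = (w n * nrm X x) powr p"
    by (subst suminf_finite[of "{n}"]) (auto simp: pw_single)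
  then show "nrm Z (single n x) = w n * nrm X x"
    using p w[of n] norm_ge0[OF assms] by (simp add: Z_simps powr_powr)
qed

lemma single_op: "single n \<in> bounded_ops X Z"
proof (rule bounded_opsI[of _ _ _ "w n"])
  show "single n (x \<oplus> y) = single n x \<oplus>\<^bsub>Z\<^esub> single n y" for x y by (auto simp: single_def Z_simps)
  show "single n (a \<odot> x) = a \<odot>\<^bsub>Z\<^esub> single n x" for a x by (auto simp: single_def Z_simps)
qed (simp_all add: single_Z)

lemma coord_op: "(\<lambda>z. z n) \<in> bounded_ops Z X"
proof (rule bounded_opsI[of _ _ _ "1 / w n"])
  fix z assume "z \<in> carrier Z"
  then show "nrm X (z n) \<le> 1 / w n * nrm Z z" using Z_coord_le[of z n] w[of n] by (simp add: field_simps)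
qed (auto simp: Z_coord Z_simps)

definition trunc :: "nat \<Rightarrow> (nat \<Rightarrow> 'a) \<Rightarrow> nat \<Rightarrow> 'a" where
  "trunc m z = (\<lambda>k. if k < m then z k else \<zero>)"

lemma trunc_Z:
  assumes "z \<in> carrier Z" shows "trunc m z \<in> carrier Z" "nrm Z (trunc m z) \<le> nrm Z z"
  using Z_dominated[OF assms, of "trunc m z" 1] Z_coord[OF assms] norm_ge0[OF Z_coord[OF assms]]
  by (auto simp: trunc_def)

lemma trunc_0: "trunc 0 z = \<zero>\<^bsub>Z\<^esub>"
  by (simp add: trunc_def Z_simps)

lemma trunc_Suc: "z \<in> carrier Z \<Longrightarrow> trunc (Suc m) z = trunc m z \<oplus>\<^bsub>Z\<^esub> single m (z m)"
  by (auto simp: trunc_def Z_simps single_def fun_eq_iff less_Suc_eq Z_coord)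

text \<open>The p-th power of the error is a tail of a convergent series. Finitely supported
  sequences are thus dense, which strong continuity, measurability and the duality argument all rely
  on.\<close>

lemma trunc_tends:
  assumes z: "z \<in> carrier Z" shows "tends Z (\<lambda>m. trunc m z) z"
proof -
  have tl: "nrm Z (trunc m z \<ominus>\<^bsub>Z\<^esub> z) powr p = (\<Sum>k. pw z (k + m))" for m
  proof -
    have dZ: "z \<ominus>\<^bsub>Z\<^esub> trunc m z \<in> carrier Z" using z trunc_Z by simp
    have e: "pw (z \<ominus>\<^bsub>Z\<^esub> trunc m z) k = (if k < m then 0 else pw z k)" for k
      unfolding Z_diff[OF z trunc_Z(1)[OF z]] pw_def
      using z by (simp add: trunc_def diff_self diff_zero Z_coord)
    have "nrm Z (z \<ominus>\<^bsub>Z\<^esub> trunc m z) powr p = suminf (pw (z \<ominus>\<^bsub>Z\<^esub> trunc m z))"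
      by (rule Z_norm_powr[OF dZ])
    also have "\<dots> = (\<Sum>k. pw (z \<ominus>\<^bsub>Z\<^esub> trunc m z) (k + m)) + (\<Sum>k<m. pw (z \<ominus>\<^bsub>Z\<^esub> trunc m z) k)"
      by (rule suminf_split_initial_segment[OF Z_summable[OF dZ]])
    also have "\<dots> = (\<Sum>k. pw z (k + m))" by (simp add: e)
    finally show ?thesis using Z.norm_minus_commute[OF z trunc_Z(1)[OF z]] by simp
  qed
  have "(\<lambda>m. (\<Sum>k. pw z (k + m))) \<longlonglongrightarrow> 0"
    by (rule suminf_exist_split2[OF Z_summable[OF z]])
  then have "(\<lambda>m. (nrm Z (trunc m z \<ominus>\<^bsub>Z\<^esub> z) powr p) powr (1/p)) \<longlonglongrightarrow> 0 powr (1/p)"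
    unfolding tl using p by (intro tendsto_powr2 tendsto_intros)
      (auto intro!: always_eventually suminf_nonneg pw_ge0 simp: summable_iff_shift Z_summable[OF z])
  then show ?thesis using p Z_norm_ge0 by (simp add: tends_def powr_powr)
qed

end

section \<open>Quotients by closed subspaces\<close>

definition coset_of :: "('k, 'a) normed_module \<Rightarrow> 'a set \<Rightarrow> 'a \<Rightarrow> 'a set" where
  "coset_of Z N z = {z' \<in> carrier Z. z' \<ominus>\<^bsub>Z\<^esub> z \<in> N}"

text \<open>Elements are the cosets themselves, and the operations go through chosen
  representatives; \<open>Y_add\<close> and \<open>Y_smult\<close> make them independent of the
  choice.\<close>

definition quotient_space :: "('k, 'a) normed_module \<Rightarrow> 'a set \<Rightarrow> ('k, 'a set) normed_module" where
  "quotient_space Z N = \<lparr>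
     carrier = coset_of Z N ` carrier Z, mult = undefined, one = undefined, zero = coset_of Z N \<zero>\<^bsub>Z\<^esub>,
     add = (\<lambda>y y'. coset_of Z N ((SOME z. z \<in> y) \<oplus>\<^bsub>Z\<^esub> (SOME z. z \<in> y'))),
     smult = (\<lambda>a y. coset_of Z N (a \<odot>\<^bsub>Z\<^esub> (SOME z. z \<in> y))), nrm = (\<lambda>y. INF z\<in>y. nrm Z z)\<rparr>"

locale banach_quotient = banach_space Z for Z :: "('k::real_or_complex, 'a) normed_module" (structure) +
  fixes N
  assumes N_closed: "closed_subset Z N" and N_zero: "\<zero> \<in> N"
    and N_add: "x \<in> N \<Longrightarrow> y \<in> N \<Longrightarrow> x \<oplus> y \<in> N" and N_smult: "x \<in> N \<Longrightarrow> a \<odot> x \<in> N"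
begin

abbreviation "Y \<equiv> quotient_space Z N"
abbreviation "cls \<equiv> coset_of Z N"

lemma N_sub: "x \<in> N \<Longrightarrow> x \<in> carrier Z" using N_closed unfolding closed_subset_def by auto

lemma N_minus: "x \<in> N \<Longrightarrow> y \<in> N \<Longrightarrow> x \<ominus> y \<in> N"
  by (simp add: minus_smult N_sub N_add N_smult)

lemma cls_self: "z \<in> carrier Z \<Longrightarrow> z \<in> cls z"
  by (simp add: coset_of_def diff_self N_zero)

lemma cls_eq_iff:
  assumes "z \<in> carrier Z" "z' \<in> carrier Z"
  shows "cls z = cls z' \<longleftrightarrow> z \<ominus> z' \<in> N"
proof
  assume "cls z = cls z'"
  then show "z \<ominus> z' \<in> N" using cls_self[OF assms(1)] by (simp add: coset_of_def)
next
  assume d: "z \<ominus> z' \<in> N"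
  have "v \<ominus> z \<in> N \<longleftrightarrow> v \<ominus> z' \<in> N" if v: "v \<in> carrier Z" for v
  proof
    assume "v \<ominus> z \<in> N"
    then show "v \<ominus> z' \<in> N" using N_add[OF _ d, of "v \<ominus> z"] diff_split[of v z z'] v assms by simp
  next
    assume "v \<ominus> z' \<in> N"
    moreover have "z' \<ominus> z \<in> N" using N_minus[OF N_zero d] assms
      by (simp add: a_minus_def M.minus_add M.a_comm)
    ultimately show "v \<ominus> z \<in> N" using N_add[of "v \<ominus> z'" "z' \<ominus> z"] diff_split[of v z' z] v assms by simp
  qed
  then show "cls z = cls z'" by (auto simp: coset_of_def)
qed

lemma cls_mem: "z \<in> carrier Z \<Longrightarrow> z' \<in> cls z \<longleftrightarrow> z' \<in> carrier Z \<and> cls z' = cls z"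
  using cls_eq_iff[of z' z] by (auto simp: coset_of_def[of Z N z])

lemma cls_zero_iff: "z \<in> carrier Z \<Longrightarrow> cls z = cls \<zero> \<longleftrightarrow> z \<in> N"
  by (simp add: cls_eq_iff diff_zero)

lemma some_cls:
  assumes "z \<in> carrier Z" shows "(SOME v. v \<in> cls z) \<in> carrier Z" "cls (SOME v. v \<in> cls z) = cls z"
  using someI[of "\<lambda>v. v \<in> cls z", OF cls_self[OF assms]] cls_mem[OF assms] by auto

lemma carrier_Y: "carrier Y = cls ` carrier Z"
  and Y_zero: "zero Y = cls \<zero>"
  and Y_nrm: "nrm Y y = (INF z\<in>y. nrm Z z)"
  by (simp_all add: quotient_space_def)

lemma Y_add:
  assumes z: "z \<in> carrier Z" "z' \<in> carrier Z"
  shows "cls z \<oplus>\<^bsub>Y\<^esub> cls z' = cls (z \<oplus> z')"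
proof -
  let ?s = "SOME v. v \<in> cls z" let ?s' = "SOME v. v \<in> cls z'"
  have "?s \<ominus> z \<in> N" "?s' \<ominus> z' \<in> N"
    using some_cls[OF z(1)] some_cls[OF z(2)] z by (simp_all add: cls_eq_iff[symmetric])
  then have "(?s \<oplus> ?s') \<ominus> (z \<oplus> z') \<in> N" using z some_cls by (simp add: add_minus_add N_add)
  then have "cls (?s \<oplus> ?s') = cls (z \<oplus> z')" using z some_cls by (subst cls_eq_iff) auto
  then show ?thesis by (simp add: quotient_space_def)
qed

lemma Y_smult:
  assumes z: "z \<in> carrier Z"
  shows "a \<odot>\<^bsub>Y\<^esub> cls z = cls (a \<odot> z)"
proof -
  let ?s = "SOME v. v \<in> cls z"
  have "?s \<ominus> z \<in> N" using some_cls[OF z] z by (simp add: cls_eq_iff[symmetric])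
  then have "a \<odot> ?s \<ominus> a \<odot> z \<in> N" using z some_cls by (simp add: smult_diff[symmetric] N_smult)
  then have "cls (a \<odot> ?s) = cls (a \<odot> z)" using z some_cls by (subst cls_eq_iff) auto
  then show ?thesis by (simp add: quotient_space_def)
qed

lemma Y_bdd: "z \<in> carrier Z \<Longrightarrow> bdd_below (nrm Z ` cls z)"
  by (rule bdd_belowI2[of _ 0]) (auto simp: coset_of_def norm_ge0)

lemma Y_norm_le: "z \<in> carrier Z \<Longrightarrow> nrm Y (cls z) \<le> nrm Z z"
  unfolding Y_nrm by (rule cINF_lower[OF Y_bdd cls_self])

lemma Y_norm_greatest:
  "z \<in> carrier Z \<Longrightarrow> (\<And>v. v \<in> carrier Z \<Longrightarrow> cls v = cls z \<Longrightarrow> B \<le> nrm Z v) \<Longrightarrow> B \<le> nrm Y (cls z)"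
  unfolding Y_nrm by (rule cINF_greatest) (use cls_self cls_mem in auto)

lemma Y_norm_ge0': "z \<in> carrier Z \<Longrightarrow> 0 \<le> nrm Y (cls z)"
  by (rule Y_norm_greatest) (auto simp: norm_ge0)

lemma Y_lift:
  assumes z: "z \<in> carrier Z" and e: "e > 0"
  shows "\<exists>v\<in>carrier Z. cls v = cls z \<and> nrm Z v < nrm Y (cls z) + e"
proof (rule ccontr)
  assume "\<not> ?thesis"
  then have "nrm Y (cls z) + e \<le> nrm Y (cls z)" by (intro Y_norm_greatest[OF z]) (auto simp: not_less)
  then show False using e by simp
qed

lemma Y_normed: "normed_mod Y"
proof (intro normed_mod.intro moduleI cring_scalar_ring abelian_groupI normed_mod_axioms.intro)
  fix y assume "y \<in> carrier Y"
  then obtain z where z: "z \<in> carrier Z" "y = cls z" by (auto simp: carrier_Y)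
  show "\<exists>y'\<in>carrier Y. y' \<oplus>\<^bsub>Y\<^esub> y = \<zero>\<^bsub>Y\<^esub>"
    by (rule bexI[of _ "cls (\<ominus> z)"]) (use z in \<open>auto simp: carrier_Y Y_zero Y_add M.l_neg\<close>)
  show "0 \<le> nrm Y y" using z Y_norm_ge0' by simp
  show "nrm Y y = 0 \<longleftrightarrow> y = \<zero>\<^bsub>Y\<^esub>"
  proof
    assume 0: "nrm Y y = 0"
    \<comment> \<open>Representatives \<open>v n\<close> of norm tending to 0 exhibit
      \<open>z\<close> as the limit of the elements \<open>z \<ominus> v n\<close> of
      \<open>N\<close>; here closedness of \<open>N\<close> enters.\<close>
    have "\<exists>v\<in>carrier Z. cls v = cls z \<and> nrm Z v < 1 / real (Suc n)" for n
      using Y_lift[OF z(1), of "1 / real (Suc n)"] 0 z(2) by simp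
    then obtain v where v: "\<And>n. v n \<in> carrier Z" "\<And>n. cls (v n) = cls z" "\<And>n. nrm Z (v n) < 1 / real (Suc n)" by metis
    have "(\<lambda>n. nrm Z ((z \<ominus> v n) \<ominus> z)) \<longlonglongrightarrow> 0"
    proof (rule Lim_null_comparison[OF always_eventually LIMSEQ_inverse_real_of_nat], rule allI)
      fix n
      have "(z \<ominus> v n) \<ominus> z = \<ominus> v n" using v(1)[of n] z(1) by (simp add: a_minus_def M.a_ac M.r_neg1 M.r_neg2)
      also have "\<ominus> v n = \<zero> \<ominus> v n" using v(1) by (simp add: a_minus_def)
      finally have "nrm Z ((z \<ominus> v n) \<ominus> z) = nrm Z (v n)"
        using norm_minus_commute[of "\<zero>" "v n"] v(1) by (simp add: diff_zero)
      then show "norm (nrm Z ((z \<ominus> v n) \<ominus> z)) \<le> inverse (real (Suc n))"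
        using v(3)[of n] norm_ge0[OF v(1)[of n]] by (simp add: inverse_eq_divide less_imp_le)
    qed
    moreover have "z \<ominus> v n \<in> N" for n using cls_eq_iff[OF z(1) v(1)[of n]] v(2)[of n] by simp
    then have "range (\<lambda>n. z \<ominus> v n) \<subseteq> N" by auto
    ultimately have "z \<in> N" using N_closed z(1) unfolding closed_subset_def by blast
    then show "y = \<zero>\<^bsub>Y\<^esub>" using z by (simp add: Y_zero cls_zero_iff)
  next
    assume "y = \<zero>\<^bsub>Y\<^esub>"
    then show "nrm Y y = 0" using Y_norm_le[of \<zero>] Y_norm_ge0'[of \<zero>] by (simp add: Y_zero)
  qed
  have le: "nrm Y (b \<odot>\<^bsub>Y\<^esub> cls v) \<le> norm b * nrm Y (cls v)" if v: "v \<in> carrier Z" for b v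
  proof (cases "b = 0")
    case True
    then show ?thesis using v Y_norm_le[of \<zero>] by (simp add: Y_smult)
  next
    case False
    have "nrm Y (b \<odot>\<^bsub>Y\<^esub> cls v) / norm b \<le> nrm Y (cls v)"
    proof (rule Y_norm_greatest[OF v])
      fix v' assume v': "v' \<in> carrier Z" "cls v' = cls v"
      have "b \<odot>\<^bsub>Y\<^esub> cls v = cls (b \<odot> v')" using v' Y_smult by metis
      then show "nrm Y (b \<odot>\<^bsub>Y\<^esub> cls v) / norm b \<le> nrm Z v'"
        using Y_norm_le[of "b \<odot> v'"] v'(1) False by (simp add: norm_smult divide_le_eq mult.commute)
    qed
    then show ?thesis using False by (simp add: divide_le_eq mult.commute)
  qed
  show "nrm Y (a \<odot>\<^bsub>Y\<^esub> y) = norm a * nrm Y y" for a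
  proof (cases "a = 0")
    case True
    then show ?thesis using le[OF z(1), of a] Y_norm_ge0'[of "a \<odot> z"] z by (simp add: Y_smult)
  next
    case False
    have "nrm Y (inverse a \<odot>\<^bsub>Y\<^esub> cls (a \<odot> z)) \<le> norm (inverse a) * nrm Y (cls (a \<odot> z))"
      by (rule le) (use z in simp)
    moreover have "inverse a \<odot>\<^bsub>Y\<^esub> cls (a \<odot> z) = y" using z False by (simp add: Y_smult smult_assoc)
    ultimately have "norm a * nrm Y y \<le> norm a * (norm (inverse a) * nrm Y (cls (a \<odot> z)))"
      by (intro mult_left_mono) auto
    also have "\<dots> = nrm Y (cls (a \<odot> z))"
      using False by (simp add: nonzero_norm_inverse[OF False] mult.assoc[symmetric])
    finally show ?thesis using le[OF z(1), of a] z by (simp add: Y_smult)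
  qed
  fix y' assume "y' \<in> carrier Y"
  then obtain z' where z': "z' \<in> carrier Z" "y' = cls z'" by (auto simp: carrier_Y)
  show "nrm Y (y \<oplus>\<^bsub>Y\<^esub> y') \<le> nrm Y y + nrm Y y'"
  proof (rule field_le_epsilon)
    fix e :: real assume e: "e > 0"
    obtain v where v: "v \<in> carrier Z" "cls v = cls z" "nrm Z v < nrm Y (cls z) + e/2" using Y_lift[OF z(1), of "e/2"] e by auto
    obtain v' where v': "v' \<in> carrier Z" "cls v' = cls z'" "nrm Z v' < nrm Y (cls z') + e/2" using Y_lift[OF z'(1), of "e/2"] e by auto
    have "y \<oplus>\<^bsub>Y\<^esub> y' = cls (v \<oplus> v')" using Y_add[OF v(1) v'(1)] v v' z z' by simp
    then show "nrm Y (y \<oplus>\<^bsub>Y\<^esub> y') \<le> nrm Y y + nrm Y y' + e"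
      using Y_norm_le[of "v \<oplus> v'"] norm_triangle[OF v(1) v'(1)] v v' z(2) z'(2) by simp
  qed
qed (auto simp: carrier_Y Y_zero Y_add Y_smult M.a_ac smult_add_left smult_add_right smult_assoc)

sublocale Y: normed_mod Y by (rule Y_normed)

lemma cls_op: "cls \<in> bounded_ops Z Y"
  by (rule bounded_opsI[of _ _ _ 1]) (auto simp: carrier_Y Y_add Y_smult Y_norm_le)

sublocale cls: op Z Y cls
  by unfold_locales (rule cls_op)

text \<open>The infimum need not be attained. The factor 2 leaves room when the norm is positive,
  and norm 0 occurs only for the class of zero.\<close>

lemma Y_section:
  assumes y: "y \<in> carrier Y"
  shows "\<exists>z\<in>carrier Z. cls z = y \<and> nrm Z z \<le> 2 * nrm Y y"
proof (cases "nrm Y y = 0")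
  case True
  then have "y = cls \<zero>" using Y.norm_0_iff[OF y] by (simp add: Y_zero)
  then show ?thesis using True by (intro bexI[of _ \<zero>]) auto
next
  case False
  then have "nrm Y y > 0" using Y.norm_ge0[OF y] by simp
  moreover obtain z where "z \<in> carrier Z" "y = cls z" using y by (auto simp: carrier_Y)
  ultimately obtain v where "v \<in> carrier Z" "cls v = cls z" "nrm Z v < nrm Y (cls z) + nrm Y y" "y = cls z"
    using Y_lift[of z "nrm Y y"] by blast
  then show ?thesis by (intro bexI[of _ v]) auto
qed

text \<open>Lifting the increments, not the terms, and summing them in Z gives a rapidly converging
  sequence above \<open>u\<close>.\<close>

lemma Y_banach: "banach_space Y"
proof (rule Y.banach_spaceI_fast)
  fix u assume u: "range u \<subseteq> carrier Y" and st: "\<And>n. nrm Y (u (Suc n) \<ominus>\<^bsub>Y\<^esub> u n) \<le> (1/2) ^ n"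
  have uc: "u n \<in> carrier Y" for n using u by auto
  have "\<exists>d\<in>carrier Z. cls d = u (Suc n) \<ominus>\<^bsub>Y\<^esub> u n \<and> nrm Z d \<le> 2 * nrm Y (u (Suc n) \<ominus>\<^bsub>Y\<^esub> u n)" for n
    by (rule Y_section) (use uc in simp)
  then obtain d where d: "\<And>n. d n \<in> carrier Z" "\<And>n. cls (d n) = u (Suc n) \<ominus>\<^bsub>Y\<^esub> u n"
    "\<And>n. nrm Z (d n) \<le> 2 * nrm Y (u (Suc n) \<ominus>\<^bsub>Y\<^esub> u n)" by metis
  obtain z0 where z0: "z0 \<in> carrier Z" "cls z0 = u 0" using Y_section[OF uc[of 0]] by blast
  define z where "z = rec_nat z0 (\<lambda>n v. v \<oplus> d n)"
  have z_simps: "z 0 = z0" "z (Suc n) = z n \<oplus> d n" for n by (simp_all add: z_def)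
  have zc: "z n \<in> carrier Z" for n by (induction n) (auto simp: z_simps z0 d)
  have zu: "cls (z n) = u n" for n
    by (induction n) (auto simp: z_simps z0 d zc Y_add[symmetric] Y.add_diff_self uc)
  have "nrm Z (z (Suc n) \<ominus> z n) \<le> 2 * (1/2)^n" for n
    using d(3)[of n] st[of n] zc[of n] d(1)[of n] by (simp add: z_simps M.a_comm[of "z n"] add_diff_cancel)
  from complete_fast[OF zc _ _ this] obtain x where x: "x \<in> carrier Z" "tends Z z x" by auto
  have "tends Y (\<lambda>n. cls (z n)) (cls x)" by (rule cls.tends[OF x(2) _ x(1)]) (use zc in auto)
  then show "\<exists>x\<in>carrier Y. tends Y u x" using x(1) unfolding zu by (auto simp: carrier_Y)
qed

sublocale Y: banach_space Y by (rule Y_banach)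

definition induced :: "('a \<Rightarrow> 'a) \<Rightarrow> 'a set \<Rightarrow> 'a set" where
  "induced B y = cls (B (SOME z. z \<in> y))"

lemma induced_cls:
  assumes B: "B \<in> bounded_ops Z Z" "\<And>x. x \<in> N \<Longrightarrow> B x \<in> N" and z: "z \<in> carrier Z"
  shows "induced B (cls z) = cls (B z)"
proof -
  interpret B: op Z Z B using B(1) by unfold_locales
  let ?s = "SOME v. v \<in> cls z"
  have "?s \<ominus> z \<in> N" using some_cls[OF z] z by (simp add: cls_eq_iff[symmetric])
  then have "B ?s \<ominus> B z \<in> N" using B(2) some_cls z by (simp add: B.diff[symmetric])
  then show ?thesis using some_cls z by (simp add: induced_def cls_eq_iff)
qed

text \<open>Every bound \<open>C\<close> of \<open>B\<close> survives on the quotient, because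
  representatives come arbitrarily close to the infimum. The explicit bound is needed uniformly in
  time when continuity of the group from the left is proved.\<close>

lemma induced_op:
  assumes B: "B \<in> bounded_ops Z Z" "\<And>x. x \<in> N \<Longrightarrow> B x \<in> N"
    and C: "\<And>z. z \<in> carrier Z \<Longrightarrow> nrm Z (B z) \<le> C * nrm Z z"
  shows "induced B \<in> bounded_ops Y Y" "\<And>y. y \<in> carrier Y \<Longrightarrow> nrm Y (induced B y) \<le> C * nrm Y y"
proof -
  interpret B: op Z Z B using B(1) by unfold_locales
  show bd: "nrm Y (induced B y) \<le> C * nrm Y y" if "y \<in> carrier Y" for y
  proof -
    from that obtain z where z: "z \<in> carrier Z" "y = cls z" by (auto simp: carrier_Y)
    \<comment> \<open>A negative \<open>C\<close> is compatible only with norm zero, since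
      \<open>B z\<close> has nonnegative norm. In the remaining case multiplication by
      \<open>C\<close> is monotone.\<close>
    have C0: "C \<ge> 0 \<or> nrm Y y = 0"
    proof (rule ccontr)
      assume "\<not> ?thesis"
      then have "C < 0" "nrm Z z > 0" using Y_norm_le[OF z(1)] Y.norm_ge0[OF that] z(2) by auto
      then have "C * nrm Z z < 0" by (simp add: mult_neg_pos)
      then show False using C[OF z(1)] norm_ge0[OF B.cl[OF z(1)]] by linarith
    qed
    show ?thesis
    proof (cases "nrm Y y = 0")
      case True
      then have "y = cls \<zero>" using Y.norm_0_iff[OF that] by (simp add: Y_zero)
      then show ?thesis using True Y_norm_le[of \<zero>] by (simp add: induced_cls[OF B] B.zero)
    next
      case False
      then have C0: "C \<ge> 0" using C0 by simp
      show ?thesis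
      proof (rule field_le_epsilon)
        fix e :: real assume e: "e > 0"
        obtain v where v: "v \<in> carrier Z" "cls v = cls z" "nrm Z v < nrm Y (cls z) + e / (C + 1)"
          using Y_lift[OF z(1), of "e / (C + 1)"] e C0 by auto
        have "nrm Y (induced B y) \<le> nrm Z (B v)"
          using Y_norm_le[of "B v"] v(1) induced_cls[OF B v(1)] v(2) z(2) by simp
        also have "\<dots> \<le> C * (nrm Y y + e / (C + 1))"
          using C[OF v(1)] v(3) C0 z(2) mult_left_mono[of "nrm Z v" "nrm Y y + e / (C + 1)" C] by auto
        also have "\<dots> \<le> C * nrm Y y + e" using C0 e by (simp add: field_simps)
        finally show "nrm Y (induced B y) \<le> C * nrm Y y + e" .
      qed
    qed
  qed
  show "induced B \<in> bounded_ops Y Y"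
    by (rule bounded_opsI[OF _ _ _ bd]) (auto simp: carrier_Y induced_cls[OF B] Y_add Y_smult B.add B.smult)
qed

end

section \<open>The group extension\<close>

context banach_space begin

text \<open>Otherwise there are times \<open>t n\<close> tending to 0 at which the operator norm
  exceeds \<open>n + 1\<close>. Strong continuity bounds every orbit along these times, which
  contradicts uniform boundedness.\<close>

lemma semigroup_bounded_near_0:
  assumes T: "C0_semigroup X T"
  shows "\<exists>\<delta>>0. \<exists>C. \<forall>t\<in>{0..\<delta>}. \<forall>x\<in>carrier X. nrm X (T t x) \<le> C * nrm X x"
proof (rule ccontr)
  assume neg: "\<not> ?thesis"
  have op: "T t \<in> bounded_ops X X" if "t \<ge> 0" for t using T that by (simp add: C0_semigroup_def)
  have T0: "T 0 x = x" if "x \<in> carrier X" for x using T that by (simp add: C0_semigroup_def)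
  have lim: "((\<lambda>t. nrm X (T t x \<ominus> x)) \<longlongrightarrow> 0) (at_right 0)" if "x \<in> carrier X" for x
    using T that by (simp add: C0_semigroup_def)
  have "\<exists>t x. 0 < t \<and> t \<le> 1 / real (Suc n) \<and> x \<in> carrier X \<and> nrm X (T t x) > real (Suc n) * nrm X x" for n
  proof -
    have "\<not> (\<forall>t\<in>{0..1 / real (Suc n)}. \<forall>x\<in>carrier X. nrm X (T t x) \<le> real (Suc n) * nrm X x)"
      using neg by (metis of_nat_0_less_iff zero_less_Suc zero_less_divide_1_iff)
    then obtain t x where tx: "t \<in> {0..1 / real (Suc n)}" "x \<in> carrier X" "nrm X (T t x) > real (Suc n) * nrm X x"
      by (auto simp: not_le)
    \<comment> \<open>The limit at 0 from the right says nothing about time 0 itself. It is excluded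
      because \<open>T 0\<close> is the identity and the claimed growth factor is at least
      1.\<close>
    have "t \<noteq> 0"
    proof
      assume "t = 0"
      then have "nrm X x > (1 + real n) * nrm X x" using tx T0 by simp
      then have "real n * nrm X x < 0" by (simp add: algebra_simps)
      then show False using norm_ge0[OF tx(2)] by (simp add: mult_less_0_iff)
    qed
    then show ?thesis using tx by (intro exI[of _ t] exI[of _ x]) auto
  qed
  then obtain t x where t: "\<And>n. 0 < t n" "\<And>n. t n \<le> 1 / real (Suc n)"
    and x: "\<And>n. x n \<in> carrier X" "\<And>n. nrm X (T (t n) (x n)) > real (Suc n) * nrm X (x n)" by metis
  have t0: "filterlim t (at_right 0) sequentially"
  proof -
    have "t \<longlonglongrightarrow> 0"
      by (rule Lim_null_comparison[OF always_eventually LIMSEQ_inverse_real_of_nat])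
        (use t in \<open>auto simp: inverse_eq_divide less_imp_le\<close>)
    moreover have "t n \<noteq> 0" "0 < t n" for n using t(1)[of n] by simp_all
    ultimately show ?thesis by (simp add: filterlim_at always_eventually)
  qed
  have "\<exists>C>0. \<forall>n\<in>UNIV. \<forall>x\<in>carrier X. nrm X (T (t n) x) \<le> C * nrm X x"
  proof (rule uniform_boundedness[OF banach_space_axioms normed_mod_axioms])
    show "T (t n) \<in> bounded_ops X X" for n using op t(1)[of n] by simp
    fix y assume y: "y \<in> carrier X"
    have "(\<lambda>n. nrm X (T (t n) y \<ominus> y)) \<longlonglongrightarrow> 0"
      by (rule filterlim_compose[OF lim[OF y] t0])
    then have "Bseq (\<lambda>n. nrm X (T (t n) y \<ominus> y))" by (intro convergent_imp_Bseq convergentI)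
    then obtain K where K: "\<And>n. norm (nrm X (T (t n) y \<ominus> y)) \<le> K" by (meson BseqE)
    have "nrm X (T (t n) y) \<le> nrm X y + K" for n
      using norm_le_add_diff[OF bounded_ops_cl[OF op[of "t n"] y] y] K[of n] t(1)[of n] by simp
    then show "\<exists>B. \<forall>n\<in>UNIV. nrm X (T (t n) y) \<le> B" by blast
  qed
  then obtain C where C: "\<And>n x. x \<in> carrier X \<Longrightarrow> nrm X (T (t n) x) \<le> C * nrm X x" by blast
  obtain n where n: "real n > C" using reals_Archimedean2 by blast
  have "real (Suc n) * nrm X (x n) < C * nrm X (x n)" using C[OF x(1)] x(2) by (rule less_le_trans[rotated])
  moreover have "C * nrm X (x n) \<le> real (Suc n) * nrm X (x n)"
    using n norm_ge0[OF x(1)] by (intro mult_right_mono) auto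
  ultimately show False by simp
qed

text \<open>Cutting \<open>t\<close> into pieces of length at most \<delta> gives powers of the
  bound near 0. The maximum with 1 makes these powers increasing, so a single power covers the whole
  interval.\<close>

lemma semigroup_locally_bounded:
  assumes T: "C0_semigroup X T"
  shows "\<exists>M\<ge>1. \<forall>t\<in>{0..\<tau>}. \<forall>x\<in>carrier X. nrm X (T t x) \<le> M * nrm X x"
proof -
  obtain \<delta> C where d: "\<delta> > 0" and C: "\<And>t x. t \<in> {0..\<delta>} \<Longrightarrow> x \<in> carrier X \<Longrightarrow> nrm X (T t x) \<le> C * nrm X x"
    using semigroup_bounded_near_0[OF T] by blast
  have cl: "T t x \<in> carrier X" if "t \<ge> 0" "x \<in> carrier X" for t x
    using T that by (auto simp: C0_semigroup_def intro: bounded_ops_cl)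
  define D where "D = max 1 C"
  have D: "D \<ge> 1" by (simp add: D_def)
  have CD: "nrm X (T t x) \<le> D * nrm X x" if "t \<in> {0..\<delta>}" "x \<in> carrier X" for t x
    using C[OF that] mult_right_mono[of C D "nrm X x"] norm_ge0[OF that(2)] by (simp add: D_def)
  have k: "\<forall>t\<in>{0..real k * \<delta>}. \<forall>x\<in>carrier X. nrm X (T t x) \<le> D ^ k * nrm X x" for k
  proof (induction k)
    case 0 then show ?case using T by (auto simp: C0_semigroup_def)
  next
    case (Suc k)
    show ?case
    proof (intro ballI)
      fix t x assume t: "t \<in> {0..real (Suc k) * \<delta>}" and x: "x \<in> carrier X"
      show "nrm X (T t x) \<le> D ^ Suc k * nrm X x"
      proof (cases "t \<le> \<delta>")
        case True
        have "1 * D * nrm X x \<le> D ^ k * D * nrm X x"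
          using D norm_ge0[OF x] by (intro mult_right_mono one_le_power) auto
        then show ?thesis using CD[of t x] True t x by (simp add: mult.commute)
      next
        case False
        have s: "t - \<delta> \<in> {0..real k * \<delta>}" using False t by (auto simp: algebra_simps)
        have "T t x = T (t - \<delta> + \<delta>) x" by simp
        also have "\<dots> = T (t - \<delta>) (T \<delta> x)"
          using T s d x unfolding C0_semigroup_def by (meson atLeastAtMost_iff less_imp_le)
        finally have "nrm X (T t x) \<le> D ^ k * nrm X (T \<delta> x)" using Suc s cl[OF less_imp_le[OF d] x] by simp
        also have "\<dots> \<le> D ^ k * (D * nrm X x)" using CD[of \<delta> x] d x D by (intro mult_left_mono) auto
        finally show ?thesis by (simp add: mult_ac)
      qed
    qed
  qed
  obtain k where "real k > \<tau> / \<delta>" using reals_Archimedean2 by blast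
  then have "\<tau> \<le> real k * \<delta>" using d by (simp add: divide_less_eq)
  then show ?thesis using k[of k] D by (intro exI[of _ "D ^ k"]) auto
qed

end

section \<open>The exponential lower bound\<close>

locale bounded_below_semigroup = banach_space X for X :: "('k::real_or_complex, 'a) normed_module" (structure) +
  fixes T :: "real \<Rightarrow> 'a \<Rightarrow> 'a" and t0 c :: real
  assumes T: "C0_semigroup X T" and t0: "t0 > 0" and c: "c > 0"
    and low: "x \<in> carrier X \<Longrightarrow> nrm X (T t0 x) \<ge> c * nrm X x"
begin

lemma T_op: "t \<ge> 0 \<Longrightarrow> T t \<in> bounded_ops X X" using T by (simp add: C0_semigroup_def)
lemma T_cl [simp]: "t \<ge> 0 \<Longrightarrow> x \<in> carrier X \<Longrightarrow> T t x \<in> carrier X" using T_op by (auto intro: bounded_ops_cl)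
lemma T_0 [simp]: "x \<in> carrier X \<Longrightarrow> T 0 x = x" using T by (simp add: C0_semigroup_def)
lemma T_add: "s \<ge> 0 \<Longrightarrow> t \<ge> 0 \<Longrightarrow> x \<in> carrier X \<Longrightarrow> T (s + t) x = T s (T t x)"
  using T by (simp add: C0_semigroup_def)
lemma T_lim: "x \<in> carrier X \<Longrightarrow> ((\<lambda>t. nrm X (T t x \<ominus> x)) \<longlongrightarrow> 0) (at_right 0)"
  using T by (simp add: C0_semigroup_def)
lemma T_oper: "t \<ge> 0 \<Longrightarrow> op X X (T t)"
  using T_op by (intro op.intro op_axioms.intro normed_mod_axioms) auto

lemma iterated_lower_bound:
  assumes "x \<in> carrier X"
  shows "c ^ n * nrm X x \<le> nrm X (T (real n * t0) x)"
proof (induction n)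
  case 0 then show ?case using assms by simp
next
  case (Suc n)
  have "T (real (Suc n) * t0) x = T t0 (T (real n * t0) x)"
    using T_add[of t0 "real n * t0" x] t0 assms by (simp add: algebra_simps)
  then have "c * nrm X (T (real n * t0) x) \<le> nrm X (T (real (Suc n) * t0) x)"
    using low[of "T (real n * t0) x"] t0 assms by simp
  moreover have "c * (c ^ n * nrm X x) \<le> c * nrm X (T (real n * t0) x)"
    using Suc c by (intro mult_left_mono) auto
  ultimately show ?case by (simp add: mult_ac)
qed

theorem exponential_lower_bound:
  assumes \<alpha>: "\<alpha> > 1"
  shows "\<exists>m>0. \<forall>x\<in>carrier X. \<forall>t>0. nrm X (T t x) \<ge> m * exp (1 / t0 * ln (c / \<alpha>) * t) * nrm X x"
proof -
  obtain M where M: "M \<ge> 1" "\<And>t x. t \<in> {0..t0} \<Longrightarrow> x \<in> carrier X \<Longrightarrow> nrm X (T t x) \<le> M * nrm X x"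
    using semigroup_locally_bounded[OF T, of t0] by blast
  \<comment> \<open>\<open>1 / M\<close> pays for the operator \<open>T s\<close> with
    \<open>s\<close> at most \<open>t0\<close>; \<open>min 1 c\<close> pays for rounding
    \<open>t / t0\<close> up to an integer, which loses up to one factor \<open>c\<close> when
    \<open>c < 1\<close>.\<close>
  define m where "m = min 1 c / M"
  have m: "m > 0" using M c by (simp add: m_def)
  have "m * exp (1 / t0 * ln (c / \<alpha>) * t) * nrm X x \<le> nrm X (T t x)" if x: "x \<in> carrier X" and t: "t > 0" for x t
  proof -
    define n where "n = nat \<lceil>t / t0\<rceil>"
    have "t / t0 > 0" using t t0 by simp
    then have "real n = of_int \<lceil>t / t0\<rceil>" unfolding n_def by (subst of_nat_nat) linarith+
    then have n: "t / t0 \<le> real n" "real n < t / t0 + 1" by linarith+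
    define s where "s = real n * t0 - t"
    have s: "s \<in> {0..t0}" using n t0 by (auto simp: s_def field_simps)
    have "exp (1 / t0 * ln (c / \<alpha>) * t) = (c / \<alpha>) powr (t / t0)"
      using c \<alpha> by (simp add: powr_def)
    also have "\<dots> \<le> c powr (t / t0)" using c \<alpha> t t0 by (intro powr_mono2) (auto simp: field_simps)
    finally have e: "min 1 c * exp (1 / t0 * ln (c / \<alpha>) * t) \<le> min 1 c * c powr (t / t0)"
      using c by (intro mult_left_mono) auto
    also have "\<dots> \<le> c ^ n"
    proof (cases "c \<ge> 1")
      case True
      then have "c powr (t / t0) \<le> c powr (real n)" using n by (intro powr_mono) auto
      then show ?thesis using True c by (simp add: powr_realpow)
    next
      case False
      then have "c powr (t / t0 + 1) \<le> c powr (real n)" using n c by (intro powr_mono') auto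
      then show ?thesis using False c by (simp add: powr_realpow powr_add mult.commute)
    qed
    finally have e: "min 1 c * exp (1 / t0 * ln (c / \<alpha>) * t) \<le> c ^ n" .
    have "T (real n * t0) x = T s (T t x)" using T_add[of s t x] s t x by (simp add: s_def)
    then have "c ^ n * nrm X x \<le> M * nrm X (T t x)"
      using iterated_lower_bound[OF x, of n] M(2)[OF s, of "T t x"] t x by simp
    moreover have "min 1 c * exp (1 / t0 * ln (c / \<alpha>) * t) * nrm X x \<le> c ^ n * nrm X x"
      using e norm_ge0[OF x] by (rule mult_right_mono)
    ultimately have "min 1 c * exp (1 / t0 * ln (c / \<alpha>) * t) * nrm X x \<le> M * nrm X (T t x)" by linarith
    then show ?thesis using M(1) by (simp add: m_def field_simps)
  qed
  then show ?thesis using m by blast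
qed

end

section \<open>The sequence space, the operator J and the group on the quotient\<close>

locale group_extension = bounded_below_semigroup X T t0 c + weighted_ellp X p w
  for X :: "('k::real_or_complex, 'a) normed_module" (structure) and T t0 c p w +
  assumes w_eq: "w n = (2 / c) ^ n"
begin

definition Tz :: "real \<Rightarrow> (nat \<Rightarrow> 'a) \<Rightarrow> nat \<Rightarrow> 'a" where "Tz t z = (\<lambda>n. T t (z n))"
definition R :: "(nat \<Rightarrow> 'a) \<Rightarrow> nat \<Rightarrow> 'a" where "R z = (\<lambda>n. case n of 0 \<Rightarrow> \<zero> | Suc k \<Rightarrow> z k)"
definition J :: "(nat \<Rightarrow> 'a) \<Rightarrow> nat \<Rightarrow> 'a" where "J u = u \<ominus>\<^bsub>Z\<^esub> R (Tz t0 u)"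
definition N where "N = J ` carrier Z"

lemma R_simps [simp]: "R z 0 = \<zero>" "R z (Suc n) = z n" by (simp_all add: R_def)

lemma Tz_bound:
  assumes t: "t \<ge> 0" and K: "K \<ge> 0" "\<And>x. x \<in> carrier X \<Longrightarrow> nrm X (T t x) \<le> K * nrm X x" and z: "z \<in> carrier Z"
  shows "Tz t z \<in> carrier Z" "nrm Z (Tz t z) \<le> K * nrm Z z"
  using Z_dominated[OF z, of "Tz t z" K] K t Z_coord[OF z] by (auto simp: Tz_def)

lemma Tz_op: assumes t: "t \<ge> 0" shows "Tz t \<in> bounded_ops Z Z"
proof -
  interpret O: op X X "T t" by (rule T_oper[OF t])
  obtain K where K: "K > 0" "\<And>x. x \<in> carrier X \<Longrightarrow> nrm X (T t x) \<le> K * nrm X x" using O.bound by blast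
  show ?thesis
    by (rule bounded_opsI[of _ _ _ K])
      (use Tz_bound[OF t less_imp_le[OF K(1)] K(2)] in \<open>auto simp: Tz_def Z_simps(2,3) O.add O.smult Z_coord\<close>)
qed

lemma R_Z:
  assumes z: "z \<in> carrier Z"
  shows "R z \<in> carrier Z" "nrm Z (R z) \<le> 2 / c * nrm Z z"
proof -
  have e: "pw (R z) (Suc n) = (2 / c) powr p * pw z n" for n
  proof -
    have "w (Suc n) * nrm X (R z (Suc n)) = 2 / c * (w n * nrm X (z n))" by (simp add: w_eq)
    then show ?thesis unfolding pw_def by (simp only: powr_mult)
  qed
  have "pw (R z) 0 = 0" by (simp add: pw_def)
  then have "(\<Sum>n<Suc m. pw (R z) n) = (2 / c) powr p * (\<Sum>n<m. pw z n)" for m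
    by (subst sum.lessThan_Suc_shift) (simp add: e sum_distrib_left)
  moreover have "(\<Sum>n<m. pw (R z) n) \<le> (\<Sum>n<Suc m. pw (R z) n)" for m using pw_ge0[of "R z" m] by simp
  ultimately have 1: "(\<Sum>n<m. pw (R z) n) \<le> (2 / c) powr p * (\<Sum>n<m. pw z n)" for m by metis
  have "(\<Sum>n<m. pw (R z) n) \<le> (2 / c * nrm Z z) powr p" for m
    unfolding powr_mult by (rule order_trans[OF 1]) (intro mult_left_mono Z_partial z; simp)
  then show "R z \<in> carrier Z" "nrm Z (R z) \<le> 2 / c * nrm Z z"
    using Z_I[of "R z" "2 / c * nrm Z z"] Z_coord[OF z] c Z_norm_ge0[of z] by (auto simp: R_def split: nat.splits)
qed

lemma R_op: "R \<in> bounded_ops Z Z"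
proof (rule bounded_opsI[of _ _ _ "2/c"])
  show "R (x \<oplus>\<^bsub>Z\<^esub> y) = R x \<oplus>\<^bsub>Z\<^esub> R y" for x y
    by (auto simp: Z_simps R_def fun_eq_iff split: nat.splits)
  show "R (a \<odot>\<^bsub>Z\<^esub> x) = a \<odot>\<^bsub>Z\<^esub> R x" for a x
    by (auto simp: Z_simps R_def fun_eq_iff split: nat.splits)
qed (simp_all only: R_Z)

lemma R_Tz: "t \<ge> 0 \<Longrightarrow> R (Tz t z) = Tz t (R z)"
  using op.zero[OF T_oper, of t] by (auto simp: R_def Tz_def fun_eq_iff split: nat.splits)

lemma Tz_add: "s \<ge> 0 \<Longrightarrow> t \<ge> 0 \<Longrightarrow> z \<in> carrier Z \<Longrightarrow> Tz (s + t) z = Tz s (Tz t z)"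
  by (simp add: Tz_def T_add Z_coord)

lemma Tz_cl [simp]: "t \<ge> 0 \<Longrightarrow> z \<in> carrier Z \<Longrightarrow> Tz t z \<in> carrier Z"
  using Tz_op by (rule bounded_ops_cl)

lemma R_cl [simp]: "z \<in> carrier Z \<Longrightarrow> R z \<in> carrier Z"
  by (rule R_Z)

text \<open>Coordinate \<open>n\<close> of \<open>u\<close> reappears at place \<open>n + 1\<close>,
  where the weight is larger by \<open>2 / c\<close> and the norm by at least
  \<open>c\<close>.\<close>

lemma shift_lower_bound:
  assumes u: "u \<in> carrier Z"
  shows "2 * nrm Z u \<le> nrm Z (R (Tz t0 u))"
proof -
  let ?v = "R (Tz t0 u)"
  have v: "?v \<in> carrier Z" using u t0 by simp
  have e: "pw u n \<le> (1/2) powr p * pw ?v (Suc n)" for n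
  proof -
    have "w n * nrm X (u n) = 1/2 * ((2 / c) ^ Suc n * (c * nrm X (u n)))" using c by (simp add: w_eq)
    also have "\<dots> \<le> 1/2 * (w (Suc n) * nrm X (T t0 (u n)))"
      unfolding w_eq using c low[OF Z_coord[OF u], of n] by (intro mult_left_mono) auto
    finally have "pw u n \<le> (1/2 * (w (Suc n) * nrm X (T t0 (u n)))) powr p"
      unfolding pw_def using p w[of n] norm_ge0[OF Z_coord[OF u]] by (intro powr_mono2) (auto simp: less_imp_le)
    moreover have "(1/2 * (w (Suc n) * nrm X (T t0 (u n)))) powr p = (1/2) powr p * (w (Suc n) * nrm X (T t0 (u n))) powr p"
      by (rule powr_mult)
    ultimately show ?thesis by (simp only: pw_def Tz_def R_simps)
  qed
  have "(\<Sum>n<m. pw u n) \<le> (1/2 * nrm Z ?v) powr p" for m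
  proof -
    have "(\<Sum>n<m. pw u n) \<le> (1/2) powr p * (\<Sum>n<m. pw ?v (Suc n))"
      using e by (simp add: sum_distrib_left sum_mono)
    also have "(\<Sum>n<m. pw ?v (Suc n)) \<le> (\<Sum>n<Suc m. pw ?v n)"
      unfolding sum.lessThan_Suc_shift using pw_ge0[of ?v 0] by simp
    also have "\<dots> \<le> nrm Z ?v powr p" by (rule Z_partial[OF v]) simp
    finally show ?thesis unfolding powr_mult by simp
  qed
  from Z_I(2)[OF Z_coord[OF u] this] Z_norm_ge0[of ?v] show ?thesis by simp
qed

lemma J_cl [simp]: "u \<in> carrier Z \<Longrightarrow> J u \<in> carrier Z"
  using t0 by (simp add: J_def)

text \<open>These formulas can be solved for \<open>u\<close> coordinate by coordinate. This
  explicit inverse lets preimages under \<open>J\<close> be chosen measurably in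
  \<open>H_preserves_N\<close>.\<close>

lemma J_coord:
  assumes "u \<in> carrier Z" shows "J u 0 = u 0" "J u (Suc n) = u (Suc n) \<ominus> T t0 (u n)"
  using assms t0 by (simp_all add: J_def Z_diff diff_zero Z_coord) (simp add: Tz_def)

lemma J_op: "J \<in> bounded_ops Z Z"
proof -
  interpret O: op Z Z "\<lambda>u. R (Tz t0 u)"
    using bounded_ops_comp[OF Tz_op R_op] t0 Z_norm_ge0 by unfold_locales simp
  obtain K where K: "K > 0" "\<And>x. x \<in> carrier Z \<Longrightarrow> nrm Z (R (Tz t0 x)) \<le> K * nrm Z x" using O.bound by blast
  show ?thesis
  proof (rule bounded_opsI[of _ _ _ "1 + K"])
    fix x assume x: "x \<in> carrier Z"
    show "nrm Z (J x) \<le> (1 + K) * nrm Z x"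
      unfolding J_def using Z.norm_diff_le[OF x O.cl[OF x]] K(2)[OF x] by (simp add: algebra_simps)
    show "J (a \<odot>\<^bsub>Z\<^esub> x) = a \<odot>\<^bsub>Z\<^esub> J x" for a
      unfolding J_def using x O.cl[OF x] by (simp add: O.smult Z.smult_diff)
    show "J (x \<oplus>\<^bsub>Z\<^esub> y) = J x \<oplus>\<^bsub>Z\<^esub> J y" if y: "y \<in> carrier Z" for y
      unfolding J_def using x y O.cl[OF x] O.cl[OF y] by (simp add: O.add Z.add_minus_add)
  qed (rule J_cl)
qed

sublocale J: op Z Z J by unfold_locales (rule J_op)

text \<open>Twice the norm of \<open>u\<close> is at most the norm of \<open>R (Tz t0 u)\<close>,
  which differs from \<open>u\<close> by \<open>J u\<close>. One of the two copies of the norm of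
  \<open>u\<close> is absorbed.\<close>

lemma J_lower_bound:
  assumes u: "u \<in> carrier Z" shows "nrm Z u \<le> 1 * nrm Z (J u)"
proof -
  have "nrm Z (R (Tz t0 u)) \<le> nrm Z u + nrm Z (J u)"
    using Z.norm_le_add_diff[of "R (Tz t0 u)" u] Z.norm_minus_commute[of u "R (Tz t0 u)"] u t0 by (simp add: J_def)
  then show ?thesis using shift_lower_bound[OF u] by simp
qed

sublocale Q: banach_quotient Z N
proof unfold_locales
  show "closed_subset Z N" unfolding N_def
    by (rule closed_range[OF Z_banach _ J_lower_bound]) unfold_locales
  show "\<zero>\<^bsub>Z\<^esub> \<in> N" unfolding N_def using J.zero by (metis Z.M.zero_closed image_eqI)
  show "x \<oplus>\<^bsub>Z\<^esub> y \<in> N" if "x \<in> N" "y \<in> N" for x y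
  proof -
    obtain u v where "u \<in> carrier Z" "x = J u" "v \<in> carrier Z" "y = J v" using \<open>x \<in> N\<close> \<open>y \<in> N\<close> by (auto simp: N_def)
    then show ?thesis unfolding N_def by (intro image_eqI[of _ _ "u \<oplus>\<^bsub>Z\<^esub> v"]) (simp_all add: J.add)
  qed
  show "a \<odot>\<^bsub>Z\<^esub> x \<in> N" if "x \<in> N" for x a
  proof -
    obtain u where "u \<in> carrier Z" "x = J u" using \<open>x \<in> N\<close> by (auto simp: N_def)
    then show ?thesis unfolding N_def by (intro image_eqI[of _ _ "a \<odot>\<^bsub>Z\<^esub> u"]) (simp_all add: J.smult)
  qed
qed

text \<open>Such an \<open>F\<close> commutes with \<open>J\<close> and hence maps the range of
  \<open>J\<close> to itself.\<close>

lemma commuting_preserves_N: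
  assumes F: "F \<in> bounded_ops Z Z" and com: "\<And>u. u \<in> carrier Z \<Longrightarrow> F (R (Tz t0 u)) = R (Tz t0 (F u))" and x: "x \<in> N"
  shows "F x \<in> N"
proof -
  interpret F: op Z Z F using F by unfold_locales
  obtain u where u: "u \<in> carrier Z" "x = J u" using x by (auto simp: N_def)
  have "F x = J (F u)" unfolding u(2) using u(1) t0 by (simp add: J_def F.diff com)
  then show ?thesis using u(1) by (auto simp: N_def)
qed

text \<open>The difference of \<open>z\<close> and \<open>R (Tz t0 z)\<close> is \<open>J z\<close>.
  So on the quotient the shift inverts \<open>T t0\<close>, the relation for which \<open>N\<close>
  was chosen.\<close>

lemma cls_shift: "z \<in> carrier Z \<Longrightarrow> Q.cls (R (Tz t0 z)) = Q.cls z"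
  using Q.cls_eq_iff[of z "R (Tz t0 z)"] t0 by (auto simp: N_def J_def)

text \<open>\<open>E k s\<close> represents the group element at time \<open>s - k t\<^sub>0\<close>.\<close>

definition E :: "nat \<Rightarrow> real \<Rightarrow> (nat \<Rightarrow> 'a) \<Rightarrow> nat \<Rightarrow> 'a" where "E k s z = (R ^^ k) (Tz s z)"

lemma Rk_cl: "z \<in> carrier Z \<Longrightarrow> (R ^^ k) z \<in> carrier Z"
  by (induction k) auto

lemma E_op: "s \<ge> 0 \<Longrightarrow> E k s \<in> bounded_ops Z Z"
proof (induction k)
  case 0 then show ?case using Tz_op[of s] by (simp add: E_def[abs_def])
next
  case (Suc k)
  have "(\<lambda>z. R (E k s z)) \<in> bounded_ops Z Z"
    by (rule bounded_ops_comp[OF Suc.IH R_op]) (use Suc Z_norm_ge0 in auto)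
  then show ?case by (simp add: E_def[abs_def])
qed

lemma Rk_Tz: "t \<ge> 0 \<Longrightarrow> (R ^^ k) (Tz t z) = Tz t ((R ^^ k) z)"
  by (induction k) (auto simp: R_Tz)

lemma Tz_commute: "s \<ge> 0 \<Longrightarrow> t \<ge> 0 \<Longrightarrow> z \<in> carrier Z \<Longrightarrow> Tz s (Tz t z) = Tz t (Tz s z)"
  using Tz_add[of s t z] Tz_add[of t s z] by (simp add: add.commute)

lemma E_shift: "s \<ge> 0 \<Longrightarrow> z \<in> carrier Z \<Longrightarrow> E k s (R (Tz t0 z)) = R (Tz t0 (E k s z))"
  using t0 Rk_cl[of z k] by (simp add: E_def Rk_Tz R_Tz Tz_commute funpow_swap1)

lemma E_N: "s \<ge> 0 \<Longrightarrow> x \<in> N \<Longrightarrow> E k s x \<in> N"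
  by (rule commuting_preserves_N[OF E_op E_shift])

lemma E_cl: "s \<ge> 0 \<Longrightarrow> z \<in> carrier Z \<Longrightarrow> E k s z \<in> carrier Z"
  using E_op by (rule bounded_ops_cl)

text \<open>One more shift cancels one more period \<open>t0\<close>. Thus the class depends only on
  the total time \<open>s - k * t0\<close>.\<close>

lemma cls_E_Suc: assumes "s \<ge> 0" "z \<in> carrier Z"
  shows "Q.cls (E (Suc k) (s + t0) z) = Q.cls (E k s z)"
proof -
  have "E (Suc k) (s + t0) z = R (Tz t0 (E k s z))"
    using assms t0 by (simp add: E_def Tz_add Rk_Tz Rk_cl Tz_commute R_Tz)
  then show ?thesis using cls_shift[OF E_cl[OF assms]] by simp
qed

lemma cls_E_add: assumes "s \<ge> 0" "z \<in> carrier Z"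
  shows "Q.cls (E (k + j) (s + real j * t0) z) = Q.cls (E k s z)"
proof (induction j)
  case (Suc j)
  then show ?case using cls_E_Suc[of "s + real j * t0" z "k + j"] assms t0 by (simp add: algebra_simps)
qed simp

text \<open>The chosen \<open>k\<close> is the least number of shifts that makes
  \<open>t + k * t0\<close> nonnegative; truncation by \<open>nat\<close> gives 0 for all
  \<open>t \<ge> 0\<close>.\<close>

definition S :: "real \<Rightarrow> (nat \<Rightarrow> 'a) set \<Rightarrow> (nat \<Rightarrow> 'a) set" where
  "S t = (let k = nat \<lceil>- t / t0\<rceil> in Q.induced (E k (t + real k * t0)))"

lemma steps_nonneg: "0 \<le> t + real (nat \<lceil>- t / t0\<rceil>) * t0"
proof -
  have "- t / t0 \<le> real (nat \<lceil>- t / t0\<rceil>)" by linarith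
  then have "(- t / t0) * t0 \<le> real (nat \<lceil>- t / t0\<rceil>) * t0" using t0 by (intro mult_right_mono) auto
  then show ?thesis using t0 by simp
qed

text \<open>Any admissible number of shifts gives the same class, because surplus shifts cancel
  against periods. This freedom is used with the sum of two shift numbers in \<open>S_add\<close>,
  with 0 for positive times and with 1 on \<open>[-t0, 0]\<close>.\<close>

lemma S_cls:
  assumes s: "t + real k * t0 \<ge> 0" and z: "z \<in> carrier Z"
  shows "S t (Q.cls z) = Q.cls (E k (t + real k * t0) z)"
proof -
  define k0 where "k0 = nat \<lceil>- t / t0\<rceil>"
  have k0: "t + real k0 * t0 \<ge> 0" unfolding k0_def by (rule steps_nonneg)
  have "S t (Q.cls z) = Q.cls (E k0 (t + real k0 * t0) z)"
    unfolding S_def Let_def k0_def[symmetric] by (rule Q.induced_cls[OF E_op[OF k0] E_N[OF k0] z])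
  also have "\<dots> = Q.cls (E k (t + real k * t0) z)"
  proof (cases "k0 \<le> k")
    case True
    have "t + real k0 * t0 + real (k - k0) * t0 = t + real k * t0" using True by (simp add: algebra_simps of_nat_diff)
    then show ?thesis using cls_E_add[OF k0 z, of k0 "k - k0"] True by (simp only: le_add_diff_inverse)
  next
    case False
    have "t + real k * t0 + real (k0 - k) * t0 = t + real k0 * t0" using False by (simp add: algebra_simps of_nat_diff)
    then show ?thesis using cls_E_add[OF s z, of k "k0 - k"] False by (simp only: not_le less_imp_le le_add_diff_inverse)
  qed
  finally show ?thesis .
qed

lemma S_op: "S t \<in> bounded_ops Q.Y Q.Y"
proof -
  define k0 where "k0 = nat \<lceil>- t / t0\<rceil>"
  have k0: "t + real k0 * t0 \<ge> 0" unfolding k0_def by (rule steps_nonneg)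
  interpret O: op Z Z "E k0 (t + real k0 * t0)" using E_op[OF k0] by unfold_locales
  show ?thesis
    unfolding S_def Let_def k0_def[symmetric] by (rule Q.induced_op(1)[OF E_op[OF k0] E_N[OF k0] O.opnrm_bound])
qed

lemma S_add:
  assumes "y \<in> carrier Q.Y" shows "S (s + t) y = S s (S t y)"
proof -
  obtain z where z: "z \<in> carrier Z" "y = Q.cls z" using assms by (auto simp: Q.carrier_Y)
  define k m where "k = nat \<lceil>- s / t0\<rceil>" and "m = nat \<lceil>- t / t0\<rceil>"
  have km: "s + real k * t0 \<ge> 0" "t + real m * t0 \<ge> 0" unfolding k_def m_def by (rule steps_nonneg)+
  have "S s (S t y) = Q.cls (E k (s + real k * t0) (E m (t + real m * t0) z))"
    unfolding z(2) S_cls[OF km(2) z(1)] by (rule S_cls[OF km(1) E_cl[OF km(2) z(1)]])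
  \<comment> \<open>Shifts and the coordinatewise semigroup commute, so the numbers of shifts and
    the times add separately.\<close>
  also have "E k (s + real k * t0) (E m (t + real m * t0) z) = E (k + m) ((s + real k * t0) + (t + real m * t0)) z"
    using km z(1) by (simp add: E_def Tz_add Rk_Tz Rk_cl funpow_add)
  also have "(s + real k * t0) + (t + real m * t0) = (s + t) + real (k + m) * t0" by (simp add: algebra_simps)
  also have "Q.cls (E (k + m) ((s + t) + real (k + m) * t0) z) = S (s + t) (Q.cls z)"
    by (rule S_cls[symmetric, OF _ z(1)]) (use km in \<open>simp add: algebra_simps\<close>)
  finally show ?thesis using z(2) by simp
qed

lemma S_pos: "t \<ge> 0 \<Longrightarrow> z \<in> carrier Z \<Longrightarrow> S t (Q.cls z) = Q.cls (Tz t z)"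
  using S_cls[of t 0 z] by (simp add: E_def)

lemma S_0: "y \<in> carrier Q.Y \<Longrightarrow> S 0 y = y"
proof -
  assume "y \<in> carrier Q.Y"
  then obtain z where z: "z \<in> carrier Z" "y = Q.cls z" by (auto simp: Q.carrier_Y)
  have "Tz 0 z = z" using z(1) by (simp add: Tz_def Z_coord)
  then show ?thesis using z S_pos[of 0 z] by simp
qed

text \<open>Strong continuity holds for sequences with one nonzero coordinate, passes to sums and
  hence to truncations. Density of truncations and the bound on \<open>[0, 1]\<close> extend it to
  all of Z.\<close>

lemma Tz_lim:
  assumes z: "z \<in> carrier Z"
  shows "((\<lambda>t. nrm Z (Tz t z \<ominus>\<^bsub>Z\<^esub> z)) \<longlongrightarrow> 0) (at_right 0)"
proof -
  define good where "good z \<longleftrightarrow> ((\<lambda>t. nrm Z (Tz t z \<ominus>\<^bsub>Z\<^esub> z)) \<longlongrightarrow> 0) (at_right 0)" for z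
  have pos: "\<forall>\<^sub>F t in at_right (0::real). t > 0" by (simp add: eventually_at_right_less)
  have add: "good (x \<oplus>\<^bsub>Z\<^esub> y)" if "good x" "good y" "x \<in> carrier Z" "y \<in> carrier Z" for x y
    unfolding good_def
  proof (rule Lim_null_comparison)
    show "((\<lambda>t. nrm Z (Tz t x \<ominus>\<^bsub>Z\<^esub> x) + nrm Z (Tz t y \<ominus>\<^bsub>Z\<^esub> y)) \<longlongrightarrow> 0) (at_right 0)"
      using tendsto_add[OF that(1,2)[unfolded good_def]] by simp
    show "\<forall>\<^sub>F t in at_right 0. norm (nrm Z (Tz t (x \<oplus>\<^bsub>Z\<^esub> y) \<ominus>\<^bsub>Z\<^esub> (x \<oplus>\<^bsub>Z\<^esub> y)))
       \<le> nrm Z (Tz t x \<ominus>\<^bsub>Z\<^esub> x) + nrm Z (Tz t y \<ominus>\<^bsub>Z\<^esub> y)"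
      using pos
    proof eventually_elim
      case (elim t)
      have "Tz t (x \<oplus>\<^bsub>Z\<^esub> y) = Tz t x \<oplus>\<^bsub>Z\<^esub> Tz t y"
        using elim that by (intro bounded_ops_add[OF Tz_op]) auto
      then show ?case using elim that Z.norm_triangle Z_norm_ge0 by (simp add: Z.add_minus_add)
    qed
  qed
  have single: "good (single n x)" if x: "x \<in> carrier X" for n x unfolding good_def
  proof (rule Lim_transform_eventually)
    show "((\<lambda>t. w n * nrm X (T t x \<ominus> x)) \<longlongrightarrow> 0) (at_right 0)"
      using tendsto_mult_right_zero[OF T_lim[OF x]] by simp
    show "\<forall>\<^sub>F t in at_right 0. w n * nrm X (T t x \<ominus> x) = nrm Z (Tz t (single n x) \<ominus>\<^bsub>Z\<^esub> single n x)"
      using pos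
    proof eventually_elim
      case (elim t)
      have "Tz t (single n x) \<ominus>\<^bsub>Z\<^esub> single n x = single n (T t x \<ominus> x)"
        using elim x op.zero[OF T_oper, of t] Z_diff[OF Tz_cl[OF _ single_Z(1)[OF x]] single_Z(1)[OF x], of t n n]
        by (auto simp: single_Z Tz_def single_def fun_eq_iff diff_self)
      then show ?case using elim x by (simp add: single_Z)
    qed
  qed
  have zero: "good \<zero>\<^bsub>Z\<^esub>" unfolding good_def
  proof (rule Lim_transform_eventually[OF tendsto_const])
    show "\<forall>\<^sub>F t in at_right 0. 0 = nrm Z (Tz t \<zero>\<^bsub>Z\<^esub> \<ominus>\<^bsub>Z\<^esub> \<zero>\<^bsub>Z\<^esub>)" using pos
    proof eventually_elim
      case (elim t)
      have "Tz t \<zero>\<^bsub>Z\<^esub> = \<zero>\<^bsub>Z\<^esub>" using elim op.zero[OF T_oper, of t] by (simp add: Tz_def Z_simps)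
      then show ?case by (simp add: Z.diff_self)
    qed
  qed
  have trunc: "good (trunc m z)" for m
  proof (induction m)
    case 0 then show ?case using zero by (simp add: trunc_0)
  next
    case (Suc m) then show ?case using add single Z_coord[OF z] by (simp add: trunc_Suc z trunc_Z single_Z)
  qed
  obtain M where M: "M \<ge> 1" "\<And>t x. t \<in> {0..1} \<Longrightarrow> x \<in> carrier X \<Longrightarrow> nrm X (T t x) \<le> M * nrm X x"
    using semigroup_locally_bounded[OF T, of 1] by blast
  show ?thesis
  proof (rule tendstoI)
    fix e :: real assume e: "e > 0"
    \<comment> \<open>The truncation error enters once directly and once multiplied by
      \<open>M\<close>; together these stay below \<open>e / 2\<close>.\<close>
    have "e / (2 * (M + 1)) > 0" using e M by simp
    then obtain m where m: "nrm Z (trunc m z \<ominus>\<^bsub>Z\<^esub> z) < e / (2 * (M + 1))"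
      using LIMSEQ_0_lessD[OF trunc_tends[OF z, unfolded tends_def], of "e / (2 * (M + 1))"] by auto
    have "\<forall>\<^sub>F t in at_right 0. nrm Z (Tz t (trunc m z) \<ominus>\<^bsub>Z\<^esub> trunc m z) < e / 2"
      using order_tendstoD(2)[OF trunc[of m, unfolded good_def], of "e/2"] e by simp
    moreover have "\<forall>\<^sub>F t in at_right (0::real). t < 1" by (rule eventually_at_rightI[of 0 1]) auto
    ultimately show "\<forall>\<^sub>F t in at_right 0. dist (nrm Z (Tz t z \<ominus>\<^bsub>Z\<^esub> z)) 0 < e" using pos
    proof eventually_elim
      case (elim t)
      let ?v = "trunc m z"
      have v: "?v \<in> carrier Z" using z by (rule trunc_Z)
      have "nrm Z (Tz t (z \<ominus>\<^bsub>Z\<^esub> ?v)) \<le> M * nrm Z (z \<ominus>\<^bsub>Z\<^esub> ?v)"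
        using elim M z v by (intro Tz_bound(2)) auto
      moreover have "Tz t (z \<ominus>\<^bsub>Z\<^esub> ?v) = Tz t z \<ominus>\<^bsub>Z\<^esub> Tz t ?v"
      proof -
        interpret O: op Z Z "Tz t" using Tz_op elim by unfold_locales simp
        show ?thesis using z v by (rule O.diff)
      qed
      ultimately have 1: "nrm Z (Tz t z \<ominus>\<^bsub>Z\<^esub> Tz t ?v) \<le> M * nrm Z (?v \<ominus>\<^bsub>Z\<^esub> z)"
        using Z.norm_minus_commute[OF z v] by simp
      have "nrm Z (Tz t z \<ominus>\<^bsub>Z\<^esub> z) \<le> nrm Z (Tz t z \<ominus>\<^bsub>Z\<^esub> Tz t ?v) + (nrm Z (Tz t ?v \<ominus>\<^bsub>Z\<^esub> ?v) + nrm Z (?v \<ominus>\<^bsub>Z\<^esub> z))"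
        using Z.norm_diff_triangle[of "Tz t z" "Tz t ?v" z] Z.norm_diff_triangle[of "Tz t ?v" ?v z] z v elim by simp
      also have "\<dots> < (M + 1) * (e / (2 * (M + 1))) + e / 2"
        using 1 elim(1) mult_strict_left_mono[OF m, of "M + 1"] M(1) by (simp add: distrib_right)
      also have "\<dots> = e" using M(1) by (simp add: divide_simps) (simp add: algebra_simps)
      finally show ?case using Z_norm_ge0 by simp
    qed
  qed
qed

lemma S_lim_right:
  assumes y: "y \<in> carrier Q.Y"
  shows "((\<lambda>t. nrm Q.Y (S t y \<ominus>\<^bsub>Q.Y\<^esub> y)) \<longlongrightarrow> 0) (at_right 0)"
proof -
  obtain z where z: "z \<in> carrier Z" "y = Q.cls z" using y by (auto simp: Q.carrier_Y)
  have pos: "\<forall>\<^sub>F t in at_right (0::real). t > 0" by (simp add: eventually_at_right_less)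
  show ?thesis
  proof (rule Lim_null_comparison[OF _ Tz_lim[OF z(1)]])
    show "\<forall>\<^sub>F t in at_right 0. norm (nrm Q.Y (S t y \<ominus>\<^bsub>Q.Y\<^esub> y)) \<le> nrm Z (Tz t z \<ominus>\<^bsub>Z\<^esub> z)"
      using pos
    proof eventually_elim
      case (elim t)
      have "S t y \<ominus>\<^bsub>Q.Y\<^esub> y = Q.cls (Tz t z \<ominus>\<^bsub>Z\<^esub> z)" using elim z by (simp add: S_pos Q.cls.diff)
      then show ?case using Q.Y_norm_le[of "Tz t z \<ominus>\<^bsub>Z\<^esub> z"] Q.Y_norm_ge0'[of "Tz t z \<ominus>\<^bsub>Z\<^esub> z"] elim z by simp
    qed
  qed
qed

text \<open>For \<open>t\<close> in \<open>[0, t0]\<close> one shift suffices: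
  \<open>S (- t)\<close> is induced by \<open>R\<close> after \<open>T (t0 - t)\<close>, whose norm
  is at most \<open>2 / c * M\<close>.\<close>

lemma S_negative_bounded: "\<exists>K. \<forall>t\<in>{0..t0}. \<forall>y\<in>carrier Q.Y. nrm Q.Y (S (- t) y) \<le> K * nrm Q.Y y"
proof -
  obtain M where M: "M \<ge> 1" "\<And>t x. t \<in> {0..t0} \<Longrightarrow> x \<in> carrier X \<Longrightarrow> nrm X (T t x) \<le> M * nrm X x"
    using semigroup_locally_bounded[OF T, of t0] by blast
  have "nrm Q.Y (S (- t) y) \<le> 2 / c * M * nrm Q.Y y" if t: "t \<in> {0..t0}" and y: "y \<in> carrier Q.Y" for t y
  proof -
    have s: "t0 - t \<ge> 0" "t0 - t \<in> {0..t0}" using t by auto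
    have E: "nrm Z (E 1 (t0 - t) z) \<le> 2 / c * M * nrm Z z" if z: "z \<in> carrier Z" for z
    proof -
      have "nrm Z (E 1 (t0 - t) z) \<le> 2 / c * nrm Z (Tz (t0 - t) z)" using R_Z(2)[OF Tz_cl[OF s(1) z]] by (simp add: E_def)
      also have "\<dots> \<le> 2 / c * (M * nrm Z z)"
        using Tz_bound(2)[OF s(1) _ M(2)[OF s(2)] z] M(1) c by (intro mult_left_mono) auto
      finally show ?thesis by (simp add: mult_ac)
    qed
    obtain z where z: "z \<in> carrier Z" "y = Q.cls z" using y by (auto simp: Q.carrier_Y)
    have "S (- t) y = Q.induced (E 1 (t0 - t)) y"
      using S_cls[of "-t" 1 z] Q.induced_cls[OF E_op[OF s(1)] E_N[OF s(1)] z(1), of 1] z s(1) by simp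
    then show ?thesis using Q.induced_op(2)[OF E_op[OF s(1)] E_N[OF s(1)] E y] by simp
  qed
  then show ?thesis by blast
qed

lemma S_group: "C0_group Q.Y S"
proof -
  have "((\<lambda>t. nrm Q.Y (S t y \<ominus>\<^bsub>Q.Y\<^esub> y)) \<longlongrightarrow> 0) (at 0)" if y: "y \<in> carrier Q.Y" for y
  proof -
    obtain K where K: "\<And>t y. t \<in> {0..t0} \<Longrightarrow> y \<in> carrier Q.Y \<Longrightarrow> nrm Q.Y (S (- t) y) \<le> K * nrm Q.Y y"
      using S_negative_bounded by blast
    have "((\<lambda>t. nrm Q.Y (S (- t) y \<ominus>\<^bsub>Q.Y\<^esub> y)) \<longlongrightarrow> 0) (at_right 0)"
    proof (rule Lim_null_comparison)
      show "((\<lambda>t. K * nrm Q.Y (S t y \<ominus>\<^bsub>Q.Y\<^esub> y)) \<longlongrightarrow> 0) (at_right 0)"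
        using tendsto_mult_right_zero[OF S_lim_right[OF y]] by simp
      have "\<forall>\<^sub>F t in at_right (0::real). t \<in> {0<..<t0}" by (rule eventually_at_rightI[of 0 t0]) (use t0 in auto)
      then show "\<forall>\<^sub>F t in at_right 0. norm (nrm Q.Y (S (- t) y \<ominus>\<^bsub>Q.Y\<^esub> y)) \<le> K * nrm Q.Y (S t y \<ominus>\<^bsub>Q.Y\<^esub> y)"
      proof eventually_elim
        case (elim t)
        interpret O: op Q.Y Q.Y "S s" for s using S_op by unfold_locales
        \<comment> \<open>Left continuity is reduced to right continuity by writing
          \<open>S (- t) y \<ominus> y\<close> as \<open>S (- t)\<close> applied to
          \<open>y \<ominus> S t y\<close>, with \<open>S (- t)\<close> uniformly bounded.\<close>
        have "S (- t) (S t y) = y" using S_add[OF y, of "-t" t] S_0[OF y] by simp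
        then have "S (- t) (y \<ominus>\<^bsub>Q.Y\<^esub> S t y) = S (- t) y \<ominus>\<^bsub>Q.Y\<^esub> y" using y by (simp add: O.diff)
        then have "nrm Q.Y (S (- t) y \<ominus>\<^bsub>Q.Y\<^esub> y) \<le> K * nrm Q.Y (y \<ominus>\<^bsub>Q.Y\<^esub> S t y)"
          using K[of t "y \<ominus>\<^bsub>Q.Y\<^esub> S t y"] elim y by simp
        then show ?case using Q.Y.norm_minus_commute[of y "S t y"] Q.Y.norm_ge0[of "S (- t) y \<ominus>\<^bsub>Q.Y\<^esub> y"] y by simp
      qed
    qed
    then have "((\<lambda>t. nrm Q.Y (S t y \<ominus>\<^bsub>Q.Y\<^esub> y)) \<longlongrightarrow> 0) (at_left 0)"
      by (simp add: filterlim_at_left_to_right)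
    then show ?thesis using S_lim_right[OF y] by (simp add: filterlim_at_split)
  qed
  then show ?thesis unfolding C0_group_def by (intro conjI allI ballI S_op S_0 S_add)
qed

section \<open>The embedding of X\<close>

definition emb :: "'a \<Rightarrow> (nat \<Rightarrow> 'a) set" where "emb x = Q.cls (single 0 x)"

lemma S_emb: "t \<ge> 0 \<Longrightarrow> x \<in> carrier X \<Longrightarrow> S t (emb x) = emb (T t x)"
proof -
  assume t: "t \<ge> 0" and x: "x \<in> carrier X"
  have "Tz t (single 0 x) = single 0 (T t x)" using op.zero[OF T_oper[OF t]] by (auto simp: Tz_def single_def)
  then show ?thesis using t x by (simp add: emb_def S_pos single_Z)
qed

text \<open>A representative of the class of \<open>x\<close> is
  \<open>v = single 0 x + J u\<close>. Away from coordinate 0 this equation bounds \<open>u\<close>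
  by \<open>v\<close>; coordinate 0 then reads \<open>x = v 0 - u 0\<close> and costs the factor
  2.\<close>

lemma emb_lower_bound:
  assumes x: "x \<in> carrier X" shows "nrm X x \<le> 2 * nrm Q.Y (emb x)"
proof -
  have "nrm X x / 2 \<le> nrm Q.Y (emb x)" unfolding emb_def
  proof (rule Q.Y_norm_greatest[OF single_Z(1)[OF x]])
    fix v assume v: "v \<in> carrier Z" "Q.cls v = Q.cls (single 0 x)"
    then have "v \<ominus>\<^bsub>Z\<^esub> single 0 x \<in> N" using Q.cls_eq_iff single_Z x by simp
    then obtain u where u: "u \<in> carrier Z" "v \<ominus>\<^bsub>Z\<^esub> single 0 x = J u" by (auto simp: N_def)
    have co: "v n \<ominus> single 0 x n = J u n" for n using fun_cong[OF u(2), of n] v(1) x by (simp add: Z_diff single_Z)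
    have vc: "v n \<in> carrier X" "u n \<in> carrier X" for n using v(1) u(1) by (auto simp: Z_coord)
    \<comment> \<open>Deleting coordinate 0 removes \<open>x\<close> from the equation and leaves
      \<open>R (Tz t0 u)\<close> unchanged, since that sequence vanishes at 0. Hence twice the norm
      of \<open>u\<close> is at most the norm of \<open>u\<close> plus that of
      \<open>v\<close>.\<close>
    define v' u' where "v' = (\<lambda>n. if n = 0 then \<zero> else v n)" and "u' = (\<lambda>n. if n = 0 then \<zero> else u n)"
    have v': "v' \<in> carrier Z" "nrm Z v' \<le> 1 * nrm Z v"
      using Z_dominated[OF v(1), of v' 1] vc norm_ge0 by (auto simp: v'_def)
    have u': "u' \<in> carrier Z" "nrm Z u' \<le> 1 * nrm Z u"
      using Z_dominated[OF u(1), of u' 1] vc norm_ge0 by (auto simp: u'_def)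
    have RT: "R (Tz t0 u) \<in> carrier Z" using u(1) t0 by simp
    have "v' = u' \<ominus>\<^bsub>Z\<^esub> R (Tz t0 u)"
    proof
      fix n show "v' n = (u' \<ominus>\<^bsub>Z\<^esub> R (Tz t0 u)) n"
        using co[of n] vc[of n] u' RT x u(1)
        by (cases n) (auto simp: Z_diff v'_def u'_def single_def diff_self diff_zero J_coord Tz_def)
    qed
    then have "nrm Z (R (Tz t0 u)) \<le> nrm Z u' + nrm Z v'"
      using Z.norm_le_add_diff[OF RT u'(1)] Z.norm_minus_commute[OF RT u'(1)] by simp
    then have uv: "nrm Z u \<le> nrm Z v" using shift_lower_bound[OF u(1)] v' u' by simp
    have "v 0 \<ominus> x = u 0" using co[of 0] u(1) by (simp add: single_def J_coord)
    then have "nrm X x \<le> nrm X (v 0) + nrm X (u 0)"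
      using norm_le_add_diff[OF x vc(1), of 0] norm_minus_commute[OF x vc(1), of 0] by simp
    also have "\<dots> \<le> nrm Z v + nrm Z u"
      using Z_coord_le[OF v(1), of 0] Z_coord_le[OF u(1), of 0] by (simp add: w_eq)
    finally show "nrm X x / 2 \<le> nrm Z v" using uv by simp
  qed
  then show ?thesis by simp
qed

lemma emb_op: "emb \<in> bounded_ops X Q.Y"
  unfolding emb_def[abs_def] by (rule bounded_ops_comp[OF single_op Q.cls_op Z_norm_ge0])

lemma emb_closed: "closed_embedding X Q.Y emb"
proof -
  have o: "op X Q.Y emb" using emb_op by unfold_locales
  show ?thesis unfolding closed_embedding_def
    using emb_op closed_range[OF banach_space_axioms o emb_lower_bound] emb_lower_bound by blast
qed

end

section \<open>Reflexivity\<close>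

text \<open>The adjoint \<open>q\<close> of the quotient map embeds the dual of Y into the dual of
  Z. A functional \<Phi> on the former is extended by Hahn--Banach to the latter, where it is
  evaluation at some \<open>z\<close>; then \<Phi> is evaluation at the class of
  \<open>z\<close>.\<close>

lemma (in banach_quotient) reflexive_quotient:
  assumes "reflexive Z" shows "reflexive Y"
proof (rule Y.reflexiveI)
  fix \<Phi> assume \<Phi>: "\<Phi> \<in> bounded_ops (dual_space Y) scalar_space"
  interpret DZ: normed_mod "dual_space Z" by (rule dual_normed)
  interpret DY: normed_mod "dual_space Y" by (rule Y.dual_normed)
  interpret \<Phi>: op "dual_space Y" scalar_space \<Phi>
    using \<Phi> by (intro op.intro op_axioms.intro DY.normed_mod_axioms scalar_space_normed)
  obtain K where K: "K > 0" "\<And>f. f \<in> carrier (dual_space Y) \<Longrightarrow> norm (\<Phi> f) \<le> K * nrm (dual_space Y) f"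
    using \<Phi>.bound by auto
  define q where "q = (\<lambda>f :: 'a set \<Rightarrow> 'k. \<lambda>z\<in>carrier Z. f (cls z))"
  have q: "q \<in> bounded_ops (dual_space Y) (dual_space Z)"
    unfolding q_def by (rule dual_pullback[OF normed_mod_axioms Y.normed_mod_axioms cls_op])
  interpret q: op "dual_space Y" "dual_space Z" q
    using q by (intro op.intro op_axioms.intro DZ.normed_mod_axioms DY.normed_mod_axioms)
  \<comment> \<open>The factor 2 is that of \<open>Y_section\<close>: a vector of norm at most 1 in
    Y has a representative of norm at most 2.\<close>
  have q_norm: "nrm (dual_space Y) f \<le> 2 * nrm (dual_space Z) (q f)" if f: "f \<in> carrier (dual_space Y)" for f
  proof (rule Y.dual_least[OF f])
    fix y assume y: "y \<in> carrier Y" "nrm Y y \<le> 1"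
    obtain z where z: "z \<in> carrier Z" "cls z = y" "nrm Z z \<le> 2 * nrm Y y" using Y_section[OF y(1)] by blast
    have "norm (f y) \<le> nrm (dual_space Z) (q f) * nrm Z z"
      using dual_bound[OF q.cl[OF f] z(1)] z by (simp add: q_def)
    also have "\<dots> \<le> nrm (dual_space Z) (q f) * 2"
      using z(3) y(2) dual_norm_ge0[OF q.cl[OF f]] by (intro mult_left_mono) auto
    finally show "norm (f y) \<le> 2 * nrm (dual_space Z) (q f)" by simp
  qed
  have inj: "inj_on q (carrier (dual_space Y))"
  proof (rule inj_onI)
    fix f g assume fg: "f \<in> carrier (dual_space Y)" "g \<in> carrier (dual_space Y)" "q f = q g"
    show "f = g"
    proof (rule Y.dual_eqI[OF fg(1,2)])
      fix y assume "y \<in> carrier Y"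
      then obtain z where "z \<in> carrier Z" "y = cls z" by (auto simp: carrier_Y)
      then show "f y = g y" using fun_cong[OF fg(3), of z] by (simp add: q_def)
    qed
  qed
  define r where "r = inv_into (carrier (dual_space Y)) q"
  have r: "r (q f) = f" if "f \<in> carrier (dual_space Y)" for f using inj that by (simp add: r_def)
  have "\<exists>F. F \<in> bounded_ops (dual_space Z) scalar_space \<and> (\<forall>h\<in>q ` carrier (dual_space Y). F h = \<Phi> (r h)) \<and>
     (\<forall>h\<in>carrier (dual_space Z). norm (F h) \<le> 2 * K * nrm (dual_space Z) h)"
  proof (rule DZ.hahn_banach)
    show "q ` carrier (dual_space Y) \<subseteq> carrier (dual_space Z)" by auto
    show "\<zero>\<^bsub>dual_space Z\<^esub> \<in> q ` carrier (dual_space Y)" using q.zero by (metis DY.M.zero_closed image_eqI)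
    show "2 * K \<ge> 0" using K by simp
    fix h assume "h \<in> q ` carrier (dual_space Y)"
    then obtain f where f: "f \<in> carrier (dual_space Y)" "h = q f" by blast
    show "a \<odot>\<^bsub>dual_space Z\<^esub> h \<in> q ` carrier (dual_space Y)" for a
      using f by (simp add: q.smult[symmetric])
    show "\<Phi> (r (a \<odot>\<^bsub>dual_space Z\<^esub> h)) = a * \<Phi> (r h)" for a
      using f \<Phi>.smult[OF f(1), of a] by (simp add: q.smult[symmetric] r)
    show "norm (\<Phi> (r h)) \<le> 2 * K * nrm (dual_space Z) h"
      using f K(2)[OF f(1)] mult_left_mono[OF q_norm[OF f(1)] less_imp_le[OF K(1)]] by (simp add: r)
    fix h' assume "h' \<in> q ` carrier (dual_space Y)"
    then obtain f' where f': "f' \<in> carrier (dual_space Y)" "h' = q f'" by blast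
    show "h \<oplus>\<^bsub>dual_space Z\<^esub> h' \<in> q ` carrier (dual_space Y)"
      using f f' by (simp add: q.add[symmetric])
    show "\<Phi> (r (h \<oplus>\<^bsub>dual_space Z\<^esub> h')) = \<Phi> (r h) + \<Phi> (r h')"
      using f f' \<Phi>.add[OF f(1) f'(1)] by (simp add: q.add[symmetric] r)
  qed
  then obtain F where F: "F \<in> bounded_ops (dual_space Z) scalar_space"
    "\<And>h. h \<in> q ` carrier (dual_space Y) \<Longrightarrow> F h = \<Phi> (r h)" by auto
  obtain z where z: "z \<in> carrier Z" "\<And>h. h \<in> carrier (dual_space Z) \<Longrightarrow> F h = h z"
    using reflexiveD[OF assms F(1)] by auto
  have "\<Phi> f = f (cls z)" if f: "f \<in> carrier (dual_space Y)" for f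
    using F(2)[of "q f"] z(2)[OF q.cl[OF f]] f z(1) by (simp add: r) (simp add: q_def)
  then show "\<exists>y\<in>carrier Y. \<forall>f\<in>carrier (dual_space Y). \<Phi> f = f y"
    using z(1) by (intro bexI[of _ "cls z"]) auto
qed

text \<open>Young's inequality with a free parameter. If \<open>t \<le> e * b\<close>, the first
  summand dominates the left-hand side; otherwise \<open>b \<le> t / e\<close> and the second
  does.\<close>

lemma powr_young_eps:
  fixes p b t e :: real
  assumes "p > 1" "b \<ge> 0" "t \<ge> 0" "e > 0"
  shows "b powr (p - 1) * t \<le> e * b powr p + e powr (1 - p) * t powr p"
proof (cases "t \<le> e * b")
  case True
  have "b powr (p - 1) * b = b powr p" using assms by (cases "b = 0") (auto simp: powr_mult_base mult.commute)
  then have "b powr (p - 1) * (e * b) = e * b powr p" by (metis mult.left_commute)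
  moreover have "b powr (p - 1) * t \<le> b powr (p - 1) * (e * b)" using True by (intro mult_left_mono) auto
  moreover have "0 \<le> e powr (1 - p) * t powr p" by simp
  ultimately show ?thesis by linarith
next
  case False
  then have "b \<le> t / e" using assms by (simp add: le_divide_eq mult.commute)
  then have "b powr (p - 1) * t \<le> (t / e) powr (p - 1) * t"
    using assms by (intro mult_right_mono powr_mono2) auto
  also have "\<dots> = e powr (1 - p) * (t powr (p - 1) * t)"
    using assms powr_minus[of e "p - 1"] by (simp add: powr_divide field_simps)
  also have "t powr (p - 1) * t = t powr p" using assms by (cases "t = 0") (auto simp: powr_mult_base mult.commute)
  finally show ?thesis using assms by (simp add: add_increasing)
qed

section \<open>Reflexivity of weighted sequence spaces\<close>

context weighted_ellp begin

text \<open>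
  Otherwise there are \<open>j\<close> disjointly supported unit vectors on which \<open>F\<close> is at least \<open>e\<close>; their sum has norm at most
  \<open>j powr (1/p)\<close> but \<open>F\<close>-value at least \<open>j * e\<close>. This is where \<open>p > 1\<close> enters.
\<close>

lemma dual_tail:
  assumes F: "F \<in> carrier (dual_space Z)" and e: "e > 0"
  shows "\<exists>m\<ge>m0. \<forall>z\<in>carrier Z. nrm Z z \<le> 1 \<longrightarrow> norm (F (z \<ominus>\<^bsub>Z\<^esub> trunc m z)) \<le> e"
proof (rule ccontr)
  assume neg: "\<not> ?thesis"
  interpret F: op Z scalar_space F by (rule Z.dual_op[OF F])
  have block: "\<exists>m'\<ge>m. \<exists>v\<in>carrier Z. trunc m' v = v \<and> (\<forall>n<m. v n = \<zero>) \<and> suminf (pw v) \<le> 1 \<and> (\<exists>r\<ge>e. F v = of_real r)"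
    if m: "m \<ge> m0" for m
  proof -
    obtain z where z: "z \<in> carrier Z" "nrm Z z \<le> 1" "norm (F (z \<ominus>\<^bsub>Z\<^esub> trunc m z)) > e"
    proof -
      have "\<not> (\<forall>z\<in>carrier Z. nrm Z z \<le> 1 \<longrightarrow> norm (F (z \<ominus>\<^bsub>Z\<^esub> trunc m z)) \<le> e)" using neg m by blast
      then show ?thesis using that by (meson not_le)
    qed
    define v where "v = z \<ominus>\<^bsub>Z\<^esub> trunc m z"
    have v_eq: "v = (\<lambda>n. if n < m then \<zero> else z n)"
      unfolding v_def Z_diff[OF z(1) trunc_Z(1)[OF z(1)]] using Z_coord[OF z(1)]
      by (auto simp: trunc_def diff_self diff_zero)
    have v: "v \<in> carrier Z" "norm (F v) > e" using z trunc_Z(1)[OF z(1)] by (simp_all add: v_def)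
    have vz: "nrm Z v \<le> 1 * nrm Z z"
      using Z_coord[OF z(1)] norm_ge0[OF Z_coord[OF z(1)]] by (intro Z_dominated(2)[OF z(1)]) (auto simp: v_eq)
    \<comment> \<open>By continuity of \<open>F\<close> the block can be cut off at a finite place
      \<open>k\<close> without losing the strict inequality, so that the next block starts behind
      it.\<close>
    have "tends scalar_space (\<lambda>k. F (trunc k v)) (F v)"
      by (rule F.tends[OF trunc_tends[OF v(1)]]) (use v(1) trunc_Z in auto)
    from SS.tends_norm[OF this] have "(\<lambda>k. norm (F (trunc k v))) \<longlonglongrightarrow> norm (F v)" by simp
    then have "\<forall>\<^sub>F k in sequentially. norm (F (trunc k v)) > e" by (rule order_tendstoD(1)[OF _ v(2)])
    then have "\<forall>\<^sub>F k in sequentially. norm (F (trunc k v)) > e \<and> k \<ge> m"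
      by (rule eventually_conj[OF _ eventually_ge_at_top])
    then obtain k where k: "norm (F (trunc k v)) > e" "k \<ge> m" by (auto simp: eventually_sequentially)
    define u where "u = trunc k v"
    have u: "u \<in> carrier Z" "norm (F u) > e" using k trunc_Z(1)[OF v(1)] by (simp_all add: u_def)
    \<comment> \<open>Rotating each block to a positive real value of \<open>F\<close> prevents
      cancellation when the blocks are added.\<close>
    define a where "a = of_real (norm (F u)) / F u"
    have Fu: "F u \<noteq> 0" using u(2) e by auto
    have a: "norm a = 1" "a * F u = of_real (norm (F u))" using Fu by (simp_all add: a_def norm_divide)
    define y where "y = a \<odot>\<^bsub>Z\<^esub> u"
    have y: "y \<in> carrier Z" using u by (simp add: y_def)
    have "nrm Z y \<le> 1" using trunc_Z(2)[OF v(1), of k] vz z(2) a(1) u(1) by (simp add: y_def Z.norm_smult u_def)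
    then have "nrm Z y powr p \<le> 1 powr p" using p Z_norm_ge0 by (intro powr_mono2) auto
    then have "suminf (pw y) \<le> 1" using Z_norm_powr[OF y] by simp
    moreover have "trunc k y = y" by (auto simp: y_def u_def Z_simps trunc_def)
    moreover have "\<forall>n<m. y n = \<zero>" by (auto simp: y_def u_def Z_simps trunc_def v_eq)
    moreover have "F y = of_real (norm (F u))" using F.smult[OF u(1), of a] a(2) by (simp add: y_def)
    ultimately show ?thesis using k(2) y u(2) less_imp_le by blast
  qed
  have "\<exists>m\<ge>m0. \<exists>z\<in>carrier Z. trunc m z = z \<and> suminf (pw z) \<le> real j \<and> (\<exists>r\<ge>real j * e. F z = of_real r)" for j
  proof (induction j)
    case 0
    show ?case
      by (intro exI[of _ m0] conjI bexI[of _ "\<zero>\<^bsub>Z\<^esub>"])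
        (auto simp: Z_simps trunc_def pw_def[abs_def] F.zero[unfolded Z_simps] intro!: exI[of _ 0] Z_zero_cl)
  next
    case (Suc j)
    then obtain m z r where z: "m \<ge> m0" "z \<in> carrier Z" "trunc m z = z" "suminf (pw z) \<le> real j" "r \<ge> real j * e" "F z = of_real r"
      by blast
    obtain m' v s where v: "m' \<ge> m" "v \<in> carrier Z" "trunc m' v = v" "\<And>n. n < m \<Longrightarrow> v n = \<zero>" "suminf (pw v) \<le> 1" "s \<ge> e" "F v = of_real s"
      using block[OF z(1)] by auto
    have z0: "z n = \<zero>" if "n \<ge> m" for n using fun_cong[OF z(3), of n] that by (simp add: trunc_def)
    have v0: "v n = \<zero>" if "n \<ge> m'" for n using fun_cong[OF v(3), of n] that by (simp add: trunc_def)
    have "pw (z \<oplus>\<^bsub>Z\<^esub> v) n = pw z n + pw v n" for n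
      using z0[of n] v(4)[of n] Z_coord[OF z(2), of n] Z_coord[OF v(2), of n]
      by (cases "n < m") (simp_all add: pw_def Z_simps)
    then have "pw (z \<oplus>\<^bsub>Z\<^esub> v) = (\<lambda>n. pw z n + pw v n)" by (rule ext)
    then have "suminf (pw (z \<oplus>\<^bsub>Z\<^esub> v)) = suminf (pw z) + suminf (pw v)"
      using suminf_add[OF Z_summable[OF z(2)] Z_summable[OF v(2)]] by simp
    then have 1: "suminf (pw (z \<oplus>\<^bsub>Z\<^esub> v)) \<le> real (Suc j)" using z(4) v(5) by simp
    have 2: "trunc m' (z \<oplus>\<^bsub>Z\<^esub> v) = z \<oplus>\<^bsub>Z\<^esub> v" using z0 v0 v(1) by (auto simp: trunc_def Z_simps fun_eq_iff)
    have 3: "F (z \<oplus>\<^bsub>Z\<^esub> v) = of_real (r + s)" using F.add[OF z(2) v(2)] z(6) v(7) by simp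
    have 4: "r + s \<ge> real (Suc j) * e" using z(5) v(6) by (simp add: algebra_simps)
    show ?case
      using z(1) v(1) z(2) v(2) 1 2 3 4 by (intro exI[of _ m'] conjI bexI[of _ "z \<oplus>\<^bsub>Z\<^esub> v"] exI[of _ "r + s"]) auto
  qed
  note J = this
  define C where "C = nrm (dual_space Z) F + 1"
  have C: "C > 0" using Z.dual_norm_ge0[OF F] by (simp add: C_def)
  \<comment> \<open>The two bounds give \<open>j * e \<le> C * j powr (1 / p)\<close>, that is
    \<open>j powr s \<le> C / e\<close>, which fails for large \<open>j\<close> because
    \<open>s > 0\<close>.\<close>
  define s where "s = 1 - 1 / p"
  have s: "s > 0" using p by (simp add: s_def)
  obtain j where j: "real j > (C / e) powr (1 / s)" using reals_Archimedean2 by blast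
  have "((C / e) powr (1 / s)) powr s < real j powr s" using j s by (intro powr_less_mono2) auto
  then have js: "C / e < real j powr s" using s C e by (simp add: powr_powr)
  have j0: "real j > 0" using j by (rule le_less_trans[rotated]) simp
  obtain m z r where z: "z \<in> carrier Z" "suminf (pw z) \<le> real j" "r \<ge> real j * e" "F z = of_real r" using J[of j] by blast
  have "real j * e \<le> norm (F z)" using z(3,4) by simp
  also have "\<dots> \<le> nrm (dual_space Z) F * nrm Z z" by (rule Z.dual_bound[OF F z(1)])
  also have "\<dots> \<le> C * nrm Z z" using Z_norm_ge0 by (intro mult_right_mono) (auto simp: C_def)
  also have "nrm Z z \<le> real j powr (1 / p)"
    unfolding Z_simps using z(2) suminf_pw_ge0[OF z(1)] p by (intro powr_mono2) auto
  finally have "real j * e \<le> C * real j powr (1 / p)" using C by (simp add: mult_left_mono)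
  moreover have "real j powr s * real j powr (1 / p) = real j" using j0 by (simp add: powr_add[symmetric] s_def)
  ultimately have "(real j powr s * e) * real j powr (1 / p) \<le> C * real j powr (1 / p)" by (simp add: mult_ac)
  then have "real j powr s * e \<le> C" using j0 by (simp add: mult_le_cancel_right)
  then show False using js e by (simp add: divide_less_eq)
qed

text \<open>Reflexivity of X represents \<Psi> on the functionals supported in one coordinate, which
  produces a candidate \<open>x\<close>. Testing \<Psi> against duality functionals of the
  truncations of \<open>x\<close> puts \<open>x\<close> into Z, and \<open>dual_tail\<close> makes
  every functional a norm limit of finitely supported ones.\<close>

lemma reflexive_ellp:
  assumes X: "reflexive X" shows "reflexive Z"
proof (rule Z.reflexiveI)
  fix \<Psi> assume \<Psi>: "\<Psi> \<in> bounded_ops (dual_space Z) scalar_space"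
  interpret DX: normed_mod "dual_space X" by (rule dual_normed)
  interpret DZ: normed_mod "dual_space Z" by (rule Z.dual_normed)
  interpret \<Psi>: op "dual_space Z" scalar_space \<Psi>
    using \<Psi> by (intro op.intro op_axioms.intro DZ.normed_mod_axioms scalar_space_normed)
  obtain K where K: "K > 0" "\<And>f. f \<in> carrier (dual_space Z) \<Longrightarrow> norm (\<Psi> f) \<le> K * nrm (dual_space Z) f"
    using \<Psi>.bound by auto
  define co where "co n g = (\<lambda>z\<in>carrier Z. g (z n))" for n and g :: "'a \<Rightarrow> 'k"
  have co: "co n \<in> bounded_ops (dual_space X) (dual_space Z)" for n
    unfolding co_def[abs_def] by (rule dual_pullback[OF Z.normed_mod_axioms normed_mod_axioms coord_op])
  have "\<exists>x\<in>carrier X. \<forall>g\<in>carrier (dual_space X). \<Psi> (co n g) = g x" for n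
    by (rule reflexiveD[OF X bounded_ops_comp[OF co \<Psi> Z.dual_norm_ge0]])
  then obtain x where x: "\<And>n. x n \<in> carrier X" "\<And>n g. g \<in> carrier (dual_space X) \<Longrightarrow> \<Psi> (co n g) = g (x n)" by metis
  have co_cl: "co n g \<in> carrier (dual_space Z)" if "g \<in> carrier (dual_space X)" for n g
    using co that by (rule bounded_ops_cl)
  have "\<exists>g. g \<in> carrier (dual_space X) \<and> g (x n) = of_real (nrm X (x n)) \<and> (\<forall>y\<in>carrier X. norm (g y) \<le> nrm X y)" for n
  proof -
    obtain F where "F \<in> bounded_ops X scalar_space" "F (x n) = of_real (nrm X (x n))" "\<forall>y\<in>carrier X. norm (F y) \<le> nrm X y"
      using norming_functional[OF x(1)] by blast
    then show ?thesis using x(1) by (intro exI[of _ "restrict F (carrier X)"]) (auto simp: dual_restrict)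
  qed
  then obtain g where g: "\<And>n. g n \<in> carrier (dual_space X)" "\<And>n. g n (x n) = of_real (nrm X (x n))"
    "\<And>n y. y \<in> carrier X \<Longrightarrow> norm (g n y) \<le> nrm X y" by metis
  \<comment> \<open>The coefficients of the duality map: the functional with these weights and the
    norming \<open>g n\<close> takes the value \<open>pw x n\<close> on coordinate \<open>n\<close>
    of \<open>x\<close>.\<close>
  define a where "a n = w n * (w n * nrm X (x n)) powr (p - 1)" for n
  have a0: "a n \<ge> 0" for n using w[of n] by (simp add: a_def)
  have ax: "a n * nrm X (x n) = pw x n" for n
  proof -
    define b where "b = w n * nrm X (x n)"
    have "b \<ge> 0" using w[of n] norm_ge0[OF x(1)] by (simp add: b_def)
    then have "b * b powr (p - 1) = b powr p" by (simp add: powr_mult_base)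
    then show ?thesis by (simp add: a_def pw_def b_def mult_ac)
  qed
  define G where "G m = rec_nat \<zero>\<^bsub>dual_space Z\<^esub> (\<lambda>n h. h \<oplus>\<^bsub>dual_space Z\<^esub> of_real (a n) \<odot>\<^bsub>dual_space Z\<^esub> co n (g n)) m" for m
  have G_simps: "G 0 = \<zero>\<^bsub>dual_space Z\<^esub>" "G (Suc m) = G m \<oplus>\<^bsub>dual_space Z\<^esub> of_real (a m) \<odot>\<^bsub>dual_space Z\<^esub> co m (g m)" for m
    by (simp_all add: G_def)
  have G_cl: "G m \<in> carrier (dual_space Z)" for m by (induction m) (auto simp: G_simps co_cl g)
  have \<Psi>G: "\<Psi> (G m) = of_real (\<Sum>n<m. pw x n)" for m
  proof (induction m)
    case 0 then show ?case using \<Psi>.zero by (simp add: G_simps)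
  next
    case (Suc m)
    have "\<Psi> (G (Suc m)) = \<Psi> (G m) + of_real (a m) * (g m (x m))"
      using G_cl co_cl[OF g(1)] \<Psi>.add \<Psi>.smult x(2)[OF g(1)] by (simp add: G_simps)
    then show ?case using Suc ax[of m] by (simp add: g(2)) (metis of_real_mult)
  qed
  have Gz: "norm (G m z) \<le> (\<Sum>n<m. a n * nrm X (z n))" if z: "z \<in> carrier Z" for m z
  proof (induction m)
    case 0 then show ?case using z by (simp add: G_simps Z.dual_simps)
  next
    case (Suc m)
    have "norm (G (Suc m) z) \<le> norm (G m z) + a m * norm (g m (z m))"
      using z norm_triangle_ineq[of "G m z" "of_real (a m) * g m (z m)"] a0[of m]
      by (simp add: G_simps Z.dual_simps co_def norm_mult)
    then show ?case using Suc g(3)[OF Z_coord[OF z], of m] mult_left_mono[OF g(3)[OF Z_coord[OF z], of m m] a0[of m]] by simp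
  qed
  \<comment> \<open>With this parameter in Young's inequality the partial sum returns on the right
    with factor \<open>K * e = 1/2\<close> and can be absorbed.\<close>
  define e where "e = 1 / (2 * K)"
  have e: "e > 0" "K * e = 1/2" using K by (simp_all add: e_def)
  have bd: "(\<Sum>n<m. pw x n) \<le> 2 * K * e powr (1 - p)" for m
  proof -
    define s where "s = (\<Sum>n<m. pw x n)"
    have s0: "s \<ge> 0" unfolding s_def by (intro sum_nonneg pw_ge0)
    have "nrm (dual_space Z) (G m) \<le> e * s + e powr (1 - p)"
    proof (rule Z.dual_least[OF G_cl])
      fix z assume z: "z \<in> carrier Z" "nrm Z z \<le> 1"
      have "a n * nrm X (z n) \<le> e * pw x n + e powr (1 - p) * pw z n" for n
        using powr_young_eps[OF p, of "w n * nrm X (x n)" "w n * nrm X (z n)" e] e w[of n]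
          norm_ge0[OF x(1)] norm_ge0[OF Z_coord[OF z(1)]] by (simp add: a_def pw_def mult_ac)
      then have "(\<Sum>n<m. a n * nrm X (z n)) \<le> (\<Sum>n<m. e * pw x n + e powr (1 - p) * pw z n)" by (intro sum_mono)
      also have "\<dots> = e * s + e powr (1 - p) * (\<Sum>n<m. pw z n)" by (simp add: sum.distrib sum_distrib_left s_def)
      also have "(\<Sum>n<m. pw z n) \<le> 1"
      proof -
        have "nrm Z z powr p \<le> 1 powr p" using z(2) p Z_norm_ge0 by (intro powr_mono2) auto
        then show ?thesis using Z_partial[OF z(1), of "{..<m}"] by simp
      qed
      finally show "norm (G m z) \<le> e * s + e powr (1 - p)"
        using Gz[OF z(1), of m] by (simp add: mult_left_mono mult_left_le)
    qed
    then have "K * nrm (dual_space Z) (G m) \<le> K * (e * s + e powr (1 - p))" using K by (intro mult_left_mono) auto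
    moreover have "norm (\<Psi> (G m)) = s" using \<Psi>G[of m] s0 by (simp add: s_def[symmetric])
    ultimately have "s \<le> K * (e * s + e powr (1 - p))" using K(2)[OF G_cl, of m] by linarith
    also have "\<dots> = s / 2 + K * e powr (1 - p)" using e(2) by (simp add: distrib_left mult.assoc[symmetric])
    finally show ?thesis by (simp add: s_def)
  qed
  have xZ: "x \<in> carrier Z"
  proof (rule Z_I(1)[OF x(1)])
    show "(\<Sum>n<m. pw x n) \<le> ((2 * K * e powr (1 - p)) powr (1 / p)) powr p" for m
      using bd[of m] p K by (simp add: powr_powr)
  qed simp
  have "\<Psi> F = F x" if F: "F \<in> carrier (dual_space Z)" for F
  proof -
    interpret F: op Z scalar_space F by (rule Z.dual_op[OF F])
    \<comment> \<open>\<open>F\<close> composed with truncation is the sum of its first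
      \<open>m\<close> coordinate parts \<open>f m\<close>, on which \<Psi> is already known to be
      evaluation at \<open>x\<close>.\<close>
    define Fm where "Fm m = (\<lambda>z\<in>carrier Z. F (trunc m z))" for m
    define f where "f m = (\<lambda>y\<in>carrier X. F (single m y))" for m
    have f: "f m \<in> carrier (dual_space X)" for m
      unfolding f_def by (rule bounded_ops_cl[OF dual_pullback[OF normed_mod_axioms Z.normed_mod_axioms single_op] F])
    have Fm_simps: "Fm 0 = \<zero>\<^bsub>dual_space Z\<^esub>" "Fm (Suc m) = Fm m \<oplus>\<^bsub>dual_space Z\<^esub> co m (f m)" for m
      using F.zero by (auto simp: Fm_def Z.dual_simps trunc_0 trunc_Suc F.add trunc_Z single_Z Z_coord co_def f_def fun_eq_iff restrict_def)
    have Fm: "Fm m \<in> carrier (dual_space Z) \<and> \<Psi> (Fm m) = F (trunc m x)" for m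
    proof (induction m)
      case 0 then show ?case using \<Psi>.zero F.zero by (simp add: Fm_simps trunc_0)
    next
      case (Suc m)
      then show ?case using co_cl[OF f, of m m] x(2)[OF f, of m m] x(1)[of m] xZ
        by (simp add: Fm_simps \<Psi>.add trunc_Suc F.add trunc_Z single_Z) (simp add: f_def)
    qed
    have small: "norm (\<Psi> F - F x) \<le> e" if "e > 0" for e
    proof -
      define e' where "e' = e / (2 * K)"
      have e': "e' > 0" "K * e' = e / 2" using \<open>e > 0\<close> K by (simp_all add: e'_def)
      have "tends scalar_space (\<lambda>k. F (trunc k x)) (F x)"
        by (rule F.tends[OF trunc_tends[OF xZ]]) (use xZ trunc_Z in auto)
      then have "(\<lambda>k. norm (F (trunc k x) \<ominus>\<^bsub>scalar_space\<^esub> F x)) \<longlonglongrightarrow> 0" by (simp add: tends_def)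
      from LIMSEQ_0_lessD[OF this, of "e/2"] obtain m0 where m0: "\<And>m. m \<ge> m0 \<Longrightarrow> norm (F (trunc m x) - F x) < e / 2"
        using \<open>e > 0\<close> by (auto simp: SS.minus_smult)
      obtain m where m: "m \<ge> m0" "\<And>z. z \<in> carrier Z \<Longrightarrow> nrm Z z \<le> 1 \<Longrightarrow> norm (F (z \<ominus>\<^bsub>Z\<^esub> trunc m z)) \<le> e'"
        using dual_tail[OF F e'(1), of m0] by blast
      define H where "H = F \<ominus>\<^bsub>dual_space Z\<^esub> Fm m"
      have H: "H \<in> carrier (dual_space Z)" using F Fm by (simp add: H_def)
      have Hz: "H z = F (z \<ominus>\<^bsub>Z\<^esub> trunc m z)" if "z \<in> carrier Z" for z
        using that F Fm by (simp add: H_def DZ.minus_smult Z.dual_simps F.diff trunc_Z SS.minus_smult) (simp add: Fm_def)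
      have "nrm (dual_space Z) H \<le> e'" by (rule Z.dual_least[OF H]) (simp add: Hz m(2))
      then have "norm (\<Psi> H) \<le> e / 2" using K(2)[OF H] mult_left_mono[of "nrm (dual_space Z) H" e' K] K(1) e'(2) by linarith
      moreover have "\<Psi> H = \<Psi> F - F (trunc m x)" using F Fm[of m] by (simp add: H_def \<Psi>.diff SS.minus_smult)
      ultimately have "norm (\<Psi> F - F (trunc m x)) + norm (F (trunc m x) - F x) \<le> e" using m0[OF m(1)] by simp
      then show ?thesis using norm_triangle_ineq[of "\<Psi> F - F (trunc m x)" "F (trunc m x) - F x"] by simp
    qed
    have "norm (\<Psi> F - F x) \<le> 0"
    proof (rule field_le_epsilon)
      fix e :: real assume "e > 0"
      from small[OF this] show "norm (\<Psi> F - F x) \<le> 0 + e" by simp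
    qed
    then show ?thesis by simp
  qed
  then show "\<exists>x\<in>carrier Z. \<forall>F\<in>carrier (dual_space Z). \<Psi> F = F x" using xZ by blast
qed

end

lemma (in group_extension) reflexive_extension: "reflexive X \<Longrightarrow> reflexive Q.Y"
  by (intro Q.reflexive_quotient reflexive_ellp)

section \<open>Smooth cut-off functions\<close>

text \<open>\<open>Ck k f\<close> says that \<open>f\<close> and its derivatives up to order
  \<open>k\<close> are differentiable. The recursion strips the first derivative, so closure
  properties follow by induction on \<open>k\<close> with \<open>f\<close> arbitrary;
  \<open>Ck_iterated\<close> returns to the iterated derivatives of
  \<open>test_function\<close>.\<close>

primrec Ck :: "nat \<Rightarrow> (real \<Rightarrow> real) \<Rightarrow> bool" where
  "Ck 0 f \<longleftrightarrow> f differentiable_on UNIV"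
| "Ck (Suc k) f \<longleftrightarrow> f differentiable_on UNIV \<and> Ck k (deriv f)"

lemma Ck_differentiable: "Ck k f \<Longrightarrow> f differentiable_on UNIV"
  by (cases k) auto

lemma Ck_Suc_imp: "Ck (Suc k) f \<Longrightarrow> Ck k f"
  by (induction k arbitrary: f) (auto intro: Ck_differentiable)

lemma Ck_iterated: "Ck k f \<Longrightarrow> (deriv ^^ k) f differentiable_on UNIV"
proof (induction k arbitrary: f)
  case (Suc k)
  have "(deriv ^^ Suc k) f = (deriv ^^ k) (deriv f)" by (simp add: funpow_swap1)
  then show ?case using Suc by simp
qed simp

lemma DERIV_deriv_of_differentiable_on: "(f :: real \<Rightarrow> real) differentiable_on UNIV \<Longrightarrow> DERIV f x :> deriv f x"
  by (simp add: DERIV_deriv_iff_real_differentiable differentiable_on_def)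

lemma differentiable_on_UNIV_I: "(\<And>x. DERIV (f :: real \<Rightarrow> real) x :> f' x) \<Longrightarrow> f differentiable_on UNIV"
  by (meson differentiable_on_def has_field_derivative_imp_has_derivative differentiable_def UNIV_I)

lemma deriv_eqI: "(\<And>x. DERIV f x :> f' x) \<Longrightarrow> deriv f = f'"
  by (auto intro: DERIV_imp_deriv)

lemma Ck_SucI: "(\<And>x. DERIV f x :> f' x) \<Longrightarrow> Ck k f' \<Longrightarrow> Ck (Suc k) f"
  using deriv_eqI[of f f'] differentiable_on_UNIV_I[of f f'] by simp

lemma Ck_const: "Ck k (\<lambda>_. c)"
  by (induction k arbitrary: c) (auto intro!: Ck_SucI[of _ "\<lambda>_. 0"] derivative_eq_intros simp del: Ck.simps(2))

lemma Ck_add: "Ck k f \<Longrightarrow> Ck k g \<Longrightarrow> Ck k (\<lambda>x. f x + g x)"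
proof (induction k arbitrary: f g)
  case (Suc k)
  have fg: "f differentiable_on UNIV" "g differentiable_on UNIV" using Suc.prems by auto
  have "Ck k (\<lambda>x. deriv f x + deriv g x)" using Suc by simp
  then show ?case
    by (rule Ck_SucI[OF DERIV_add[OF DERIV_deriv_of_differentiable_on[OF fg(1)] DERIV_deriv_of_differentiable_on[OF fg(2)]]])
qed (simp add: differentiable_on_add)

lemma Ck_mult: "Ck k f \<Longrightarrow> Ck k g \<Longrightarrow> Ck k (\<lambda>x. f x * g x)"
proof (induction k arbitrary: f g)
  case (Suc k)
  have fg: "f differentiable_on UNIV" "g differentiable_on UNIV" using Suc.prems by auto
  have "Ck k (\<lambda>x. deriv f x * g x + deriv g x * f x)"
    using Suc.prems by (intro Ck_add Suc.IH Ck_Suc_imp[of k f] Ck_Suc_imp[of k g]) auto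
  then show ?case
    by (rule Ck_SucI[OF DERIV_mult[OF DERIV_deriv_of_differentiable_on[OF fg(1)] DERIV_deriv_of_differentiable_on[OF fg(2)]]])
qed (simp add: differentiable_on_mult)

lemma Ck_inverse: "Ck k f \<Longrightarrow> (\<And>x. f x \<noteq> 0) \<Longrightarrow> Ck k (\<lambda>x. inverse (f x))"
proof (induction k arbitrary: f)
  case 0
  have "DERIV (\<lambda>x. inverse (f x)) x :> - (inverse (f x) * deriv f x * inverse (f x))" for x
    by (rule DERIV_inverse'[OF DERIV_deriv_of_differentiable_on[OF Ck_differentiable[OF 0(1)]] 0(2)])
  then show ?case unfolding Ck.simps by (rule differentiable_on_UNIV_I)
next
  case (Suc k)
  have f: "f differentiable_on UNIV" using Suc.prems by auto
  have "Ck k (\<lambda>x. (-1) * (deriv f x * (inverse (f x) * inverse (f x))))"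
    using Suc.prems(1) Suc.IH[OF Ck_Suc_imp[OF Suc.prems(1)] Suc.prems(2)]
    by (simp only: Ck_mult Ck_const Ck.simps simp_thms)
  moreover have "DERIV (\<lambda>x. inverse (f x)) x :> (-1) * (deriv f x * (inverse (f x) * inverse (f x)))" for x
    using DERIV_inverse_fun[OF DERIV_deriv_of_differentiable_on[OF f, of x] Suc.prems(2)] by (simp add: power2_eq_square)
  ultimately show ?case by (rule Ck_SucI[rotated])
qed

lemma Ck_affine: "Ck k f \<Longrightarrow> Ck k (\<lambda>x. f (a * x + b))"
proof (induction k arbitrary: f)
  case 0
  have "DERIV (\<lambda>x. f (a * x + b)) x :> deriv f (a * x + b) * a" for x
    using 0 by (intro DERIV_chain2[OF DERIV_deriv_of_differentiable_on]) (auto intro!: derivative_eq_intros)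
  then show ?case unfolding Ck.simps by (rule differentiable_on_UNIV_I)
next
  case (Suc k)
  have f: "f differentiable_on UNIV" using Suc.prems by auto
  have "DERIV (\<lambda>x. f (a * x + b)) x :> deriv f (a * x + b) * a" for x
    using f by (intro DERIV_chain2[OF DERIV_deriv_of_differentiable_on]) (auto intro!: derivative_eq_intros)
  moreover have "Ck k (\<lambda>x. deriv f (a * x + b) * a)"
    by (rule Ck_mult[OF Suc.IH Ck_const]) (use Suc.prems in simp)
  ultimately show ?case by (rule Ck_SucI)
qed

lemma Ck_prod: "finite D \<Longrightarrow> (\<And>i. i \<in> D \<Longrightarrow> Ck k (f i)) \<Longrightarrow> Ck k (\<lambda>x. \<Prod>i\<in>D. f i x)"
  by (induction D rule: finite_induct) (auto intro: Ck_const Ck_mult)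

section \<open>Flat functions, smooth steps and bumps\<close>

definition flat :: "nat \<Rightarrow> real \<Rightarrow> real" where
  "flat n x = (if x > 0 then exp (- 1 / x) / x ^ n else 0)"

lemma flat_tendsto_0: "(flat n \<longlongrightarrow> 0) (at 0)"
proof -
  have "((\<lambda>x. inverse x ^ n / exp (inverse x)) \<longlongrightarrow> 0) (at_right (0::real))"
    by (rule filterlim_compose[OF tendsto_power_div_exp_0 filterlim_inverse_at_top_right])
  then have "(flat n \<longlongrightarrow> 0) (at_right 0)"
  proof (rule Lim_transform_eventually)
    have "\<forall>\<^sub>F x in at_right (0::real). x > 0" by (simp add: eventually_at_right_less)
    then show "\<forall>\<^sub>F x in at_right 0. inverse x ^ n / exp (inverse x) = flat n x"
      by eventually_elim (simp add: flat_def exp_minus field_simps)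
  qed
  moreover have "(flat n \<longlongrightarrow> 0) (at_left 0)"
  proof (rule Lim_transform_eventually[OF tendsto_const])
    have "\<forall>\<^sub>F x in at_left (0::real). x < 0" by (rule eventually_at_leftI[of "-1"]) auto
    then show "\<forall>\<^sub>F x in at_left 0. 0 = flat n x" by eventually_elim (simp add: flat_def)
  qed
  ultimately show ?thesis by (simp add: filterlim_at_split)
qed

text \<open>The family \<open>flat n\<close> is closed under differentiation up to linear
  combinations, so all members are smooth. At 0 the difference quotient of \<open>flat n\<close> is
  \<open>flat (Suc n)\<close> on both sides, and it tends to 0.\<close>

lemma DERIV_flat: "DERIV (flat n) x :> flat (n + 2) x + (- real n) * flat (n + 1) x"
proof (cases x "0::real" rule: linorder_cases)
  case less
  have "DERIV (\<lambda>_. 0) x :> (0::real)" by simp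
  then have "DERIV (flat n) x :> 0"
    by (rule has_field_derivative_transform_within_open[of _ _ _ "{..<0}"]) (use less in \<open>auto simp: flat_def\<close>)
  then show ?thesis using less by (simp add: flat_def)
next
  case equal
  have "((\<lambda>y. (flat n y - flat n 0) / (y - 0)) \<longlongrightarrow> 0) (at 0)"
    using flat_tendsto_0[of "Suc n"]
    by (rule Lim_transform_eventually) (auto simp: flat_def eventually_at intro!: exI[of _ 1])
  then show ?thesis using equal by (simp add: has_field_derivative_iff flat_def)
next
  case greater
  have "DERIV (\<lambda>x. exp (- 1 / x) / x ^ n) x :> flat (n + 2) x + (- real n) * flat (n + 1) x"
  proof (cases n)
    case 0
    then show ?thesis using greater
      by (auto intro!: derivative_eq_intros simp: flat_def field_simps power2_eq_square)
  next
    case (Suc m)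
    have "DERIV (\<lambda>x. x ^ Suc m) x :> real (Suc m) * x ^ m"
      using DERIV_pow[of "Suc m" x] by simp
    moreover have "DERIV (\<lambda>x. exp (- 1 / x)) x :> exp (- 1 / x) / x\<^sup>2"
      using greater by (auto intro!: derivative_eq_intros simp: power2_eq_square)
    ultimately have "DERIV (\<lambda>x. exp (- 1 / x) / x ^ Suc m) x :>
        (exp (- 1 / x) / x\<^sup>2 * x ^ Suc m - exp (- 1 / x) * (real (Suc m) * x ^ m)) / (x ^ Suc m * x ^ Suc m)"
      using greater by (intro DERIV_divide) auto
    moreover have "(exp (- 1 / x) / x\<^sup>2 * x ^ Suc m - exp (- 1 / x) * (real (Suc m) * x ^ m)) / (x ^ Suc m * x ^ Suc m)
       = flat (n + 2) x + (- real n) * flat (n + 1) x"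
      using greater Suc by (simp add: flat_def field_simps power2_eq_square)
    ultimately show ?thesis unfolding Suc by simp
  qed
  then show ?thesis
    by (rule has_field_derivative_transform_within_open[of _ _ _ "{0<..}"]) (use greater in \<open>auto simp: flat_def\<close>)
qed

lemma Ck_flat: "Ck k (flat n)"
proof (induction k arbitrary: n)
  case 0
  show ?case unfolding Ck.simps by (rule differentiable_on_UNIV_I[OF DERIV_flat])
next
  case (Suc k)
  have "Ck k (\<lambda>x. flat (n + 2) x + (- real n) * flat (n + 1) x)"
    by (intro Ck_add Ck_mult Ck_const Suc.IH)
  then show ?case by (rule Ck_SucI[OF DERIV_flat])
qed

text \<open>A smooth transition from 0 on the negative axis to 1 beyond 1. The denominator is
  positive because \<open>x\<close> and \<open>1 - x\<close> are never both nonpositive;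
  \<open>inverse\<close> and \<open>(-1) * x + 1\<close> match the closure rules for
  \<open>Ck\<close>.\<close>

definition step :: "real \<Rightarrow> real" where
  "step x = flat 0 x * inverse (flat 0 x + flat 0 ((-1) * x + 1))"

lemma step_denom_pos: "flat 0 x + flat 0 ((-1) * x + 1) > 0"
proof -
  have nn: "flat 0 y \<ge> 0" for y by (simp add: flat_def)
  consider "x > 0" | "(-1) * x + 1 > 0" by linarith
  then show ?thesis
    by cases (use nn[of x] nn[of "(-1) * x + 1"] in \<open>auto simp: flat_def intro: add_pos_nonneg add_nonneg_pos\<close>)
qed

lemma step_range: "0 \<le> step x" "step x \<le> 1"
  and step_0: "x \<le> 0 \<Longrightarrow> step x = 0" and step_1: "x \<ge> 1 \<Longrightarrow> step x = 1"
proof -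
  have nn: "flat 0 y \<ge> 0" for y by (simp add: flat_def)
  have e: "step x = flat 0 x / (flat 0 x + flat 0 ((-1) * x + 1))" by (simp add: step_def divide_inverse)
  show "0 \<le> step x" "step x \<le> 1" unfolding e using nn[of x] nn[of "(-1) * x + 1"] step_denom_pos[of x]
    by (auto simp: divide_le_eq)
  show "x \<le> 0 \<Longrightarrow> step x = 0" by (simp add: step_def flat_def)
  show "x \<ge> 1 \<Longrightarrow> step x = 1" using step_denom_pos[of x] unfolding e by (auto simp: flat_def)
qed

lemma Ck_step: "Ck k step"
  unfolding step_def[abs_def] using step_denom_pos
  by (intro Ck_mult[OF Ck_flat Ck_inverse[OF Ck_add[OF Ck_flat Ck_affine[OF Ck_flat]]]]) (simp add: less_imp_neq[symmetric])

text \<open>In the variable \<open>y = (x - c) / d\<close> this is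
  \<open>step (y + 2) * step (2 - y)\<close>, equal to 1 for \<bar>y\<bar> \<le> 1 and to 0 for
  \<bar>y\<bar> \<ge> 2. The arguments are expanded to the affine form of
  \<open>Ck_affine\<close>.\<close>

definition bump :: "real \<Rightarrow> real \<Rightarrow> real \<Rightarrow> real" where
  "bump c d x = step (inverse d * x + (2 - c / d)) * step ((- inverse d) * x + (2 + c / d))"

lemma bump_range: "0 \<le> bump c d x" "bump c d x \<le> 1"
  unfolding bump_def using step_range by (auto intro: mult_le_one)

lemma bump_eq: "d > 0 \<Longrightarrow> bump c d x = step ((x - c) / d + 2) * step (- ((x - c) / d) + 2)"
proof -
  assume d: "d > 0"
  have "inverse d * x + (2 - c / d) = (x - c) / d + 2" "(- inverse d) * x + (2 + c / d) = - ((x - c) / d) + 2"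
    using d by (simp_all add: field_simps)
  then show ?thesis unfolding bump_def by (simp only:)
qed

lemma bump_1: "d > 0 \<Longrightarrow> \<bar>x - c\<bar> \<le> d \<Longrightarrow> bump c d x = 1"
proof -
  assume d: "d > 0" and x: "\<bar>x - c\<bar> \<le> d"
  have "\<bar>(x - c) / d\<bar> \<le> 1" using d x by simp
  then have "(x - c) / d + 2 \<ge> 1" "- ((x - c) / d) + 2 \<ge> 1" by linarith+
  then show ?thesis unfolding bump_eq[OF d] by (simp only: step_1 mult_1)
qed

lemma bump_0: "d > 0 \<Longrightarrow> \<bar>x - c\<bar> \<ge> 2 * d \<Longrightarrow> bump c d x = 0"
proof -
  assume d: "d > 0" and x: "\<bar>x - c\<bar> \<ge> 2 * d"
  have "\<bar>(x - c) / d\<bar> \<ge> 2" using d x by (simp add: le_divide_eq)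
  then have "(x - c) / d + 2 \<le> 0 \<or> - ((x - c) / d) + 2 \<le> 0" by linarith
  then show ?thesis unfolding bump_eq[OF d] using step_0 by (metis mult_zero_left mult_zero_right)
qed

lemma Ck_bump: "Ck k (bump c d)"
  unfolding bump_def[abs_def] by (rule Ck_mult[OF Ck_affine[OF Ck_step] Ck_affine[OF Ck_step]])

text \<open>Finitely many balls cover \<open>K\<close> while the balls of twice the radius stay in
  \<open>U\<close>. One minus the product of the functions \<open>1 - bump\<close> is 1 where some
  bump is 1 and 0 where all vanish.\<close>

lemma smooth_urysohn:
  fixes K U :: "real set"
  assumes K: "compact K" and U: "open U" "K \<subseteq> U"
  shows "\<exists>\<phi>. test_function \<phi> \<and> (\<forall>t. 0 \<le> \<phi> t \<and> \<phi> t \<le> 1) \<and> (\<forall>t\<in>K. \<phi> t = 1) \<and> (\<forall>t. t \<notin> U \<longrightarrow> \<phi> t = 0)"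
proof -
  have "\<exists>d>0. ball x (2 * d) \<subseteq> U" if xK: "x \<in> K" for x
  proof -
    obtain e where "e > 0" "ball x e \<subseteq> U"
      using U(1)[unfolded open_contains_ball] U(2) xK by (meson subsetD)
    then show ?thesis by (intro exI[of _ "e/2"]) auto
  qed
  then obtain d where d: "\<And>x. x \<in> K \<Longrightarrow> d x > 0" "\<And>x. x \<in> K \<Longrightarrow> ball x (2 * d x) \<subseteq> U" by metis
  have "K \<subseteq> (\<Union>x\<in>K. ball x (d x))"
  proof
    fix x assume "x \<in> K"
    then show "x \<in> (\<Union>x\<in>K. ball x (d x))" using d(1)[of x] by (intro UN_I[of x]) auto
  qed
  then have "\<exists>D\<subseteq>K. finite D \<and> K \<subseteq> (\<Union>x\<in>D. ball x (d x))"
    using compactE_image[OF K, of K "\<lambda>x. ball x (d x)"] by (metis open_ball)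
  then obtain D where D: "D \<subseteq> K" "finite D" "K \<subseteq> (\<Union>x\<in>D. ball x (d x))" by (elim exE conjE)
  define \<phi> where "\<phi> t = 1 + (-1) * (\<Prod>x\<in>D. 1 + (-1) * bump x (d x) t)" for t
  have r: "0 \<le> (\<Prod>x\<in>D. 1 + (-1) * bump x (d x) t) \<and> (\<Prod>x\<in>D. 1 + (-1) * bump x (d x) t) \<le> 1" for t
    using bump_range by (auto intro!: prod_nonneg prod_le_1)
  have zero: "\<phi> t = 0" if "\<And>x. x \<in> D \<Longrightarrow> \<bar>t - x\<bar> \<ge> 2 * d x" for t
    using bump_0[OF d(1)] that D(1) by (auto simp: \<phi>_def intro!: prod.neutral)
  have "Ck k \<phi>" for k unfolding \<phi>_def[abs_def]
    by (rule Ck_add[OF Ck_const Ck_mult[OF Ck_const Ck_prod[OF D(2) Ck_add[OF Ck_const Ck_mult[OF Ck_const Ck_bump]]]]])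
  moreover have "\<exists>R. \<forall>t. \<bar>t\<bar> > R \<longrightarrow> \<phi> t = 0"
  proof (intro exI allI impI)
    fix t assume t: "\<bar>t\<bar> > (\<Sum>x\<in>D. \<bar>x\<bar> + 2 * d x)"
    show "\<phi> t = 0"
    proof (rule zero)
      fix x assume x: "x \<in> D"
      have "\<bar>x\<bar> + 2 * d x \<le> (\<Sum>x\<in>D. \<bar>x\<bar> + 2 * d x)"
      proof (rule member_le_sum[OF x _ D(2)])
        fix y assume "y \<in> D - {x}"
        then have "d y > 0" using D(1) d(1) by blast
        then show "0 \<le> \<bar>y\<bar> + 2 * d y" by simp
      qed
      then show "\<bar>t - x\<bar> \<ge> 2 * d x" using t by linarith
    qed
  qed
  ultimately have "test_function \<phi>" unfolding test_function_def using Ck_iterated by blast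
  moreover have "\<phi> t = 1" if tK: "t \<in> K" for t
  proof -
    obtain x where x: "x \<in> D" "t \<in> ball x (d x)" using D(3) tK by blast
    then have "bump x (d x) t = 1" using d(1)[of x] D(1) by (intro bump_1) (auto simp: dist_real_def)
    then have "(\<Prod>x\<in>D. 1 + (-1) * bump x (d x) t) = 0" using x(1) D(2) by (auto intro!: prod_zero)
    then show ?thesis by (simp add: \<phi>_def)
  qed
  moreover have "\<phi> t = 0" if "t \<notin> U" for t
  proof (rule zero)
    fix x assume "x \<in> D"
    then have "t \<notin> ball x (2 * d x)" using d(2)[of x] D(1) that by blast
    then show "\<bar>t - x\<bar> \<ge> 2 * d x" by (auto simp: dist_real_def)
  qed
  moreover have "0 \<le> \<phi> t \<and> \<phi> t \<le> 1" for t using r[of t] by (simp add: \<phi>_def)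
  ultimately show ?thesis by blast
qed

text \<open>Regularity of Lebesgue measure squeezes \<open>E\<close> between a compact and an open
  set, and a cut-off function between these differs from the indicator only on the small set
  \<open>A\<close>. Boundedness of \<open>E\<close> makes the inner closed set compact.\<close>

lemma test_function_approx:
  assumes E: "E \<in> sets lebesgue" "bounded E" and e: "e > (0::real)"
  shows "\<exists>\<phi> A. test_function \<phi> \<and> (\<forall>t. 0 \<le> \<phi> t \<and> \<phi> t \<le> 1) \<and> A \<in> sets lebesgue \<and>
     emeasure lebesgue A < ennreal e \<and> (\<forall>t. t \<notin> A \<longrightarrow> \<phi> t = indicator E t)"
proof -
  obtain U where U: "open U" "E \<subseteq> U" "U - E \<in> lmeasurable" "emeasure lebesgue (U - E) < ennreal (e/2)"
    by (rule sets_lebesgue_outer_open[OF E(1), of "e/2"]) (use e in auto)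
  obtain K where K: "closed K" "K \<subseteq> E" "E - K \<in> lmeasurable" "emeasure lebesgue (E - K) < ennreal (e/2)"
    by (rule sets_lebesgue_inner_closed[OF E(1), of "e/2"]) (use e in auto)
  have "compact K" using K(1,2) E(2) bounded_subset by (auto simp: compact_eq_bounded_closed)
  from smooth_urysohn[OF this U(1) order_trans[OF K(2) U(2)]] obtain \<phi> where \<phi>: "test_function \<phi>"
    "\<forall>t. 0 \<le> \<phi> t \<and> \<phi> t \<le> 1" "\<forall>t\<in>K. \<phi> t = 1" "\<forall>t. t \<notin> U \<longrightarrow> \<phi> t = 0" by (elim exE conjE)
  define A where "A = (U - E) \<union> (E - K)"
  have "emeasure lebesgue A \<le> emeasure lebesgue (U - E) + emeasure lebesgue (E - K)"
    unfolding A_def using U(3) K(3) by (intro emeasure_subadditive) (auto intro: fmeasurableD)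
  also have "\<dots> < ennreal (e/2) + ennreal (e/2)" using U(4) K(4) by (rule add_strict_mono)
  also have "\<dots> = ennreal e" using e by (simp flip: ennreal_plus)
  finally have "emeasure lebesgue A < ennreal e" .
  moreover have "A \<in> sets lebesgue" unfolding A_def using U(3) K(3) by (auto intro: fmeasurableD)
  moreover have "\<phi> t = indicator E t" if "t \<notin> A" for t
    using that bspec[OF \<phi>(3), of t] spec[OF \<phi>(4), of t] U(2) K(2) by (auto simp: A_def indicator_def)
  ultimately show ?thesis using \<phi>(1,2) by blast
qed

lemma test_function_continuous: "test_function \<phi> \<Longrightarrow> continuous_on UNIV \<phi>"
  unfolding test_function_def by (metis differentiable_imp_continuous_on funpow_0)

lemma test_function_bounded:
  assumes "test_function \<phi>"
  shows "\<exists>B R. B \<ge> 0 \<and> (\<forall>t. \<bar>\<phi> t\<bar> \<le> B * indicator {- R..R} t)"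
proof -
  from assms[unfolded test_function_def] obtain R where R: "\<forall>t. \<bar>t\<bar> > R \<longrightarrow> \<phi> t = 0" by (elim conjE exE)
  have "compact (\<phi> ` {-R..R})"
    by (rule compact_continuous_image[OF continuous_on_subset[OF test_function_continuous[OF assms]]]) auto
  then have "\<exists>B. \<forall>y\<in>\<phi> ` {-R..R}. norm y \<le> B"
    using compact_imp_bounded bounded_iff by blast
  then obtain B where "\<forall>y\<in>\<phi> ` {-R..R}. norm y \<le> B" by (rule exE)
  then have B: "\<bar>\<phi> t\<bar> \<le> B" if "t \<in> {-R..R}" for t using that by auto
  have "\<bar>\<phi> t\<bar> \<le> max 0 B * indicator {- R..R} t" for t
  proof (cases "t \<in> {-R..R}")
    case True then show ?thesis using B[of t] by simp
  next
    case False
    then have "\<bar>t\<bar> > R" by auto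
    then have "\<phi> t = 0" using R by blast
    then show ?thesis using False by simp
  qed
  then show ?thesis by (intro exI[of _ "max 0 B"] exI[of _ R]) auto
qed

section \<open>Strong measurability\<close>

text \<open>The value type carries no sigma-algebra; only fibres have to be measurable. Composition
  with an arbitrary function, measurable or not, stays in this class, so a chosen section of the
  quotient map may be applied to it.\<close>

definition countably_valued :: "(real \<Rightarrow> 'b) \<Rightarrow> bool" where
  "countably_valued f \<longleftrightarrow> countable (range f) \<and> (\<forall>y. f -` {y} \<in> sets lebesgue)"

lemma countably_valued_measurable:
  assumes "countably_valued f" shows "f -` A \<in> sets lebesgue"
proof -
  have "f -` A = (\<Union>y\<in>A \<inter> range f. f -` {y})" by auto
  also have "\<dots> \<in> sets lebesgue" using assms
    by (intro sets.countable_UN') (auto simp: countably_valued_def)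
  finally show ?thesis .
qed

lemma countably_valued_simple: "simple_function lebesgue s \<Longrightarrow> countably_valued s"
  unfolding countably_valued_def
proof
  assume s: "simple_function lebesgue s"
  have "finite (range s)" using simple_functionD(1)[OF s] by simp
  then show "countable (range s)" by (rule countable_finite)
  show "\<forall>y. s -` {y} \<in> sets lebesgue" using simple_functionD(2)[OF s] by simp
qed

lemma countably_valued_comp:
  assumes "countably_valued f" shows "countably_valued (\<lambda>t. g (f t))"
  unfolding countably_valued_def
proof
  have "range (\<lambda>t. g (f t)) = g ` range f" by auto
  then show "countable (range (\<lambda>t. g (f t)))" using assms by (simp add: countably_valued_def)
  have "(\<lambda>t. g (f t)) -` {y} = f -` (g -` {y})" for y by auto
  then show "\<forall>y. (\<lambda>t. g (f t)) -` {y} \<in> sets lebesgue" using countably_valued_measurable[OF assms] by simp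
qed

lemma countably_valued_pair:
  assumes "countably_valued f" "countably_valued g" shows "countably_valued (\<lambda>t. (f t, g t))"
  unfolding countably_valued_def
proof
  have "range (\<lambda>t. (f t, g t)) \<subseteq> range f \<times> range g" by auto
  then show "countable (range (\<lambda>t. (f t, g t)))"
    by (rule countable_subset) (use assms in \<open>auto simp: countably_valued_def\<close>)
  show "\<forall>y. (\<lambda>t. (f t, g t)) -` {y} \<in> sets lebesgue"
  proof
    fix y
    have "(\<lambda>t. (f t, g t)) -` {y} = f -` {fst y} \<inter> g -` {snd y}" by (cases y) auto
    then show "(\<lambda>t. (f t, g t)) -` {y} \<in> sets lebesgue" using assms by (auto simp: countably_valued_def)
  qed
qed

lemma countably_valued_comp2:
  assumes "countably_valued f" "countably_valued g" shows "countably_valued (\<lambda>t. h (f t) (g t))"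
  using countably_valued_comp[OF countably_valued_pair[OF assms], of "\<lambda>q. h (fst q) (snd q)"] by simp

lemma countably_valued_If:
  assumes "E \<in> sets lebesgue" "countably_valued f" "countably_valued g"
  shows "countably_valued (\<lambda>t. if t \<in> E then f t else g t)"
  unfolding countably_valued_def
proof
  have "range (\<lambda>t. if t \<in> E then f t else g t) \<subseteq> range f \<union> range g" by auto
  then show "countable (range (\<lambda>t. if t \<in> E then f t else g t))"
    by (rule countable_subset) (use assms in \<open>auto simp: countably_valued_def\<close>)
  have "(\<lambda>t. if t \<in> E then f t else g t) -` {y} = (E \<inter> f -` {y}) \<union> ((- E) \<inter> g -` {y})" for y by auto
  then show "\<forall>y. (\<lambda>t. if t \<in> E then f t else g t) -` {y} \<in> sets lebesgue"
    using assms by (auto simp: countably_valued_def Compl_in_sets_lebesgue)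
qed

lemma countably_valued_select:
  fixes k :: "real \<Rightarrow> nat"
  assumes "k \<in> measurable lebesgue (count_space UNIV)" "\<And>j. countably_valued (s j)"
  shows "countably_valued (\<lambda>t. s (k t) t)"
  unfolding countably_valued_def
proof
  have "range (\<lambda>t. s (k t) t) \<subseteq> (\<Union>j. range (s j))" by auto
  then show "countable (range (\<lambda>t. s (k t) t))"
    by (rule countable_subset) (use assms in \<open>auto simp: countably_valued_def\<close>)
  have "(\<lambda>t. s (k t) t) -` {y} = (\<Union>j. k -` {j} \<inter> s j -` {y})" for y by auto
  moreover have "k -` {j} \<in> sets lebesgue" for j using measurable_sets[OF assms(1), of "{j}"] by simp
  ultimately have "(\<lambda>t. s (k t) t) -` {y} \<in> sets lebesgue" for y
    using assms(2) by (simp only:) (intro sets.countable_UN, auto simp: countably_valued_def)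
  then show "\<forall>y. (\<lambda>t. s (k t) t) -` {y} \<in> sets lebesgue" ..
qed

lemma countably_valued_const: "countably_valued (\<lambda>_. y)"
  using countably_valued_simple[of "\<lambda>_. y"] by simp

section \<open>Measurability up to null sets\<close>

lemma AE_lebesgue_null: "AE t in lebesgue. P t \<Longrightarrow> \<exists>N. N \<in> null_sets lebesgue \<and> {t. \<not> P t} \<subseteq> N"
  by (auto simp: eventually_ae_filter)

text \<open>Completeness of Lebesgue measure: the preimages under the two functions differ by a
  subset of a null set, which is measurable.\<close>

lemma borel_measurable_lebesgue_AE_cong:
  fixes f g :: "real \<Rightarrow> real"
  assumes f: "f \<in> borel_measurable lebesgue" and e: "AE t in lebesgue. f t = g t"
  shows "g \<in> borel_measurable lebesgue"
proof (rule measurableI)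
  fix A :: "real set" assume A: "A \<in> sets borel"
  obtain N where N: "N \<in> null_sets lebesgue" "{t. f t \<noteq> g t} \<subseteq> N" using AE_lebesgue_null[OF e] by blast
  have "f t = g t" if "t \<notin> N" for t using N(2) that by auto
  then have eq: "g -` A = (f -` A - N) \<union> (g -` A \<inter> N)" by auto
  have "g -` A \<inter> N \<in> null_sets lebesgue" by (rule null_sets_completion_subset[OF _ N(1)]) auto
  moreover have "f -` A \<in> sets lebesgue" using measurable_sets[OF f A] by simp
  ultimately have "(f -` A - N) \<union> (g -` A \<inter> N) \<in> sets lebesgue"
    using N(1) by (intro sets.Un sets.Diff) (simp_all only: null_setsD2)
  then show "g -` A \<inter> space lebesgue \<in> sets lebesgue" by (simp only: eq[symmetric]) simp
qed simp

lemma borel_measurable_lebesgue_AE_LIMSEQ: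
  fixes u :: "nat \<Rightarrow> real \<Rightarrow> real"
  assumes u: "\<And>n. u n \<in> borel_measurable lebesgue" and lim: "AE t in lebesgue. (\<lambda>n. u n t) \<longlonglongrightarrow> g t"
  shows "g \<in> borel_measurable lebesgue"
proof -
  obtain N where N: "N \<in> null_sets lebesgue" "{t. \<not> (\<lambda>n. u n t) \<longlonglongrightarrow> g t} \<subseteq> N"
    using AE_lebesgue_null[OF lim] by blast
  have "(\<lambda>t. indicator (- N) t * g t) \<in> borel_measurable lebesgue"
  proof (rule borel_measurable_LIMSEQ_real)
    show "(\<lambda>n. indicator (- N) t * u n t) \<longlonglongrightarrow> indicator (- N) t * g t" for t
      using N(2) by (cases "t \<in> N") auto
    have "- N \<in> sets lebesgue" using N(1) by (auto simp: null_sets_def Compl_in_sets_lebesgue)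
    then show "(\<lambda>t. indicator (- N) t * u n t) \<in> borel_measurable lebesgue" for n
      using u by measurable
  qed
  moreover have "AE t in lebesgue. indicator (- N) t * g t = g t"
    by (rule AE_I'[OF N(1)]) (auto simp: indicator_def)
  ultimately show ?thesis by (rule borel_measurable_lebesgue_AE_cong)
qed

section \<open>Strongly measurable functions with values in a normed space\<close>

context normed_mod begin

lemma strongly_measurable_cl: "strongly_measurable X f \<Longrightarrow> f t \<in> carrier X"
  by (auto simp: strongly_measurable_def)

lemma strongly_measurableD:
  assumes "strongly_measurable X f"
  shows "\<exists>s. (\<forall>n. simple_function lebesgue (s n)) \<and> (\<forall>n t. s n t \<in> carrier X) \<and> (AE t in lebesgue. tends X (\<lambda>n. s n t) (f t))"
  using assms unfolding strongly_measurable_def tends_def by (elim conjE exE) (intro exI conjI; auto simp: image_subset_iff)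

lemma strongly_measurableI:
  assumes "\<And>t. f t \<in> carrier X" "\<And>n. simple_function lebesgue (s n)" "\<And>n t. s n t \<in> carrier X"
    "AE t in lebesgue. tends X (\<lambda>n. s n t) (f t)"
  shows "strongly_measurable X f"
  unfolding strongly_measurable_def using assms by (intro conjI exI[of _ s]) (auto simp: tends_def)

text \<open>
  The simple function \<open>s n n\<close> takes at \<open>t\<close> the value \<open>\<sigma> j t\<close> for the last \<open>j \<le> n\<close> such that \<open>\<sigma> j t\<close> is among the
  first \<open>n\<close> values of \<open>\<sigma> j\<close>.
\<close>

lemma strongly_measurable_countably_valuedI:
  assumes f: "\<And>t. f t \<in> carrier X" and \<sigma>: "\<And>n. countably_valued (\<sigma> n)" "\<And>n t. \<sigma> n t \<in> carrier X"
    and lim: "AE t in lebesgue. tends X (\<lambda>n. \<sigma> n t) (f t)"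
  shows "strongly_measurable X f"
proof -
  define idx where "idx n t = to_nat_on (range (\<sigma> n)) (\<sigma> n t)" for n t
  define s where "s n m = rec_nat (\<lambda>t. if idx 0 t \<le> n then \<sigma> 0 t else \<zero>)
     (\<lambda>j h t. if idx (Suc j) t \<le> n then \<sigma> (Suc j) t else h t) m" for n m
  have s_simps: "s n 0 = (\<lambda>t. if idx 0 t \<le> n then \<sigma> 0 t else \<zero>)"
    "s n (Suc j) = (\<lambda>t. if idx (Suc j) t \<le> n then \<sigma> (Suc j) t else s n j t)" for n j
    unfolding s_def by simp_all
  have cvp: "countably_valued (\<lambda>t. if idx j t \<le> n then \<sigma> j t else h t)" if "countably_valued h" for j n h
    unfolding idx_def
    by (rule countably_valued_comp2[OF \<sigma>(1) that, of "\<lambda>a b. if to_nat_on (range (\<sigma> j)) a \<le> n then a else b"])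
  have cv: "countably_valued (s n m)" for n m
    by (induction m) (simp_all only: s_simps cvp countably_valued_const)
  have scl: "s n m t \<in> carrier X" for n m t by (induction m) (auto simp: s_simps \<sigma>(2))
  have finj: "finite {y \<in> range (\<sigma> j). to_nat_on (range (\<sigma> j)) y \<le> n}" for j n
  proof (rule finite_subset)
    show "{y \<in> range (\<sigma> j). to_nat_on (range (\<sigma> j)) y \<le> n} \<subseteq> from_nat_into (range (\<sigma> j)) ` {..n}"
    proof
      fix y assume y: "y \<in> {y \<in> range (\<sigma> j). to_nat_on (range (\<sigma> j)) y \<le> n}"
      then have "from_nat_into (range (\<sigma> j)) (to_nat_on (range (\<sigma> j)) y) = y"
        using \<sigma>(1)[of j] by (intro from_nat_into_to_nat_on) (auto simp: countably_valued_def)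
      then show "y \<in> from_nat_into (range (\<sigma> j)) ` {..n}" using y by (intro image_eqI[of _ _ "to_nat_on (range (\<sigma> j)) y"]) auto
    qed
  qed simp
  have fin: "finite (range (s n m))" for n m
  proof (induction m)
    case 0
    have "range (s n 0) \<subseteq> insert \<zero> {y \<in> range (\<sigma> 0). to_nat_on (range (\<sigma> 0)) y \<le> n}"
      by (auto simp: s_simps idx_def)
    then show ?case using finj[of 0 n] finite_subset by (metis finite_insert)
  next
    case (Suc m)
    have "range (s n (Suc m)) \<subseteq> range (s n m) \<union> {y \<in> range (\<sigma> (Suc m)). to_nat_on (range (\<sigma> (Suc m))) y \<le> n}"
      by (auto simp: s_simps idx_def)
    then show ?case using finj[of "Suc m" n] Suc finite_subset by (metis finite_Un)
  qed
  \<comment> \<open>Once the value of \<open>\<sigma> N\<close> at \<open>t\<close> is among the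
    first \<open>n\<close>, the selected index is at least \<open>N\<close>, since later admissible
    indices only replace it by larger ones. This makes the diagonal sequence converge.\<close>
  have sel: "\<exists>j\<ge>N. s n (N + d) t = \<sigma> j t" if "idx N t \<le> n" for n N d t
  proof (induction d)
    case 0 then show ?case using that by (cases N) (auto simp: s_simps)
  next
    case (Suc d)
    then obtain j where j: "j \<ge> N" "s n (N + d) t = \<sigma> j t" by blast
    show ?case
      using j by (cases "idx (Suc (N + d)) t \<le> n") (auto simp: s_simps intro: exI[of _ "Suc (N + d)"])
  qed
  show ?thesis
  proof (rule strongly_measurableI[OF f])
    show "simple_function lebesgue (s n n)" for n
      using fin[of n n] cv[of n n] by (auto simp: simple_function_def countably_valued_def)
    show "s n n t \<in> carrier X" for n t by (rule scl)
    show "AE t in lebesgue. tends X (\<lambda>n. s n n t) (f t)" using lim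
    proof eventually_elim
      case (elim t)
      show ?case unfolding tends_def
      proof (rule LIMSEQ_I)
        fix e :: real assume "e > 0"
        then obtain N where N: "\<And>j. j \<ge> N \<Longrightarrow> nrm X (\<sigma> j t \<ominus> f t) < e"
          using LIMSEQ_0_lessD[OF elim[unfolded tends_def]] by blast
        have "nrm X (s n n t \<ominus> f t) < e" if n: "n \<ge> max N (idx N t)" for n
        proof -
          obtain j where "j \<ge> N" "s n n t = \<sigma> j t" using sel[of N t n "n - N"] n by auto
          then show ?thesis using N by simp
        qed
        then show "\<exists>no. \<forall>n\<ge>no. norm (nrm X (s n n t \<ominus> f t) - 0) < e"
          using norm_ge0 scl f by (intro exI[of _ "max N (idx N t)"]) auto
      qed
    qed
  qed
qed

lemma strongly_measurable_norm:
  assumes "strongly_measurable X f" shows "(\<lambda>t. nrm X (f t)) \<in> borel_measurable lebesgue"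
proof -
  obtain s where s: "\<And>n. simple_function lebesgue (s n)" "\<And>n t. s n t \<in> carrier X"
    "AE t in lebesgue. tends X (\<lambda>n. s n t) (f t)" using strongly_measurableD[OF assms] by blast
  show ?thesis
  proof (rule borel_measurable_lebesgue_AE_LIMSEQ)
    show "(\<lambda>t. nrm X (s n t)) \<in> borel_measurable lebesgue" for n
      using simple_function_compose1[OF s(1)[of n], of "nrm X"] by (rule borel_measurable_simple_function)
    show "AE t in lebesgue. (\<lambda>n. nrm X (s n t)) \<longlonglongrightarrow> nrm X (f t)"
      using s(3)
    proof eventually_elim
      case (elim t)
      show ?case by (rule tends_norm[OF elim]) (use s(2) strongly_measurable_cl[OF assms] in auto)
    qed
  qed
qed

lemma strongly_measurable_simple:
  assumes "countably_valued f" "\<And>t. f t \<in> carrier X" shows "strongly_measurable X f"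
  by (rule strongly_measurable_countably_valuedI[of f "\<lambda>_. f"]) (use assms in \<open>auto simp: tends_def diff_self\<close>)

lemma strongly_measurable_add:
  assumes f: "strongly_measurable X f" and g: "strongly_measurable X g"
  shows "strongly_measurable X (\<lambda>t. f t \<oplus> g t)"
proof -
  obtain s where s: "\<And>n. simple_function lebesgue (s n)" "\<And>n t. s n t \<in> carrier X"
    "AE t in lebesgue. tends X (\<lambda>n. s n t) (f t)" using strongly_measurableD[OF f] by blast
  obtain r where r: "\<And>n. simple_function lebesgue (r n)" "\<And>n t. r n t \<in> carrier X"
    "AE t in lebesgue. tends X (\<lambda>n. r n t) (g t)" using strongly_measurableD[OF g] by blast
  show ?thesis
  proof (rule strongly_measurableI)
    show "f t \<oplus> g t \<in> carrier X" for t using f g strongly_measurable_cl by blast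
    show "simple_function lebesgue (\<lambda>t. s n t \<oplus> r n t)" for n
      by (rule simple_function_compose2[OF s(1) r(1)])
    show "s n t \<oplus> r n t \<in> carrier X" for n t using s(2) r(2) by blast
    show "AE t in lebesgue. tends X (\<lambda>n. s n t \<oplus> r n t) (f t \<oplus> g t)"
      using s(3) r(3)
    proof eventually_elim
      case (elim t)
      show ?case by (rule tends_add[OF elim])
        (use s(2) r(2) strongly_measurable_cl[OF f] strongly_measurable_cl[OF g] in auto)
    qed
  qed
qed

lemma strongly_measurable_scaled:
  assumes \<phi>: "\<phi> \<in> borel_measurable lebesgue" and x: "x \<in> carrier X"
  shows "strongly_measurable X (\<lambda>t. of_real (\<phi> t) \<odot> x)"
proof -
  obtain r where r: "\<And>n. simple_function lebesgue (r n)" "\<And>t. (\<lambda>n. r n t) \<longlonglongrightarrow> \<phi> t"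
    using borel_measurable_implies_sequence_metric[OF \<phi>, of 0] by auto
  show ?thesis
  proof (rule strongly_measurableI)
    show "simple_function lebesgue (\<lambda>t. of_real (r n t) \<odot> x)" for n
      by (rule simple_function_compose1[OF r(1)])
    have "nrm X (of_real a \<odot> x \<ominus> of_real b \<odot> x) = \<bar>a - b\<bar> * nrm X x" for a b
    proof -
      have "of_real a \<odot> x \<ominus> of_real b \<odot> x = of_real (a - b) \<odot> x" using x by (simp add: smult_minus_left)
      also have "nrm X \<dots> = \<bar>a - b\<bar> * nrm X x" by (subst norm_smult[OF x]) (simp only: norm_of_real)
      finally show ?thesis .
    qed
    moreover have "(\<lambda>n. \<bar>r n t - \<phi> t\<bar> * nrm X x) \<longlonglongrightarrow> 0" for t
      using tendsto_mult_left_zero[OF tendsto_rabs_zero[OF LIM_zero[OF r(2)]]] .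
    ultimately show "AE t in lebesgue. tends X (\<lambda>n. of_real (r n t) \<odot> x) (of_real (\<phi> t) \<odot> x)"
      by (simp add: tends_def)
  qed (use x in auto)
qed

text \<open>At each \<open>t\<close> the first simple function with sufficiently small relative
  error is selected. Finitely many values cannot achieve a relative error in general, so the result
  is only countably valued. Where \<open>f\<close> vanishes the error must be 0, and there the value
  \<zero> is prescribed.\<close>

lemma strongly_measurable_approx:
  assumes f: "strongly_measurable X f"
  shows "\<exists>\<sigma>. (\<forall>j. countably_valued (\<sigma> j)) \<and> (\<forall>j t. \<sigma> j t \<in> carrier X) \<and>
    (AE t in lebesgue. \<forall>j. nrm X (\<sigma> j t \<ominus> f t) \<le> (1/2)^j * nrm X (f t))"
proof -
  obtain s where s: "\<And>n. simple_function lebesgue (s n)" "\<And>n t. s n t \<in> carrier X"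
    "AE t in lebesgue. tends X (\<lambda>n. s n t) (f t)" using strongly_measurableD[OF f] by blast
  note fc = strongly_measurable_cl[OF f]
  define P where "P j k t \<longleftrightarrow> nrm X (s k t \<ominus> f t) \<le> (1/2)^j * nrm X (f t)" for j k t
  have sf: "strongly_measurable X (\<lambda>t. s k t \<ominus> f t)" for k
  proof -
    have "strongly_measurable X (\<lambda>t. (-1) \<odot> f t)"
    proof (rule strongly_measurableI)
      show "simple_function lebesgue (\<lambda>t. (-1) \<odot> s n t)" for n by (rule simple_function_compose1[OF s(1)])
      show "AE t in lebesgue. tends X (\<lambda>n. (-1) \<odot> s n t) ((-1) \<odot> f t)"
        using s(3)
      proof eventually_elim
        case (elim t)
        show ?case by (rule tends_smult[OF elim]) (use s(2) fc in auto)
      qed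
    qed (use fc s(2) in auto)
    moreover have "strongly_measurable X (s k)"
      by (rule strongly_measurable_simple[OF countably_valued_simple[OF s(1)] s(2)])
    ultimately have "strongly_measurable X (\<lambda>t. s k t \<oplus> (-1) \<odot> f t)" by (intro strongly_measurable_add)
    then show ?thesis using s(2) fc by (simp add: minus_smult)
  qed
  have Pm: "Measurable.pred lebesgue (P j k)" for j k
    unfolding P_def[abs_def] using strongly_measurable_norm[OF f] strongly_measurable_norm[OF sf[of k]] by measurable
  define \<kappa> where "\<kappa> j t = (LEAST k. P j k t)" for j t
  have km: "\<kappa> j \<in> measurable lebesgue (count_space UNIV)" for j
    unfolding \<kappa>_def[abs_def] by (rule measurable_Least[OF Pm])
  have Em: "{t. nrm X (f t) = 0} \<in> sets lebesgue"
  proof -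
    have "{t \<in> space lebesgue. nrm X (f t) = 0} \<in> sets lebesgue" using strongly_measurable_norm[OF f] by measurable
    then show ?thesis by simp
  qed
  define \<sigma> where "\<sigma> j t = (if t \<in> {t. nrm X (f t) = 0} then \<zero> else s (\<kappa> j t) t)" for j t
  have "countably_valued (\<sigma> j)" for j unfolding \<sigma>_def[abs_def]
    by (rule countably_valued_If[OF Em countably_valued_const countably_valued_select[OF km countably_valued_simple[OF s(1)]]])
  moreover have "\<sigma> j t \<in> carrier X" for j t using s(2) by (simp add: \<sigma>_def)
  moreover have "AE t in lebesgue. \<forall>j. nrm X (\<sigma> j t \<ominus> f t) \<le> (1/2)^j * nrm X (f t)"
    using s(3)
  proof eventually_elim
    case (elim t)
    show ?case
    proof
      fix j
      show "nrm X (\<sigma> j t \<ominus> f t) \<le> (1/2)^j * nrm X (f t)"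
      proof (cases "nrm X (f t) = 0")
        case True
        then have "f t = \<zero>" using norm_0_iff[OF fc] by blast
        then show ?thesis by (simp add: \<sigma>_def diff_self)
      next
        case False
        then have "(1/2)^j * nrm X (f t) > 0" using norm_ge0[OF fc, of t] by simp
        from LIMSEQ_0_lessD[OF elim[unfolded tends_def] this] obtain k where "P j k t"
          unfolding P_def by (meson less_imp_le order_refl)
        then have "P j (\<kappa> j t) t" unfolding \<kappa>_def by (rule LeastI)
        then show ?thesis using False by (simp add: \<sigma>_def P_def)
      qed
    qed
  qed
  ultimately show ?thesis by blast
qed

text \<open>Each \<open>f n\<close> is replaced by a countably valued function with relative error
  \<open>(1/2)^n\<close>. Since the norms of \<open>f n t\<close> converge, the absolute error tends
  to 0 and the replacements converge to \<open>g\<close>.\<close>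

lemma strongly_measurable_limit:
  assumes f: "\<And>n. strongly_measurable X (f n)" and g: "\<And>t. g t \<in> carrier X"
    and lim: "AE t in lebesgue. tends X (\<lambda>n. f n t) (g t)"
  shows "strongly_measurable X g"
proof -
  have "\<forall>n. \<exists>\<tau>. countably_valued \<tau> \<and> (\<forall>t. \<tau> t \<in> carrier X) \<and>
    (AE t in lebesgue. nrm X (\<tau> t \<ominus> f n t) \<le> (1/2)^n * nrm X (f n t))"
  proof
    fix n
    obtain \<sigma> where "\<And>j. countably_valued (\<sigma> j)" "\<And>j t. \<sigma> j t \<in> carrier X"
      "AE t in lebesgue. \<forall>j. nrm X (\<sigma> j t \<ominus> f n t) \<le> (1/2)^j * nrm X (f n t)"
      using strongly_measurable_approx[OF f[of n]] by blast
    then show "\<exists>\<tau>. countably_valued \<tau> \<and> (\<forall>t. \<tau> t \<in> carrier X) \<and>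
      (AE t in lebesgue. nrm X (\<tau> t \<ominus> f n t) \<le> (1/2)^n * nrm X (f n t))"
      by (intro exI[of _ "\<sigma> n"]) auto
  qed
  from choice[OF this] obtain \<tau> where \<tau>': "\<forall>n. countably_valued (\<tau> n) \<and> (\<forall>t. \<tau> n t \<in> carrier X) \<and>
    (AE t in lebesgue. nrm X (\<tau> n t \<ominus> f n t) \<le> (1/2)^n * nrm X (f n t))" by (rule exE)
  then have \<tau>: "\<And>n. countably_valued (\<tau> n)" "\<And>n t. \<tau> n t \<in> carrier X"
    "\<And>n. AE t in lebesgue. nrm X (\<tau> n t \<ominus> f n t) \<le> (1/2)^n * nrm X (f n t)"
    by (simp_all only:)
  note fc = strongly_measurable_cl[OF f]
  show ?thesis
  proof (rule strongly_measurable_countably_valuedI[OF g \<tau>(1,2)])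
    have "AE t in lebesgue. \<forall>n. nrm X (\<tau> n t \<ominus> f n t) \<le> (1/2)^n * nrm X (f n t)"
      using \<tau>(3) by (simp add: AE_all_countable)
    then show "AE t in lebesgue. tends X (\<lambda>n. \<tau> n t) (g t)" using lim
    proof eventually_elim
      case (elim t)
      show ?case
      proof (rule tends_cmp)
        show "nrm X (\<tau> n t \<ominus> g t) \<le> (1/2)^n * nrm X (f n t) + nrm X (f n t \<ominus> g t)" for n
          using norm_diff_triangle[OF \<tau>(2) fc g, of n t t n t] elim(1) by (meson add_right_mono order_trans)
        have "(\<lambda>n. nrm X (f n t)) \<longlonglongrightarrow> nrm X (g t)" by (rule tends_norm[OF elim(2)]) (use fc g in auto)
        then have "(\<lambda>n. (1/2)^n * nrm X (f n t)) \<longlonglongrightarrow> 0 * nrm X (g t)"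
          by (intro tendsto_mult LIMSEQ_realpow_zero) auto
        then show "(\<lambda>n. (1/2)^n * nrm X (f n t) + nrm X (f n t \<ominus> g t)) \<longlonglongrightarrow> 0"
          using tendsto_add[OF _ elim(2)[unfolded tends_def]] by fastforce
      qed (use \<tau>(2) g in auto)
    qed
  qed
qed

end

lemma (in op) strongly_measurable_op:
  assumes f: "strongly_measurable X f" shows "strongly_measurable Y (\<lambda>t. A (f t))"
proof -
  obtain s where s: "\<And>n. simple_function lebesgue (s n)" "\<And>n t. s n t \<in> carrier X"
    "AE t in lebesgue. tends X (\<lambda>n. s n t) (f t)" using X.strongly_measurableD[OF f] by blast
  note fc = X.strongly_measurable_cl[OF f]
  show ?thesis
  proof (rule Y.strongly_measurableI)
    show "simple_function lebesgue (\<lambda>t. A (s n t))" for n by (rule simple_function_compose1[OF s(1)])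
    show "AE t in lebesgue. tends Y (\<lambda>n. A (s n t)) (A (f t))"
      using s(3)
    proof eventually_elim
      case (elim t)
      show ?case by (rule tends[OF elim]) (use s(2) fc in auto)
    qed
  qed (use fc s(2) in auto)
qed

section \<open>Density of test functions\<close>

lemma powr_add_bound:
  fixes a b p :: real
  assumes "a \<ge> 0" "b \<ge> 0" "p > 0"
  shows "(a + b) powr p \<le> 2 powr p * (a powr p + b powr p)"
proof -
  have "(a + b) powr p \<le> (2 * max a b) powr p" using assms by (intro powr_mono2) auto
  also have "\<dots> = 2 powr p * max a b powr p" by (simp add: powr_mult)
  also have "max a b powr p \<le> a powr p + b powr p" by (simp add: max_def)
  finally show ?thesis by (simp add: mult_left_mono)
qed

lemma integral_powr_eq_0_imp_AE:
  fixes f :: "real \<Rightarrow> real"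
  assumes "integrable lebesgue (\<lambda>t. f t powr p)" "(LINT t|lebesgue. f t powr p) \<le> 0" "\<And>t. f t \<ge> 0"
  shows "AE t in lebesgue. f t = 0"
proof -
  have "(LINT t|lebesgue. f t powr p) = 0" using assms(2) by (simp add: order_antisym integral_nonneg)
  then have "AE t in lebesgue. f t powr p = 0"
    using integral_nonneg_eq_0_iff_AE[OF assms(1)] by simp
  then show ?thesis by eventually_elim simp
qed

section \<open>Spaces of p-integrable functions\<close>

context normed_mod begin

lemma Lp_sm: "f \<in> Lp p X \<Longrightarrow> strongly_measurable X f"
  and Lp_int: "f \<in> Lp p X \<Longrightarrow> integrable lebesgue (\<lambda>t. nrm X (f t) powr p)"
  by (auto simp: Lp_def)

lemma Lp_cl: "f \<in> Lp p X \<Longrightarrow> f t \<in> carrier X"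
  using Lp_sm strongly_measurable_cl by blast

lemma Lp_I:
  assumes f: "strongly_measurable X f" and b: "integrable lebesgue b" "AE t in lebesgue. nrm X (f t) powr p \<le> b t"
  shows "f \<in> Lp p X"
proof -
  have "integrable lebesgue (\<lambda>t. nrm X (f t) powr p)"
  proof (rule Bochner_Integration.integrable_bound[OF b(1)])
    show "(\<lambda>t. nrm X (f t) powr p) \<in> borel_measurable lebesgue"
      using strongly_measurable_norm[OF f] by measurable
    show "AE t in lebesgue. norm (nrm X (f t) powr p) \<le> norm (b t)"
      using b(2) by eventually_elim simp
  qed
  then show ?thesis using f by (simp add: Lp_def)
qed

lemma Lp_add:
  assumes p: "p > 0" and f: "f \<in> Lp p X" and g: "g \<in> Lp p X"
  shows "(\<lambda>t. f t \<oplus> g t) \<in> Lp p X"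
    "(LINT t|lebesgue. nrm X (f t \<oplus> g t) powr p) \<le> 2 powr p * ((LINT t|lebesgue. nrm X (f t) powr p) + (LINT t|lebesgue. nrm X (g t) powr p))"
proof -
  let ?b = "\<lambda>t. 2 powr p * (nrm X (f t) powr p + nrm X (g t) powr p)"
  have b: "integrable lebesgue ?b"
    by (intro integrable_mult_right Bochner_Integration.integrable_add Lp_int f g)
  have le: "nrm X (f t \<oplus> g t) powr p \<le> ?b t" for t
  proof -
    have "nrm X (f t \<oplus> g t) powr p \<le> (nrm X (f t) + nrm X (g t)) powr p"
      using norm_triangle[OF Lp_cl[OF f] Lp_cl[OF g], of t t] p norm_ge0 Lp_cl[OF f] Lp_cl[OF g]
      by (intro powr_mono2) auto
    also have "\<dots> \<le> ?b t" using norm_ge0 Lp_cl[OF f] Lp_cl[OF g] p by (intro powr_add_bound) auto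
    finally show ?thesis .
  qed
  show m: "(\<lambda>t. f t \<oplus> g t) \<in> Lp p X"
    by (rule Lp_I[OF strongly_measurable_add[OF Lp_sm[OF f] Lp_sm[OF g]] b]) (simp add: le)
  have "(LINT t|lebesgue. nrm X (f t \<oplus> g t) powr p) \<le> (LINT t|lebesgue. ?b t)"
    by (rule integral_mono[OF Lp_int[OF m] b le])
  also have "\<dots> = 2 powr p * ((LINT t|lebesgue. nrm X (f t) powr p) + (LINT t|lebesgue. nrm X (g t) powr p))"
    using Lp_int[OF f] Lp_int[OF g] by simp
  finally show "(LINT t|lebesgue. nrm X (f t \<oplus> g t) powr p) \<le> 2 powr p * ((LINT t|lebesgue. nrm X (f t) powr p) + (LINT t|lebesgue. nrm X (g t) powr p))" .
qed

lemma smult_op: "(\<lambda>x. a \<odot> x) \<in> bounded_ops X X"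
  by (rule bounded_opsI[of _ _ _ "norm a"]) (auto simp: smult_add_right smult_assoc norm_smult mult.commute)

end

lemma (in op) Lp_op:
  assumes p: "p > 0" and K: "K \<ge> 0" "\<And>x. x \<in> carrier X \<Longrightarrow> nrm Y (A x) \<le> K * nrm X x" and f: "f \<in> Lp p X"
  shows "(\<lambda>t. A (f t)) \<in> Lp p Y"
    "(LINT t|lebesgue. nrm Y (A (f t)) powr p) \<le> K powr p * (LINT t|lebesgue. nrm X (f t) powr p)"
proof -
  have b: "integrable lebesgue (\<lambda>t. K powr p * nrm X (f t) powr p)"
    by (intro integrable_mult_right X.Lp_int f)
  have le: "nrm Y (A (f t)) powr p \<le> K powr p * nrm X (f t) powr p" for t
  proof -
    have "nrm Y (A (f t)) powr p \<le> (K * nrm X (f t)) powr p"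
      using K X.Lp_cl[OF f] p Y.norm_ge0 by (intro powr_mono2) auto
    then show ?thesis by (simp add: powr_mult)
  qed
  show m: "(\<lambda>t. A (f t)) \<in> Lp p Y"
    by (rule Y.Lp_I[OF strongly_measurable_op[OF X.Lp_sm[OF f]] b]) (simp add: le)
  have "(LINT t|lebesgue. nrm Y (A (f t)) powr p) \<le> (LINT t|lebesgue. K powr p * nrm X (f t) powr p)"
    by (rule integral_mono[OF Y.Lp_int[OF m] b le])
  then show "(LINT t|lebesgue. nrm Y (A (f t)) powr p) \<le> K powr p * (LINT t|lebesgue. nrm X (f t) powr p)"
    by simp
qed

context normed_mod begin

lemma Lp_smult:
  assumes p: "p > 0" and f: "f \<in> Lp p X" shows "(\<lambda>t. a \<odot> f t) \<in> Lp p X"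
proof -
  interpret O: op X X "\<lambda>x. a \<odot> x" using smult_op by unfold_locales
  show ?thesis by (rule O.Lp_op(1)[OF p, of "norm a", OF _ _ f]) (auto simp: norm_smult)
qed

lemma Lp_diff:
  assumes p: "p > 0" and f: "f \<in> Lp p X" "g \<in> Lp p X" shows "(\<lambda>t. f t \<ominus> g t) \<in> Lp p X"
  using Lp_add(1)[OF p f(1) Lp_smult[OF p f(2), of "-1"]] Lp_cl[OF f(1)] Lp_cl[OF f(2)] by (simp add: minus_smult)

lemma Lp_bounded_support:
  assumes p: "p > 0" and f: "strongly_measurable X f" and B: "B \<ge> 0" "\<And>t. nrm X (f t) \<le> B * indicator {-R..R} t"
  shows "f \<in> Lp p X"
proof (rule Lp_I[OF f])
  show "integrable lebesgue (\<lambda>t. B powr p * indicator {-R..R} t)"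
    using lmeasurable_interval(1)[of "-R" R] by (intro integrable_mult_right) (simp add: fmeasurable_def)
  show "AE t in lebesgue. nrm X (f t) powr p \<le> B powr p * indicator {-R..R} t"
  proof (rule AE_I2)
    fix t :: real
    have "nrm X (f t) powr p \<le> (B * indicator {-R..R} t) powr p"
      using B p norm_ge0 strongly_measurable_cl[OF f] by (intro powr_mono2) auto
    then show "nrm X (f t) powr p \<le> B powr p * indicator {-R..R} t" by (auto simp: indicator_def)
  qed
qed

lemma Lp_test:
  assumes p: "p > 0" and \<phi>: "test_function \<phi>" and x: "x \<in> carrier X"
  shows "(\<lambda>t. of_real (\<phi> t) \<odot> x) \<in> Lp p X"
proof -
  obtain B R where B: "B \<ge> 0" "\<And>t. \<bar>\<phi> t\<bar> \<le> B * indicator {-R..R} t" using test_function_bounded[OF \<phi>] by blast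
  have "\<phi> \<in> borel_measurable borel" using test_function_continuous[OF \<phi>] by (rule borel_measurable_continuous_onI)
  then have "\<phi> \<in> borel_measurable lebesgue" by (simp add: measurable_completion)
  then have sm: "strongly_measurable X (\<lambda>t. of_real (\<phi> t) \<odot> x)" using x by (rule strongly_measurable_scaled)
  show ?thesis
  proof (rule Lp_bounded_support[OF p sm])
    show "B * nrm X x \<ge> 0" using B(1) norm_ge0[OF x] by simp
    fix t
    show "nrm X (of_real (\<phi> t) \<odot> x) \<le> B * nrm X x * indicator {-R..R} t"
      using mult_right_mono[OF B(2)[of t] norm_ge0[OF x]] x by (simp add: norm_smult mult_ac)
  qed
qed

text \<open>Density of the span of the functions \<open>\<phi> \<otimes> x\<close>, cast as an
  induction rule. Multiples of indicators of bounded sets come from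
  \<open>test_function_approx\<close>, simple functions with bounded support by sums, and the
  general case by dominated convergence.\<close>

lemma Lp_induct_test_functions:
  assumes p: "p > 0" and f: "f \<in> Lp p X"
    and test: "\<And>\<phi> x. test_function \<phi> \<Longrightarrow> x \<in> carrier X \<Longrightarrow> P (\<lambda>t. of_real (\<phi> t) \<odot> x)"
    and add: "\<And>f g. f \<in> Lp p X \<Longrightarrow> g \<in> Lp p X \<Longrightarrow> P f \<Longrightarrow> P g \<Longrightarrow> P (\<lambda>t. f t \<oplus> g t)"
    and lim: "\<And>u f. (\<And>n::nat. u n \<in> Lp p X) \<Longrightarrow> (\<And>n. P (u n)) \<Longrightarrow> f \<in> Lp p X \<Longrightarrow>
      (\<lambda>n. LINT t|lebesgue. nrm X (u n t \<ominus> f t) powr p) \<longlonglongrightarrow> 0 \<Longrightarrow> P f"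
  shows "P f"
proof -
  have ind_Lp: "(\<lambda>t. if t \<in> E then x else \<zero>) \<in> Lp p X"
    if E: "E \<in> sets lebesgue" "E \<subseteq> {-R..R}" and x: "x \<in> carrier X" for E R x
  proof (rule Lp_bounded_support[OF p _ norm_ge0[OF x]])
    show "strongly_measurable X (\<lambda>t. if t \<in> E then x else \<zero>)"
      by (rule strongly_measurable_simple[OF countably_valued_If[OF E(1) countably_valued_const countably_valued_const]]) (use x in auto)
    show "nrm X (if t \<in> E then x else \<zero>) \<le> nrm X x * indicator {-R..R} t" for t
      using E(2) norm_ge0[OF x] by (auto simp: indicator_def)
  qed
  have ind: "P (\<lambda>t. if t \<in> E then x else \<zero>)"
    if E: "E \<in> sets lebesgue" "E \<subseteq> {-R..R}" and x: "x \<in> carrier X" for E R x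
  proof -
    have bE: "bounded E" using E(2) by (rule bounded_subset[rotated]) simp
    have "\<forall>n. \<exists>q. test_function (fst q) \<and> (\<forall>t. 0 \<le> fst q t \<and> fst q t \<le> 1) \<and> snd q \<in> sets lebesgue \<and>
     emeasure lebesgue (snd q) < ennreal (1 / real (Suc n)) \<and> (\<forall>t. t \<notin> snd q \<longrightarrow> fst q t = indicator E t)"
    proof
      fix n
      have "1 / real (Suc n) > 0" by simp
      from test_function_approx[OF E(1) bE this] obtain \<phi> A where "test_function \<phi> \<and> (\<forall>t. 0 \<le> \<phi> t \<and> \<phi> t \<le> 1) \<and> A \<in> sets lebesgue \<and>
     emeasure lebesgue A < ennreal (1 / real (Suc n)) \<and> (\<forall>t. t \<notin> A \<longrightarrow> \<phi> t = indicator E t)" by (elim exE)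
      then show "\<exists>q. test_function (fst q) \<and> (\<forall>t. 0 \<le> fst q t \<and> fst q t \<le> 1) \<and> snd q \<in> sets lebesgue \<and>
     emeasure lebesgue (snd q) < ennreal (1 / real (Suc n)) \<and> (\<forall>t. t \<notin> snd q \<longrightarrow> fst q t = indicator E t)"
        by (intro exI[of _ "(\<phi>, A)"]) (unfold fst_conv snd_conv, assumption)
    qed
    from choice[OF this] obtain q where q: "\<forall>n. test_function (fst (q n)) \<and> (\<forall>t. 0 \<le> fst (q n) t \<and> fst (q n) t \<le> 1) \<and> snd (q n) \<in> sets lebesgue \<and>
     emeasure lebesgue (snd (q n)) < ennreal (1 / real (Suc n)) \<and> (\<forall>t. t \<notin> snd (q n) \<longrightarrow> fst (q n) t = indicator E t)" by (rule exE)
    define \<phi> A where "\<phi> n = fst (q n)" and "A n = snd (q n)" for n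
    have \<phi>: "test_function (\<phi> n)" "0 \<le> \<phi> n t" "\<phi> n t \<le> 1" "A n \<in> sets lebesgue"
      "emeasure lebesgue (A n) < ennreal (1 / real (Suc n))" "t \<notin> A n \<Longrightarrow> \<phi> n t = indicator E t" for n t
      using spec[OF q, of n] unfolding \<phi>_def A_def by blast+
    show ?thesis
    proof (rule lim)
      show "(\<lambda>t. of_real (\<phi> n t) \<odot> x) \<in> Lp p X" for n by (rule Lp_test[OF p \<phi>(1) x])
      show "P (\<lambda>t. of_real (\<phi> n t) \<odot> x)" for n by (rule test[OF \<phi>(1) x])
      show l: "(\<lambda>t. if t \<in> E then x else \<zero>) \<in> Lp p X" by (rule ind_Lp[OF E x])
      have bd: "(LINT t|lebesgue. nrm X (of_real (\<phi> n t) \<odot> x \<ominus> (if t \<in> E then x else \<zero>)) powr p) \<le> nrm X x powr p * (1 / real (Suc n))" for n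
      proof -
        have fin: "emeasure lebesgue (A n) < \<infinity>" using \<phi>(5)[of n] by (rule less_trans) simp
        have iA: "integrable lebesgue (\<lambda>t. nrm X x powr p * indicator (A n) t)"
          by (intro integrable_mult_right) (use \<phi>(4) fin in simp)
        have le: "nrm X (of_real (\<phi> n t) \<odot> x \<ominus> (if t \<in> E then x else \<zero>)) powr p \<le> nrm X x powr p * indicator (A n) t" for t
        proof -
          have "of_real (\<phi> n t) \<odot> x \<ominus> (if t \<in> E then x else \<zero>) = of_real (\<phi> n t - indicator E t) \<odot> x"
            using x by (auto simp: smult_minus_left diff_zero)
          then have e: "nrm X (of_real (\<phi> n t) \<odot> x \<ominus> (if t \<in> E then x else \<zero>)) = \<bar>\<phi> n t - indicator E t\<bar> * nrm X x"
            using x by (simp only: norm_smult norm_of_real)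
          show ?thesis
          proof (cases "t \<in> A n")
            case True
            have "\<bar>\<phi> n t - indicator E t\<bar> \<le> 1" using \<phi>(2,3)[of n t] by (auto simp: indicator_def)
            then have "\<bar>\<phi> n t - indicator E t\<bar> * nrm X x \<le> nrm X x"
              using mult_right_mono[of "\<bar>\<phi> n t - indicator E t\<bar>" 1 "nrm X x"] norm_ge0[OF x] by simp
            then show ?thesis unfolding e using True p norm_ge0[OF x] by (simp add: powr_mono2)
          next
            case False
            then show ?thesis unfolding e using \<phi>(6)[OF False] by simp
          qed
        qed
        have "(LINT t|lebesgue. nrm X (of_real (\<phi> n t) \<odot> x \<ominus> (if t \<in> E then x else \<zero>)) powr p) \<le> (LINT t|lebesgue. nrm X x powr p * indicator (A n) t)"
          by (rule integral_mono[OF Lp_int[OF Lp_diff[OF p Lp_test[OF p \<phi>(1) x] l]] iA le])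
        also have "\<dots> = nrm X x powr p * measure lebesgue (A n)" using \<phi>(4) fin by simp
        also have "\<dots> \<le> nrm X x powr p * (1 / real (Suc n))"
        proof (rule mult_left_mono)
          have "emeasure lebesgue (A n) = ennreal (measure lebesgue (A n))" using fin by (intro emeasure_eq_ennreal_measure) auto
          then have "ennreal (measure lebesgue (A n)) \<le> ennreal (1 / real (Suc n))" using \<phi>(5)[of n] by (simp add: less_imp_le)
          then show "measure lebesgue (A n) \<le> 1 / real (Suc n)" by (subst (asm) ennreal_le_iff) auto
        qed simp
        finally show ?thesis .
      qed
      show "(\<lambda>n. LINT t|lebesgue. nrm X (of_real (\<phi> n t) \<odot> x \<ominus> (if t \<in> E then x else \<zero>)) powr p) \<longlonglongrightarrow> 0"
      proof (rule Lim_null_comparison[OF always_eventually])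
        show "\<forall>n. norm (LINT t|lebesgue. nrm X (of_real (\<phi> n t) \<odot> x \<ominus> (if t \<in> E then x else \<zero>)) powr p) \<le> nrm X x powr p * (1 / real (Suc n))"
          using bd by (simp add: integral_nonneg)
        show "(\<lambda>n. nrm X x powr p * (1 / real (Suc n))) \<longlonglongrightarrow> 0"
          using tendsto_mult_right_zero[OF LIMSEQ_inverse_real_of_nat, of "nrm X x powr p"] by (simp only: inverse_eq_divide)
      qed
    qed
  qed
  have simp_Lp: "s \<in> Lp p X" if s: "finite (range s)" "countably_valued s" "\<And>t. s t \<in> carrier X" "\<And>t. t \<notin> {-R..R} \<Longrightarrow> s t = \<zero>" for s R
  proof (rule Lp_bounded_support[OF p strongly_measurable_simple[OF s(2,3)]])
    have "nrm X (s t) \<le> Max (nrm X ` range s)" for t using s(1) by (intro Max_ge) auto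
    moreover from this[of 0] show "Max (nrm X ` range s) \<ge> 0" using norm_ge0[OF s(3), of 0] by linarith
    ultimately show "nrm X (s t) \<le> Max (nrm X ` range s) * indicator {-R..R} t" for t
      using s(4)[of t] by (cases "t \<in> {-R..R}") auto
  qed
  \<comment> \<open>Induction on the set of nonzero values: the part of \<open>s\<close> on the
    fibre of one value \<open>v\<close> is a multiple of an indicator, and the remainder takes fewer
    values.\<close>
  have simp_P: "\<forall>s. range s \<subseteq> insert \<zero> F \<longrightarrow> countably_valued s \<longrightarrow> (\<forall>t. t \<notin> {-R..R} \<longrightarrow> s t = \<zero>) \<longrightarrow> P s"
    if "finite F" "F \<subseteq> carrier X" for F R
    using that
  proof (induction F rule: finite_induct)
    case empty
    show ?case
    proof (intro allI impI)
      fix s :: "real \<Rightarrow> 'a" assume "range s \<subseteq> {\<zero>}"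
      then have "s = (\<lambda>t. if t \<in> {} then \<zero> else \<zero>)" by auto
      then show "P s" using ind[of "{}" 0 "\<zero>"] by simp
    qed
  next
    case (insert v F)
    have IH: "P s" if "range s \<subseteq> insert \<zero> F" "countably_valued s" "\<forall>t. t \<notin> {-R..R} \<longrightarrow> s t = \<zero>" for s
      using insert.IH insert.prems that by simp
    show ?case
    proof (intro allI impI)
      fix s assume s: "range s \<subseteq> insert \<zero> (insert v F)" "countably_valued s" "\<forall>t. t \<notin> {-R..R} \<longrightarrow> s t = \<zero>"
      show "P s"
      proof (cases "v = \<zero>")
        case True then show ?thesis using IH s by auto
      next
        case False
        have v: "v \<in> carrier X" using insert.prems by simp
        have sc: "s t \<in> carrier X" for t using subsetD[OF s(1) rangeI, of t] insert.prems by auto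
        define E where "E = s -` {v}"
        have E: "E \<in> sets lebesgue" unfolding E_def by (rule countably_valued_measurable[OF s(2)])
        have ER: "E \<subseteq> {-R..R}" using s(3) False unfolding E_def by auto
        define g where "g t = (if t \<in> E then \<zero> else s t)" for t
        have g1: "range g \<subseteq> insert \<zero> F" using s(1) by (auto simp: g_def E_def)
        have g2: "countably_valued g" unfolding g_def[abs_def] by (rule countably_valued_If[OF E countably_valued_const s(2)])
        have g3: "\<forall>t. t \<notin> {-R..R} \<longrightarrow> g t = \<zero>" using s(3) by (simp add: g_def)
        have gL: "g \<in> Lp p X"
          by (rule simp_Lp[OF finite_subset[OF g1] g2, of R]) (use insert.hyps g3 sc in \<open>auto simp: g_def\<close>)
        have "P (\<lambda>t. g t \<oplus> (if t \<in> E then v else \<zero>))"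
          by (rule add[OF gL ind_Lp[OF E ER v] IH[OF g1 g2 g3] ind[OF E ER v]])
        moreover have "(\<lambda>t. g t \<oplus> (if t \<in> E then v else \<zero>)) = s" using sc v by (auto simp: g_def E_def)
        ultimately show ?thesis by simp
      qed
    qed
  qed
  note fc = Lp_cl[OF f]
  obtain s where s: "\<And>n. simple_function lebesgue (s n)" "\<And>n t. s n t \<in> carrier X"
    "AE t in lebesgue. tends X (\<lambda>n. s n t) (f t)" using strongly_measurableD[OF Lp_sm[OF f]] by blast
  \<comment> \<open>Cutting to \<open>E n\<close> bounds the support and keeps the norm below twice
    that of \<open>f\<close>, hence the error below \<open>3 * nrm X (f t)\<close>, the dominating
    function. A point where \<open>f\<close> is nonzero and the simple functions converge eventually
    lies in every \<open>E n\<close>; where \<open>f\<close> vanishes, so does the cut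
    function.\<close>
  define E where "E n = {t. nrm X (s n t) \<le> 2 * nrm X (f t)} \<inter> {- real n..real n}" for n
  have E: "E n \<in> sets lebesgue" for n
  proof -
    have "{t \<in> space lebesgue. nrm X (s n t) \<le> 2 * nrm X (f t)} \<in> sets lebesgue"
      using strongly_measurable_norm[OF Lp_sm[OF f]]
        strongly_measurable_norm[OF strongly_measurable_simple[OF countably_valued_simple[OF s(1)] s(2)], of n] by measurable
    moreover have "{- real n..real n} \<in> sets lebesgue" by simp
    ultimately show ?thesis unfolding E_def by (metis (no_types, lifting) Collect_cong UNIV_I sets.Int space_completion space_lborel space_borel)
  qed
  define u where "u n t = (if t \<in> E n then s n t else \<zero>)" for n t
  have uc: "u n t \<in> carrier X" for n t using s(2) by (simp add: u_def)
  have ucv: "countably_valued (u n)" for n unfolding u_def[abs_def]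
    by (rule countably_valued_If[OF E countably_valued_simple[OF s(1)] countably_valued_const])
  have ufin: "finite (range (u n))" for n
  proof (rule finite_subset)
    show "range (u n) \<subseteq> insert \<zero> (range (s n))" by (auto simp: u_def)
    show "finite (insert \<zero> (range (s n)))" using simple_functionD(1)[OF s(1)[of n]] by simp
  qed
  have usup: "u n t = \<zero>" if "t \<notin> {- real n..real n}" for n t using that by (auto simp: u_def E_def)
  have uL: "u n \<in> Lp p X" for n by (rule simp_Lp[OF ufin ucv uc usup])
  show "P f"
  proof (rule lim[OF uL _ f])
    show "P (u n)" for n
      using simp_P[OF ufin[of n], of "real n"] uc ucv usup by blast
    have u2: "nrm X (u n t) \<le> 2 * nrm X (f t)" for n t using norm_ge0[OF fc, of t] by (simp add: u_def E_def)
    have "(\<lambda>n. LINT t|lebesgue. nrm X (u n t \<ominus> f t) powr p) \<longlonglongrightarrow> integral\<^sup>L lebesgue (\<lambda>t::real. 0)"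
    proof (rule integral_dominated_convergence[where w = "\<lambda>t. 3 powr p * nrm X (f t) powr p"])
      show "(\<lambda>t. nrm X (u n t \<ominus> f t) powr p) \<in> borel_measurable lebesgue" for n
        using Lp_int[OF Lp_diff[OF p uL f]] by (rule borel_measurable_integrable)
      show "integrable lebesgue (\<lambda>t. 3 powr p * nrm X (f t) powr p)" by (intro integrable_mult_right Lp_int f)
      show "AE t in lebesgue. norm (nrm X (u n t \<ominus> f t) powr p) \<le> 3 powr p * nrm X (f t) powr p" for n
      proof (rule AE_I2)
        fix t
        have "nrm X (u n t \<ominus> f t) \<le> 3 * nrm X (f t)" using norm_diff_le[OF uc fc, of n t t] u2[of n t] by simp
        then have "nrm X (u n t \<ominus> f t) powr p \<le> (3 * nrm X (f t)) powr p"
          using norm_ge0[of "u n t \<ominus> f t"] uc fc p by (intro powr_mono2) auto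
        then show "norm (nrm X (u n t \<ominus> f t) powr p) \<le> 3 powr p * nrm X (f t) powr p" by (simp add: powr_mult)
      qed
      show "AE t in lebesgue. (\<lambda>n. nrm X (u n t \<ominus> f t) powr p) \<longlonglongrightarrow> 0"
        using s(3)
      proof eventually_elim
        case (elim t)
        have "(\<lambda>n. nrm X (u n t \<ominus> f t)) \<longlonglongrightarrow> 0"
        proof (cases "nrm X (f t) = 0")
          case True
          then have "u n t = f t" for n
            using u2[of n t] norm_ge0[OF uc, of n t] norm_0_iff[OF uc, of n t] norm_0_iff[OF fc, of t] by auto
          then show ?thesis using fc by (simp add: diff_self)
        next
          case False
          then have fp: "nrm X (f t) > 0" using norm_ge0[OF fc, of t] by simp
          have "(\<lambda>n. nrm X (s n t)) \<longlonglongrightarrow> nrm X (f t)" by (rule tends_norm[OF elim]) (use s(2) fc in auto)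
          then have "\<forall>\<^sub>F n in sequentially. nrm X (s n t) < 2 * nrm X (f t)" using fp by (intro order_tendstoD) auto
          moreover have "\<forall>\<^sub>F n in sequentially. \<bar>t\<bar> \<le> real n"
            using eventually_ge_at_top[of "nat \<lceil>\<bar>t\<bar>\<rceil>"] by eventually_elim linarith
          ultimately have "\<forall>\<^sub>F n in sequentially. nrm X (s n t \<ominus> f t) = nrm X (u n t \<ominus> f t)"
          proof eventually_elim
            case (elim n)
            then have "t \<in> E n" by (auto simp: E_def)
            then show ?case by (simp add: u_def)
          qed
          with elim[unfolded tends_def] show ?thesis by (rule Lim_transform_eventually)
        qed
        then have "(\<lambda>n. nrm X (u n t \<ominus> f t) powr p) \<longlonglongrightarrow> 0 powr p"
          using p norm_ge0 uc fc by (intro tendsto_powr2 tendsto_const always_eventually) auto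
        then show ?case by simp
      qed
    qed auto
    then show "(\<lambda>n. LINT t|lebesgue. nrm X (u n t \<ominus> f t) powr p) \<longlonglongrightarrow> 0" by simp
  qed
qed

end

text \<open>The data in \<open>UMD\<close> for one exponent, with the bound stated for p-th powers
  of norms, the form that can be summed over coordinates. The exceptional null sets may depend on
  the functions involved.\<close>

locale Lp_hilbert = normed_mod X for X :: "('k::real_or_complex, 'a) normed_module" (structure) +
  fixes p :: real and H :: "(real \<Rightarrow> 'a) \<Rightarrow> real \<Rightarrow> 'a" and K :: real
  assumes p1: "p > 1" and H_Lp: "f \<in> Lp p X \<Longrightarrow> H f \<in> Lp p X"
    and H_add: "f \<in> Lp p X \<Longrightarrow> g \<in> Lp p X \<Longrightarrow> AE t in lebesgue. H (\<lambda>s. f s \<oplus> g s) t = H f t \<oplus> H g t"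
    and H_smult: "f \<in> Lp p X \<Longrightarrow> AE t in lebesgue. H (\<lambda>s. a \<odot> f s) t = a \<odot> H f t"
    and K0: "K \<ge> 0"
    and H_bound: "f \<in> Lp p X \<Longrightarrow> (LINT t|lebesgue. nrm X (H f t) powr p) \<le> K * (LINT t|lebesgue. nrm X (f t) powr p)"
    and H_test: "test_function \<phi> \<Longrightarrow> x \<in> carrier X \<Longrightarrow>
      AE t in lebesgue. H (\<lambda>s. of_real (\<phi> s) \<odot> x) t = of_real (hilbert_transform \<phi> t) \<odot> x"
begin

lemma H_diff:
  assumes f: "f \<in> Lp p X" and g: "g \<in> Lp p X"
  shows "AE t in lebesgue. H (\<lambda>s. f s \<ominus> g s) t = H f t \<ominus> H g t"
proof -
  have p0: "p > 0" using p1 by simp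
  have e: "(\<lambda>s. f s \<ominus> g s) = (\<lambda>s. f s \<oplus> (-1) \<odot> g s)" using Lp_cl[OF f] Lp_cl[OF g] by (simp add: minus_smult)
  show ?thesis unfolding e using H_add[OF f Lp_smult[OF p0 g, of "-1"]] H_smult[OF g, of "-1"]
  proof eventually_elim
    case (elim t)
    then show ?case using Lp_cl[OF H_Lp[OF f]] Lp_cl[OF H_Lp[OF g]] by (simp add: minus_smult)
  qed
qed

text \<open>On \<open>\<phi> \<otimes> x\<close> both sides are the scalar transform of \<phi> times
  \<open>A x\<close>. The commutator of \<open>H\<close> and \<open>A\<close> is additive and
  continuous, so it vanishes on all of L^p by density.\<close>

lemma H_commute:
  assumes A: "A \<in> bounded_ops X X" and f: "f \<in> Lp p X"
  shows "AE t in lebesgue. H (\<lambda>s. A (f s)) t = A (H f t)"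
proof -
  have p0: "p > 0" using p1 by simp
  interpret O: op X X A using A by unfold_locales
  obtain M where M: "M > 0" "\<And>x. x \<in> carrier X \<Longrightarrow> nrm X (A x) \<le> M * nrm X x" using O.bound by blast
  have AL: "(\<lambda>t. A (f t)) \<in> Lp p X"
    "(LINT t|lebesgue. nrm X (A (f t)) powr p) \<le> M powr p * (LINT t|lebesgue. nrm X (f t) powr p)" if "f \<in> Lp p X" for f
    by (rule O.Lp_op[OF p0 less_imp_le[OF M(1)] _ that], rule M(2), assumption)+
  show ?thesis
  proof (rule Lp_induct_test_functions[OF p0 f, where P = "\<lambda>f. AE t in lebesgue. H (\<lambda>s. A (f s)) t = A (H f t)"])
    fix \<phi> x assume \<phi>: "test_function \<phi>" and x: "x \<in> carrier X"
    have e: "(\<lambda>s. A (of_real (\<phi> s) \<odot> x)) = (\<lambda>s. of_real (\<phi> s) \<odot> A x)" using x by (simp add: O.smult)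
    show "AE t in lebesgue. H (\<lambda>s. A (of_real (\<phi> s) \<odot> x)) t = A (H (\<lambda>s. of_real (\<phi> s) \<odot> x) t)"
      using H_test[OF \<phi> O.cl[OF x]] H_test[OF \<phi> x] unfolding e by eventually_elim (simp add: O.smult x)
  next
    fix f g assume f: "f \<in> Lp p X" and g: "g \<in> Lp p X"
      and Pf: "AE t in lebesgue. H (\<lambda>s. A (f s)) t = A (H f t)" and Pg: "AE t in lebesgue. H (\<lambda>s. A (g s)) t = A (H g t)"
    have e: "(\<lambda>s. A (f s \<oplus> g s)) = (\<lambda>s. A (f s) \<oplus> A (g s))" using Lp_cl[OF f] Lp_cl[OF g] by (simp add: O.add)
    show "AE t in lebesgue. H (\<lambda>s. A (f s \<oplus> g s)) t = A (H (\<lambda>t. f t \<oplus> g t) t)"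
      unfolding e using Pf Pg H_add[OF f g] H_add[OF AL(1)[OF f] AL(1)[OF g]]
      by eventually_elim (simp add: O.add Lp_cl[OF H_Lp[OF f]] Lp_cl[OF H_Lp[OF g]])
  next
    fix u :: "nat \<Rightarrow> real \<Rightarrow> 'a" and f
    assume u: "\<And>n. u n \<in> Lp p X" and Pu: "\<And>n. AE t in lebesgue. H (\<lambda>s. A (u n s)) t = A (H (u n) t)"
      and f: "f \<in> Lp p X" and lim: "(\<lambda>n. LINT t|lebesgue. nrm X (u n t \<ominus> f t) powr p) \<longlonglongrightarrow> 0"
    define D where "D t = H (\<lambda>s. A (f s)) t \<ominus> A (H f t)" for t
    have DL: "D \<in> Lp p X" unfolding D_def[abs_def] by (intro Lp_diff p0 H_Lp AL f)
    have bd: "(LINT t|lebesgue. nrm X (D t) powr p) \<le> 2 powr p * (2 * (M powr p * K)) * (LINT t|lebesgue. nrm X (u n t \<ominus> f t) powr p)" for n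
    proof -
      define v where "v t = u n t \<ominus> f t" for t
      have v: "v \<in> Lp p X" unfolding v_def[abs_def] by (intro Lp_diff p0 u f)
      have HAv: "(\<lambda>t. (-1) \<odot> H (\<lambda>s. A (v s)) t) \<in> Lp p X" by (intro Lp_smult p0 H_Lp AL v)
      have AHv: "(\<lambda>t. A (H v t)) \<in> Lp p X" by (intro H_Lp AL v)
      have e: "(\<lambda>s. A (v s)) = (\<lambda>s. A (u n s) \<ominus> A (f s))" using Lp_cl[OF u] Lp_cl[OF f] by (simp add: v_def O.diff)
      \<comment> \<open>The commutator vanishes at \<open>u n\<close>, so its value at
        \<open>f\<close> is minus its value at \<open>v = u n - f\<close>, whose norm tends to
        0.\<close>
      have "AE t in lebesgue. D t = A (H v t) \<oplus> (-1) \<odot> H (\<lambda>s. A (v s)) t"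
        unfolding e using Pu[of n] H_diff[OF u f, of n, folded v_def] H_diff[OF AL(1)[OF u] AL(1)[OF f], of n]
      proof eventually_elim
        case (elim t)
        have c: "A (H (u n) t) \<in> carrier X" "A (H f t) \<in> carrier X" "H (\<lambda>s. A (f s)) t \<in> carrier X"
          "H (u n) t \<in> carrier X" "H f t \<in> carrier X"
          by (rule Lp_cl[OF AL(1)[OF H_Lp[OF u]]] Lp_cl[OF AL(1)[OF H_Lp[OF f]]] Lp_cl[OF H_Lp[OF AL(1)[OF f]]]
            Lp_cl[OF H_Lp[OF u]] Lp_cl[OF H_Lp[OF f]])+
        have "A (H v t) \<oplus> (-1) \<odot> H (\<lambda>s. A (u n s) \<ominus> A (f s)) t
          = (A (H (u n) t) \<ominus> A (H f t)) \<ominus> (A (H (u n) t) \<ominus> H (\<lambda>s. A (f s)) t)"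
          unfolding elim(2) elim(3) elim(1) using c by (simp add: O.add O.smult minus_smult)
        also have "\<dots> = H (\<lambda>s. A (f s)) t \<ominus> A (H f t)"
        proof -
          have "(A (H (u n) t) \<ominus> A (H f t)) = (A (H (u n) t) \<ominus> H (\<lambda>s. A (f s)) t) \<oplus> (H (\<lambda>s. A (f s)) t \<ominus> A (H f t))"
            using c by (intro diff_split)
          then show ?thesis using c
            by (simp add: M.a_comm[of "A (H (u n) t) \<ominus> H (\<lambda>s. A (f s)) t"] add_diff_cancel)
        qed
        finally show ?case by (simp add: D_def)
      qed
      then have "(LINT t|lebesgue. nrm X (D t) powr p) = (LINT t|lebesgue. nrm X (A (H v t) \<oplus> (-1) \<odot> H (\<lambda>s. A (v s)) t) powr p)"
        using Lp_int[OF DL] Lp_int[OF Lp_add(1)[OF p0 AHv HAv]]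
        by (intro integral_cong_AE borel_measurable_integrable) (auto elim!: eventually_mono)
      also have "\<dots> \<le> 2 powr p * ((LINT t|lebesgue. nrm X (A (H v t)) powr p) + (LINT t|lebesgue. nrm X ((-1) \<odot> H (\<lambda>s. A (v s)) t) powr p))"
        by (rule Lp_add(2)[OF p0 AHv HAv])
      also have "\<dots> \<le> 2 powr p * (M powr p * (K * (LINT t|lebesgue. nrm X (v t) powr p)) + K * (M powr p * (LINT t|lebesgue. nrm X (v t) powr p)))"
      proof (intro mult_left_mono add_mono)
        show "(LINT t|lebesgue. nrm X (A (H v t)) powr p) \<le> M powr p * (K * (LINT t|lebesgue. nrm X (v t) powr p))"
          by (rule order_trans[OF AL(2)[OF H_Lp[OF v]]]) (intro mult_left_mono H_bound v; simp)
        have "(LINT t|lebesgue. nrm X ((-1) \<odot> H (\<lambda>s. A (v s)) t) powr p) = (LINT t|lebesgue. nrm X (H (\<lambda>s. A (v s)) t) powr p)"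
          using Lp_cl[OF H_Lp[OF AL(1)[OF v]]] by (simp add: norm_smult)
        also have "\<dots> \<le> K * (LINT t|lebesgue. nrm X (A (v t)) powr p)" by (rule H_bound[OF AL(1)[OF v]])
        also have "\<dots> \<le> K * (M powr p * (LINT t|lebesgue. nrm X (v t) powr p))" by (intro mult_left_mono AL(2) v K0)
        finally show "(LINT t|lebesgue. nrm X ((-1) \<odot> H (\<lambda>s. A (v s)) t) powr p) \<le> K * (M powr p * (LINT t|lebesgue. nrm X (v t) powr p))" .
      qed simp
      also have "\<dots> = 2 powr p * (2 * (M powr p * K)) * (LINT t|lebesgue. nrm X (u n t \<ominus> f t) powr p)"
        by (simp add: v_def algebra_simps)
      finally show ?thesis .
    qed
    have "(LINT t|lebesgue. nrm X (D t) powr p) \<le> 0"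
    proof (rule LIMSEQ_le_const)
      show "(\<lambda>n. 2 powr p * (2 * (M powr p * K)) * (LINT t|lebesgue. nrm X (u n t \<ominus> f t) powr p)) \<longlonglongrightarrow> 0"
        by (rule tendsto_mult_right_zero[OF lim])
    qed (use bd in blast)
    from integral_powr_eq_0_imp_AE[OF Lp_int[OF DL] this] have "AE t in lebesgue. nrm X (D t) = 0"
      using norm_ge0 Lp_cl[OF DL] by simp
    then show "AE t in lebesgue. H (\<lambda>s. A (f s)) t = A (H f t)"
    proof eventually_elim
      case (elim t)
      have c: "A (H f t) \<in> carrier X" "H (\<lambda>s. A (f s)) t \<in> carrier X"
        by (rule Lp_cl[OF AL(1)[OF H_Lp[OF f]]] Lp_cl[OF H_Lp[OF AL(1)[OF f]]])+
      then show ?case using elim norm_0_iff[OF Lp_cl[OF DL], of t] minus_eq_0_iff[of "H (\<lambda>s. A (f s)) t" "A (H f t)"] by (simp add: D_def)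
    qed
  qed
qed

end

section \<open>The UMD property\<close>

text \<open>Raising the norm inequality to the p-th power turns \<open>C\<close> into
  \<open>\<bar>C\<bar> powr p\<close>; the absolute value covers an arbitrary sign of
  \<open>C\<close>.\<close>

lemma UMD_Lp_hilbert:
  fixes X :: "('k::real_or_complex, 'a) normed_module"
  assumes "banach_space X" "UMD X"
  shows "\<exists>p H K. Lp_hilbert X p H K"
proof -
  interpret banach_space X by fact
  from assms(2)[unfolded UMD_def] obtain p H C where p: "p > 1" and H: "H \<in> Lp p X \<rightarrow> Lp p X"
    and add: "\<forall>f\<in>Lp p X. \<forall>g\<in>Lp p X. AE t in lebesgue. H (\<lambda>s. f s \<oplus>\<^bsub>X\<^esub> g s) t = H f t \<oplus>\<^bsub>X\<^esub> H g t"
    and sm: "\<forall>a. \<forall>f\<in>Lp p X. AE t in lebesgue. H (\<lambda>s. a \<odot>\<^bsub>X\<^esub> f s) t = a \<odot>\<^bsub>X\<^esub> H f t"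
    and bd: "\<forall>f\<in>Lp p X. Lp_norm p X (H f) \<le> C * Lp_norm p X f"
    and test: "\<forall>\<phi>. \<forall>x\<in>carrier X. test_function \<phi> \<longrightarrow>
        (AE t in lebesgue. H (\<lambda>s. of_real (\<phi> s) \<odot>\<^bsub>X\<^esub> x) t = of_real (hilbert_transform \<phi> t) \<odot>\<^bsub>X\<^esub> x)"
    by (elim exE conjE)
  have "Lp_hilbert X p H (\<bar>C\<bar> powr p)"
  proof (intro Lp_hilbert.intro Lp_hilbert_axioms.intro normed_mod_axioms)
    fix f assume f: "f \<in> Lp p X"
    define I where "I g = (LINT t|lebesgue. nrm X (g t) powr p)" for g :: "real \<Rightarrow> 'a"
    have I0: "I g \<ge> 0" for g by (simp add: I_def integral_nonneg)
    have "I (H f) powr (1/p) \<le> C * I f powr (1/p)" using bspec[OF bd f] by (simp add: Lp_norm_def I_def)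
    also have "\<dots> \<le> \<bar>C\<bar> * I f powr (1/p)" by (intro mult_right_mono) auto
    finally have "(I (H f) powr (1/p)) powr p \<le> (\<bar>C\<bar> * I f powr (1/p)) powr p" using p by (intro powr_mono2) auto
    then have "I (H f) \<le> \<bar>C\<bar> powr p * I f" using p I0 by (simp add: powr_mult powr_powr)
    then show "(LINT t|lebesgue. nrm X (H f t) powr p) \<le> \<bar>C\<bar> powr p * (LINT t|lebesgue. nrm X (f t) powr p)"
      by (simp only: I_def)
    show "AE t in lebesgue. H (\<lambda>s. a \<odot>\<^bsub>X\<^esub> f s) t = a \<odot>\<^bsub>X\<^esub> H f t" for a using sm f by blast
    show "H f \<in> Lp p X" using H f by blast
    show "AE t in lebesgue. H (\<lambda>s. f s \<oplus>\<^bsub>X\<^esub> g s) t = H f t \<oplus>\<^bsub>X\<^esub> H g t" if "g \<in> Lp p X" for g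
      using add f that by blast
  qed (use p test in auto)
  then show ?thesis by blast
qed

lemma (in normed_mod) Lp_nn_finite:
  assumes "strongly_measurable X f" "(\<integral>\<^sup>+t. ennreal (nrm X (f t) powr p) \<partial>lebesgue) < \<infinity>"
  shows "f \<in> Lp p X"
proof -
  have "integrable lebesgue (\<lambda>t. nrm X (f t) powr p)"
    using strongly_measurable_norm[OF assms(1)] assms(2) by (intro integrableI_nonneg) (auto intro!: measurable)
  then show ?thesis using assms(1) by (simp add: Lp_def)
qed

lemma (in normed_mod) Lp_nn_integral:
  "f \<in> Lp p X \<Longrightarrow> (\<integral>\<^sup>+t. ennreal (nrm X (f t) powr p) \<partial>lebesgue) = ennreal (LINT t|lebesgue. nrm X (f t) powr p)"
  by (intro nn_integral_eq_integral Lp_int) auto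

locale group_extension_hilbert = group_extension X T t0 c p w + Lp_hilbert X p H K
  for X :: "('k::real_or_complex, 'a) normed_module" (structure) and T t0 c p w H K
begin

section \<open>Coordinate families as elements of L^p(R; Z)\<close>

lemma p0: "p > 0" using p by simp

text \<open>By Tonelli this is the p-th power of the norm in L^p(R; Z), see \<open>tot_norm\<close>.
  Functions into Z are handled as families of coordinate functions because \<open>H\<close> acts on
  each coordinate; extended values postpone questions of convergence.\<close>

definition tot :: "(nat \<Rightarrow> real \<Rightarrow> 'a) \<Rightarrow> ennreal" where
  "tot g = (\<Sum>n. \<integral>\<^sup>+t. ennreal (pw (\<lambda>n. g n t) n) \<partial>lebesgue)"

definition summable_family :: "(nat \<Rightarrow> real \<Rightarrow> 'a) \<Rightarrow> bool" where
  "summable_family g \<longleftrightarrow> (\<forall>n. strongly_measurable X (g n)) \<and> tot g < \<infinity>"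

lemma pw_measurable: "strongly_measurable X (g n) \<Longrightarrow> (\<lambda>t. ennreal (pw (\<lambda>n. g n t) n)) \<in> borel_measurable lebesgue"
  unfolding pw_def using strongly_measurable_norm[of "g n"] by measurable

lemma tot_eq: "(\<And>n. strongly_measurable X (g n)) \<Longrightarrow> tot g = (\<integral>\<^sup>+t. (\<Sum>n. ennreal (pw (\<lambda>n. g n t) n)) \<partial>lebesgue)"
  unfolding tot_def by (rule nn_integral_suminf[symmetric]) (rule pw_measurable)

lemma summable_family_Lp:
  assumes "summable_family g" shows "g n \<in> Lp p X"
proof (rule Lp_nn_finite)
  show sm: "strongly_measurable X (g n)" using assms by (simp add: summable_family_def)
  have "(\<integral>\<^sup>+t. ennreal (pw (\<lambda>n. g n t) n) \<partial>lebesgue) \<le> tot g"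
    unfolding tot_def using sum_le_suminf[of "\<lambda>n. \<integral>\<^sup>+t. ennreal (pw (\<lambda>n. g n t) n) \<partial>lebesgue" "{n}"] by simp
  then have fin: "(\<integral>\<^sup>+t. ennreal (pw (\<lambda>n. g n t) n) \<partial>lebesgue) < \<infinity>"
    using assms by (auto simp: summable_family_def)
  have "(\<integral>\<^sup>+t. ennreal (nrm X (g n t) powr p) \<partial>lebesgue) = (\<integral>\<^sup>+t. ennreal (inverse (w n powr p)) * ennreal (pw (\<lambda>n. g n t) n) \<partial>lebesgue)"
    using w[of n] by (intro nn_integral_cong) (simp add: pw_def powr_mult ennreal_mult[symmetric])
  also have "\<dots> = ennreal (inverse (w n powr p)) * (\<integral>\<^sup>+t. ennreal (pw (\<lambda>n. g n t) n) \<partial>lebesgue)"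
    by (rule nn_integral_cmult[OF pw_measurable[of g n, OF sm]])
  also have "\<dots> < \<infinity>" using fin by (simp add: ennreal_mult_less_top)
  finally show "(\<integral>\<^sup>+t. ennreal (nrm X (g n t) powr p) \<partial>lebesgue) < \<infinity>" .
qed

lemma summable_family_Z:
  assumes "summable_family g" shows "AE t in lebesgue. (\<lambda>n. g n t) \<in> carrier Z"
proof -
  have sm: "strongly_measurable X (g n)" for n using assms by (simp add: summable_family_def)
  have "(\<lambda>t. \<Sum>n. ennreal (pw (\<lambda>n. g n t) n)) \<in> borel_measurable lebesgue"
    by (intro borel_measurable_suminf_order pw_measurable sm)
  moreover have "(\<integral>\<^sup>+t. (\<Sum>n. ennreal (pw (\<lambda>n. g n t) n)) \<partial>lebesgue) \<noteq> \<infinity>"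
    using assms tot_eq[of g, OF sm] by (auto simp: summable_family_def)
  ultimately have "AE t in lebesgue. (\<Sum>n. ennreal (pw (\<lambda>n. g n t) n)) \<noteq> \<infinity>" by (rule nn_integral_PInf_AE)
  then show ?thesis
  proof eventually_elim
    case (elim t)
    have "summable (pw (\<lambda>n. g n t))" by (rule summable_suminf_not_top[OF pw_ge0]) (use elim in simp)
    then show ?case using strongly_measurable_cl[OF sm] by (simp add: carrier_Z)
  qed
qed

lemma Z_norm_ennreal: "z \<in> carrier Z \<Longrightarrow> ennreal (nrm Z z powr p) = (\<Sum>n. ennreal (pw z n))"
  unfolding Z_norm_powr using suminf_ennreal2[OF pw_ge0 Z_summable, of z] by simp

lemma tot_norm:
  assumes "summable_family g"
  shows "tot g = (\<integral>\<^sup>+t. ennreal (nrm Z (\<lambda>n. g n t) powr p) \<partial>lebesgue)"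
proof -
  have sm: "strongly_measurable X (g n)" for n using assms by (simp add: summable_family_def)
  have "AE t in lebesgue. (\<Sum>n. ennreal (pw (\<lambda>n. g n t) n)) = ennreal (nrm Z (\<lambda>n. g n t) powr p)"
    using summable_family_Z[OF assms] by eventually_elim (simp add: Z_norm_ennreal)
  then show ?thesis unfolding tot_eq[of g, OF sm] by (rule nn_integral_cong_AE)
qed

lemma summable_familyI:
  assumes sm: "\<And>n. strongly_measurable X (g n)" and Z: "AE t in lebesgue. (\<lambda>n. g n t) \<in> carrier Z"
    and le: "AE t in lebesgue. ennreal (nrm Z (\<lambda>n. g n t) powr p) \<le> b t" "(\<integral>\<^sup>+t. b t \<partial>lebesgue) < \<infinity>"
  shows "summable_family g" "tot g \<le> (\<integral>\<^sup>+t. b t \<partial>lebesgue)"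
proof -
  have "AE t in lebesgue. (\<Sum>n. ennreal (pw (\<lambda>n. g n t) n)) \<le> b t"
    using Z le(1) by eventually_elim (simp add: Z_norm_ennreal)
  then show "tot g \<le> (\<integral>\<^sup>+t. b t \<partial>lebesgue)" unfolding tot_eq[of g, OF sm] by (rule nn_integral_mono_AE)
  then show "summable_family g" using sm le(2) by (auto simp: summable_family_def)
qed

text \<open>Because the two exponents agree, \<open>w n powr p\<close> is a constant factor in each
  coordinate integral, and the bound on X applies to every coordinate with the same
  \<open>K\<close>.\<close>

lemma summable_family_H:
  assumes "summable_family g"
  shows "summable_family (\<lambda>n. H (g n))" "tot (\<lambda>n. H (g n)) \<le> ennreal K * tot g"
proof -
  note gL = summable_family_Lp[OF assms]
  have bd: "(\<integral>\<^sup>+t. ennreal (pw (\<lambda>n. H (g n) t) n) \<partial>lebesgue) \<le> ennreal K * (\<integral>\<^sup>+t. ennreal (pw (\<lambda>n. g n t) n) \<partial>lebesgue)" for n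
  proof -
    have e: "(\<integral>\<^sup>+t. ennreal (pw (\<lambda>n. f n t) n) \<partial>lebesgue) = ennreal (w n powr p) * ennreal (LINT t|lebesgue. nrm X (f n t) powr p)"
      if "f n \<in> Lp p X" for f
    proof -
      have "(\<integral>\<^sup>+t. ennreal (pw (\<lambda>n. f n t) n) \<partial>lebesgue) = (\<integral>\<^sup>+t. ennreal (w n powr p) * ennreal (nrm X (f n t) powr p) \<partial>lebesgue)"
        by (intro nn_integral_cong) (simp add: pw_def powr_mult ennreal_mult)
      also have "\<dots> = ennreal (w n powr p) * (\<integral>\<^sup>+t. ennreal (nrm X (f n t) powr p) \<partial>lebesgue)"
        using strongly_measurable_norm[OF Lp_sm[OF that]] by (intro nn_integral_cmult) measurable
      finally show ?thesis using Lp_nn_integral[OF that] by simp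
    qed
    have "ennreal (LINT t|lebesgue. nrm X (H (g n) t) powr p) \<le> ennreal (K * (LINT t|lebesgue. nrm X (g n t) powr p))"
      by (intro ennreal_leI H_bound gL)
    also have "\<dots> = ennreal K * ennreal (LINT t|lebesgue. nrm X (g n t) powr p)"
      using K0 by (intro ennreal_mult) (auto simp: integral_nonneg)
    finally have "ennreal (w n powr p) * ennreal (LINT t|lebesgue. nrm X (H (g n) t) powr p)
       \<le> ennreal (w n powr p) * (ennreal K * ennreal (LINT t|lebesgue. nrm X (g n t) powr p))" by (rule mult_left_mono) simp
    then show ?thesis using e[of "\<lambda>n. H (g n)", OF H_Lp[OF gL]] e[of g, OF gL] by (simp add: mult_ac)
  qed
  have "tot (\<lambda>n. H (g n)) \<le> (\<Sum>n. ennreal K * (\<integral>\<^sup>+t. ennreal (pw (\<lambda>n. g n t) n) \<partial>lebesgue))"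
    unfolding tot_def by (intro suminf_le bd) auto
  then show le: "tot (\<lambda>n. H (g n)) \<le> ennreal K * tot g" unfolding tot_def by simp
  have "ennreal K * tot g < \<infinity>" using assms by (simp add: summable_family_def ennreal_mult_less_top)
  then have "tot (\<lambda>n. H (g n)) < \<infinity>" using le by (rule le_less_trans[rotated])
  then show "summable_family (\<lambda>n. H (g n))" using Lp_sm[OF H_Lp[OF gL]] by (simp add: summable_family_def)
qed

lemma summable_family_comb:
  assumes g: "summable_family g" and h: "summable_family h"
  shows "summable_family (\<lambda>n t. a \<odot> g n t \<oplus> b \<odot> h n t)"
proof (rule summable_familyI(1))
  have gsm: "strongly_measurable X (g n)" and hsm: "strongly_measurable X (h n)" for n
    using g h by (simp_all add: summable_family_def)
  have op: "op X X (\<lambda>x. a \<odot> x)" for a using smult_op by unfold_locales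
  show "strongly_measurable X (\<lambda>t. a \<odot> g n t \<oplus> b \<odot> h n t)" for n
    by (intro strongly_measurable_add op.strongly_measurable_op[OF op] gsm hsm)
  show "AE t in lebesgue. (\<lambda>n. a \<odot> g n t \<oplus> b \<odot> h n t) \<in> carrier Z"
    using summable_family_Z[OF g] summable_family_Z[OF h]
    by eventually_elim (use Z.M.a_closed[of "a \<odot>\<^bsub>Z\<^esub> _" "b \<odot>\<^bsub>Z\<^esub> _"] in \<open>simp add: Z_simps Z_add_cl Z_smult_cl\<close>)
  let ?b = "\<lambda>t. ennreal (2 powr p) * (ennreal (norm a powr p) * ennreal (nrm Z (\<lambda>n. g n t) powr p) + ennreal (norm b powr p) * ennreal (nrm Z (\<lambda>n. h n t) powr p))"
  show "AE t in lebesgue. ennreal (nrm Z (\<lambda>n. a \<odot> g n t \<oplus> b \<odot> h n t) powr p) \<le> ?b t"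
    using summable_family_Z[OF g] summable_family_Z[OF h]
  proof eventually_elim
    case (elim t)
    let ?g = "\<lambda>n. g n t" and ?h = "\<lambda>n. h n t"
    have "nrm Z (\<lambda>n. a \<odot> g n t \<oplus> b \<odot> h n t) \<le> norm a * nrm Z ?g + norm b * nrm Z ?h"
      using Z_add_cl(2)[OF Z_smult_cl(1)[OF elim(1), of a] Z_smult_cl(1)[OF elim(2), of b]]
        Z_smult_cl(2)[OF elim(1), of a] Z_smult_cl(2)[OF elim(2), of b] by simp
    then have "nrm Z (\<lambda>n. a \<odot> g n t \<oplus> b \<odot> h n t) powr p \<le> (norm a * nrm Z ?g + norm b * nrm Z ?h) powr p"
      using p Z_norm_ge0 by (intro powr_mono2) auto
    also have "\<dots> \<le> 2 powr p * ((norm a * nrm Z ?g) powr p + (norm b * nrm Z ?h) powr p)"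
      using p Z_norm_ge0 by (intro powr_add_bound) auto
    finally have "ennreal (nrm Z (\<lambda>n. a \<odot> g n t \<oplus> b \<odot> h n t) powr p) \<le> ennreal (2 powr p * ((norm a * nrm Z ?g) powr p + (norm b * nrm Z ?h) powr p))"
      by (rule ennreal_leI)
    also have "\<dots> = ?b t" by (simp add: powr_mult ennreal_mult)
    finally show ?case .
  qed
  have m: "(\<lambda>t. ennreal (nrm Z (\<lambda>n. f n t) powr p)) \<in> borel_measurable lebesgue" if f: "summable_family f" for f
  proof -
    have fsm: "strongly_measurable X (f n)" for n using f by (simp add: summable_family_def)
    have "(\<lambda>t. \<Sum>n. pw (\<lambda>n. f n t) n) \<in> borel_measurable lebesgue"
      unfolding pw_def using strongly_measurable_norm[OF fsm] by measurable
    then have "(\<lambda>t. nrm Z (\<lambda>n. f n t) powr p) \<in> borel_measurable lebesgue" unfolding Z_simps by measurable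
    then show ?thesis by measurable
  qed
  have "(\<integral>\<^sup>+t. ?b t \<partial>lebesgue) = ennreal (2 powr p) * (ennreal (norm a powr p) * tot g + ennreal (norm b powr p) * tot h)"
    unfolding tot_norm[OF g] tot_norm[OF h] using m[OF g] m[OF h]
    by (simp add: nn_integral_cmult nn_integral_add)
  then show "(\<integral>\<^sup>+t. ?b t \<partial>lebesgue) < \<infinity>"
    using g h by (simp add: summable_family_def ennreal_mult_less_top)
qed

lemma H_comb:
  assumes f: "f \<in> Lp p X" and g: "g \<in> Lp p X"
  shows "AE t in lebesgue. H (\<lambda>s. a \<odot> f s \<oplus> b \<odot> g s) t = a \<odot> H f t \<oplus> b \<odot> H g t"
  using H_add[OF Lp_smult[OF p0 f, of a] Lp_smult[OF p0 g, of b]] H_smult[OF f, of a] H_smult[OF g, of b]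
  by eventually_elim simp

text \<open>Write the family as \<open>J u\<close> and use that \<open>H\<close> commutes with \<open>T t0\<close>.\<close>

lemma H_preserves_N:
  assumes g: "summable_family g" and N: "AE t in lebesgue. (\<lambda>n. g n t) \<in> N"
  shows "AE t in lebesgue. (\<lambda>n. H (g n) t) \<in> N"
proof -
  have gsm: "strongly_measurable X (g n)" for n using g by (simp add: summable_family_def)
  have t00: "t0 \<ge> 0" using t0 by simp
  interpret T0: op X X "T t0" by (rule T_oper[OF t00])
  \<comment> \<open>The recursive solution of \<open>J u = g\<close>. Unlike a pointwise choice of
    preimages, it is visibly measurable, and it is defined for every \<open>t\<close>.\<close>
  define u where "u n = rec_nat (g 0) (\<lambda>k h t. g (Suc k) t \<oplus> T t0 (h t)) n" for n
  have u_simps: "u 0 = g 0" "u (Suc n) = (\<lambda>t. g (Suc n) t \<oplus> T t0 (u n t))" for n unfolding u_def by simp_all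
  have usm: "strongly_measurable X (u n)" for n
    by (induction n) (simp_all only: u_simps gsm strongly_measurable_add T0.strongly_measurable_op)
  note uc = strongly_measurable_cl[OF usm] and gc = strongly_measurable_cl[OF gsm]
  have gu: "g (Suc n) = (\<lambda>t. u (Suc n) t \<ominus> T t0 (u n t))" for n
    using uc gc t00 by (simp add: u_simps add_diff_cancel)
  \<comment> \<open>If the values of \<open>g\<close> at \<open>t\<close> form \<open>J v\<close>,
    the recursion reproduces \<open>v\<close>. So \<open>u\<close> lies in Z there, and the lower
    bound of \<open>J\<close> controls its norm.\<close>
  have uZ: "(\<lambda>n. u n t) \<in> carrier Z \<and> nrm Z (\<lambda>n. u n t) \<le> nrm Z (\<lambda>n. g n t)" if Nt: "(\<lambda>n. g n t) \<in> N" for t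
  proof -
    obtain v where v: "v \<in> carrier Z" "(\<lambda>n. g n t) = J v" using Nt by (auto simp: N_def)
    have "u n t = v n" for n
    proof (induction n)
      case 0 then show ?case using fun_cong[OF v(2), of 0] J_coord(1)[OF v(1)] by (simp add: u_simps)
    next
      case (Suc n)
      have "g (Suc n) t = v (Suc n) \<ominus> T t0 (v n)" using fun_cong[OF v(2), of "Suc n"] J_coord(2)[OF v(1)] by simp
      then show ?case using Suc Z_coord[OF v(1)] t00 by (simp add: u_simps diff_add_self)
    qed
    then have "(\<lambda>n. u n t) = v" by auto
    then show ?thesis using v J_lower_bound[OF v(1)] by simp
  qed
  have us: "summable_family u"
  proof (rule summable_familyI(1)[OF usm])
    show "AE t in lebesgue. (\<lambda>n. u n t) \<in> carrier Z" using N by eventually_elim (simp add: uZ)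
    show "AE t in lebesgue. ennreal (nrm Z (\<lambda>n. u n t) powr p) \<le> ennreal (nrm Z (\<lambda>n. g n t) powr p)"
      using N
    proof eventually_elim
      case (elim t)
      show ?case using uZ[OF elim] p Z_norm_ge0 by (intro ennreal_leI powr_mono2) auto
    qed
    show "(\<integral>\<^sup>+t. ennreal (nrm Z (\<lambda>n. g n t) powr p) \<partial>lebesgue) < \<infinity>"
      using g unfolding tot_norm[OF g, symmetric] by (simp add: summable_family_def)
  qed
  note uL = summable_family_Lp[OF us]
  obtain M where M: "M > 0" "\<forall>x\<in>carrier X. nrm X (T t0 x) \<le> M * nrm X x" using T0.bound by blast
  have TuL: "(\<lambda>t. T t0 (u n t)) \<in> Lp p X" for n
    by (rule T0.Lp_op(1)[OF p0 less_imp_le[OF M(1)] _ uL]) (use M(2) in blast)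
  have "AE t in lebesgue. H (g (Suc n)) t = H (u (Suc n)) t \<ominus> T t0 (H (u n) t)" for n
    unfolding gu using H_diff[OF uL TuL, of "Suc n" n] H_commute[OF T_op[OF t00] uL, of n]
    by eventually_elim simp
  then have "AE t in lebesgue. \<forall>n. H (g (Suc n)) t = H (u (Suc n)) t \<ominus> T t0 (H (u n) t)"
    by (simp add: AE_all_countable)
  then show ?thesis using summable_family_Z[OF summable_family_H(1)[OF us]]
  proof eventually_elim
    case (elim t)
    have "(\<lambda>n. H (g n) t) = J (\<lambda>n. H (u n) t)"
    proof
      fix n show "H (g n) t = J (\<lambda>n. H (u n) t) n"
        using elim(1) J_coord[OF elim(2)] by (cases n) (simp_all add: u_simps(1))
    qed
    then show ?case using elim(2) by (auto simp: N_def)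
  qed
qed

text \<open>A summable family gives a point of Z only for almost every \<open>t\<close>. Elsewhere
  the class of zero is inserted, because functions in \<open>Lp\<close> must take values in the
  carrier everywhere.\<close>

definition to_Y :: "(nat \<Rightarrow> real \<Rightarrow> 'a) \<Rightarrow> real \<Rightarrow> (nat \<Rightarrow> 'a) set" where
  "to_Y g t = (if (\<lambda>n. g n t) \<in> carrier Z then Q.cls (\<lambda>n. g n t) else Q.cls \<zero>\<^bsub>Z\<^esub>)"

lemma to_Y_cl: "to_Y g t \<in> carrier Q.Y"
  by (auto simp: to_Y_def Q.carrier_Y)

lemma to_Y_Lp:
  assumes g: "summable_family g"
  shows "to_Y g \<in> Lp p Q.Y" "(\<integral>\<^sup>+t. ennreal (nrm Q.Y (to_Y g t) powr p) \<partial>lebesgue) \<le> tot g"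
proof -
  have gsm: "strongly_measurable X (g n)" for n using g by (simp add: summable_family_def)
  note gc = strongly_measurable_cl[OF gsm]
  \<comment> \<open>Partial sums of the coordinates are strongly measurable, and for almost every
    \<open>t\<close> they are truncations converging in Z. Their classes thus approximate
    \<open>to_Y g\<close>.\<close>
  define F where "F m t = rec_nat \<zero>\<^bsub>Z\<^esub> (\<lambda>k z. z \<oplus>\<^bsub>Z\<^esub> single k (g k t)) m" for m t
  have F_simps: "F 0 t = \<zero>\<^bsub>Z\<^esub>" "F (Suc m) t = F m t \<oplus>\<^bsub>Z\<^esub> single m (g m t)" for m t by (simp_all add: F_def)
  have sop: "op X Z (single k)" for k using single_op by unfold_locales
  have Fsm: "strongly_measurable Z (F m)" for m
  proof (induction m)
    case 0
    have "F 0 = (\<lambda>_. \<zero>\<^bsub>Z\<^esub>)" by (simp add: F_simps fun_eq_iff)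
    then show ?case using Z.strongly_measurable_simple[OF countably_valued_const, of "\<zero>\<^bsub>Z\<^esub>"] by simp
  next
    case (Suc m)
    have "F (Suc m) = (\<lambda>t. F m t \<oplus>\<^bsub>Z\<^esub> single m (g m t))" by (simp add: F_simps fun_eq_iff)
    then show ?case using Z.strongly_measurable_add[OF Suc op.strongly_measurable_op[OF sop gsm], of m m] by simp
  qed
  have Ft: "F m t = trunc m (\<lambda>n. g n t)" if "(\<lambda>n. g n t) \<in> carrier Z" for m t
    by (induction m) (simp_all add: F_simps trunc_0 trunc_Suc[OF that])
  have sm: "strongly_measurable Q.Y (to_Y g)"
  proof (rule Q.Y.strongly_measurable_limit[OF Q.cls.strongly_measurable_op[OF Fsm] to_Y_cl])
    show "AE t in lebesgue. tends Q.Y (\<lambda>n. Q.cls (F n t)) (to_Y g t)"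
      using summable_family_Z[OF g]
    proof eventually_elim
      case (elim t)
      have "tends Q.Y (\<lambda>n. Q.cls (trunc n (\<lambda>n. g n t))) (Q.cls (\<lambda>n. g n t))"
        by (rule Q.cls.tends[OF trunc_tends[OF elim] _ elim]) (use trunc_Z[OF elim] in auto)
      then show ?case using elim by (simp add: Ft to_Y_def)
    qed
  qed
  show le: "(\<integral>\<^sup>+t. ennreal (nrm Q.Y (to_Y g t) powr p) \<partial>lebesgue) \<le> tot g"
    unfolding tot_norm[OF g]
  proof (rule nn_integral_mono_AE)
    show "AE t in lebesgue. ennreal (nrm Q.Y (to_Y g t) powr p) \<le> ennreal (nrm Z (\<lambda>n. g n t) powr p)"
      using summable_family_Z[OF g]
    proof eventually_elim
      case (elim t)
      then show ?case using Q.Y_norm_le[OF elim] Q.Y_norm_ge0'[OF elim] p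
        by (intro ennreal_leI powr_mono2) (auto simp: to_Y_def)
    qed
  qed
  show "to_Y g \<in> Lp p Q.Y"
    by (rule Q.Y.Lp_nn_finite[OF sm]) (use le g in \<open>auto simp: summable_family_def\<close>)
qed

section \<open>Lifting from the quotient and the Hilbert transform on Y\<close>

definition lifts :: "(real \<Rightarrow> (nat \<Rightarrow> 'a) set) \<Rightarrow> (nat \<Rightarrow> real \<Rightarrow> 'a) \<Rightarrow> bool" where
  "lifts f g \<longleftrightarrow> summable_family g \<and> (AE t in lebesgue. (\<lambda>n. g n t) \<in> carrier Z \<and> Q.cls (\<lambda>n. g n t) = f t)"

text \<open>
  The lift is a telescoping sum of lifts of countably valued functions. The error of the approximations is
  relative to \<open>f t\<close>, so that the norm is controlled pointwise and not only in \<open>L\<^sup>p\<close>.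
\<close>

lemma lift_exists:
  assumes f: "f \<in> Lp p Q.Y"
  shows "\<exists>g. lifts f g \<and> tot g \<le> ennreal (12 powr p) * (\<integral>\<^sup>+t. ennreal (nrm Q.Y (f t) powr p) \<partial>lebesgue)"
proof -
  note fc = Q.Y.Lp_cl[OF f]
  obtain \<sigma> where \<sigma>: "\<And>j. countably_valued (\<sigma> j)" "\<And>j t. \<sigma> j t \<in> carrier Q.Y"
    "AE t in lebesgue. \<forall>j. nrm Q.Y (\<sigma> j t \<ominus>\<^bsub>Q.Y\<^esub> f t) \<le> (1/2)^j * nrm Q.Y (f t)"
    using Q.Y.strongly_measurable_approx[OF Q.Y.Lp_sm[OF f]] by blast
  have "\<forall>y\<in>carrier Q.Y. \<exists>z. z \<in> carrier Z \<and> Q.cls z = y \<and> nrm Z z \<le> 2 * nrm Q.Y y"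
    using Q.Y_section by blast
  \<comment> \<open>An arbitrary section of the quotient map, with no continuity or measurability.
    It is applied only to countably valued functions.\<close>
  from bchoice[OF this] obtain \<rho> where \<rho>': "\<forall>y\<in>carrier Q.Y. \<rho> y \<in> carrier Z \<and> Q.cls (\<rho> y) = y \<and> nrm Z (\<rho> y) \<le> 2 * nrm Q.Y y"
    by (rule exE)
  have \<rho>: "\<rho> y \<in> carrier Z" "Q.cls (\<rho> y) = y" "nrm Z (\<rho> y) \<le> 2 * nrm Q.Y y" if "y \<in> carrier Q.Y" for y
    using bspec[OF \<rho>' that] by simp_all
  define G where "G j t = rec_nat (\<rho> (\<sigma> 0 t)) (\<lambda>k z. z \<oplus>\<^bsub>Z\<^esub> \<rho> (\<sigma> (Suc k) t \<ominus>\<^bsub>Q.Y\<^esub> \<sigma> k t)) j" for j t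
  have G_simps: "G 0 t = \<rho> (\<sigma> 0 t)" "G (Suc j) t = G j t \<oplus>\<^bsub>Z\<^esub> \<rho> (\<sigma> (Suc j) t \<ominus>\<^bsub>Q.Y\<^esub> \<sigma> j t)" for j t
    by (simp_all add: G_def)
  have Gc: "G j t \<in> carrier Z" for j t by (induction j) (simp_all add: G_simps \<rho> \<sigma>(2))
  have Gcv: "countably_valued (G j)" for j
  proof (induction j)
    case 0
    have "G 0 = (\<lambda>t. \<rho> (\<sigma> 0 t))" by (simp add: G_simps fun_eq_iff)
    then show ?case using countably_valued_comp[OF \<sigma>(1)[of 0], of \<rho>] by simp
  next
    case (Suc j)
    have "G (Suc j) = (\<lambda>t. G j t \<oplus>\<^bsub>Z\<^esub> \<rho> (\<sigma> (Suc j) t \<ominus>\<^bsub>Q.Y\<^esub> \<sigma> j t))" by (simp add: G_simps fun_eq_iff)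
    moreover have "countably_valued (\<lambda>t. \<rho> (\<sigma> (Suc j) t \<ominus>\<^bsub>Q.Y\<^esub> \<sigma> j t))"
      by (rule countably_valued_comp2[OF \<sigma>(1) \<sigma>(1), of "\<lambda>a b. \<rho> (a \<ominus>\<^bsub>Q.Y\<^esub> b)"])
    ultimately show ?case using countably_valued_comp2[OF Suc, of _ "\<lambda>a b. a \<oplus>\<^bsub>Z\<^esub> b"] by simp
  qed
  have Gcls: "Q.cls (G j t) = \<sigma> j t" for j t
    by (induction j) (simp_all add: G_simps \<rho> \<sigma>(2) Gc Q.Y_add[symmetric] Q.Y.add_diff_self)
  have lim: "\<exists>x. x \<in> carrier Z \<and> tends Z (\<lambda>j. G j t) x \<and> Q.cls x = f t \<and> nrm Z x \<le> 12 * nrm Q.Y (f t)"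
    if good: "\<forall>j. nrm Q.Y (\<sigma> j t \<ominus>\<^bsub>Q.Y\<^esub> f t) \<le> (1/2)^j * nrm Q.Y (f t)" for t
  proof -
    have f0: "nrm Q.Y (f t) \<ge> 0" by (rule Q.Y.norm_ge0[OF fc])
    have "nrm Z (G (Suc j) t \<ominus>\<^bsub>Z\<^esub> G j t) \<le> 4 * nrm Q.Y (f t) * (1/2)^j" for j
    proof -
      let ?d = "\<sigma> (Suc j) t \<ominus>\<^bsub>Q.Y\<^esub> \<sigma> j t"
      have d: "?d \<in> carrier Q.Y" using \<sigma>(2) by simp
      have "G (Suc j) t \<ominus>\<^bsub>Z\<^esub> G j t = \<rho> ?d"
        using Gc[of j t] \<rho>(1)[OF d] by (simp add: G_simps Z.M.a_comm[of "G j t"] Z.add_diff_cancel)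
      then have "nrm Z (G (Suc j) t \<ominus>\<^bsub>Z\<^esub> G j t) \<le> 2 * nrm Q.Y ?d" using \<rho>(3)[OF d] by simp
      also have "nrm Q.Y ?d \<le> (1/2)^Suc j * nrm Q.Y (f t) + (1/2)^j * nrm Q.Y (f t)"
        using Q.Y.norm_diff_triangle[OF \<sigma>(2)[of "Suc j" t] fc[of t] \<sigma>(2)[of j t]]
          Q.Y.norm_minus_commute[OF fc[of t] \<sigma>(2)[of j t]] spec[OF good, of j] spec[OF good, of "Suc j"] by linarith
      also have "\<dots> \<le> 2 * ((1/2)^j * nrm Q.Y (f t))" using f0 by simp
      finally show ?thesis by (simp add: mult_ac)
    qed
    from Z.complete_fast[OF Gc _ _ this] obtain x where x: "x \<in> carrier Z" "tends Z (\<lambda>j. G j t) x"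
      "\<And>n. nrm Z (G n t \<ominus>\<^bsub>Z\<^esub> x) \<le> 4 * nrm Q.Y (f t) * (1/2)^n / (1 - 1/2)" by auto
    have "tends Q.Y (\<lambda>j. Q.cls (G j t)) (Q.cls x)" by (rule Q.cls.tends[OF x(2) _ x(1)]) (use Gc in auto)
    then have 1: "tends Q.Y (\<lambda>j. \<sigma> j t) (Q.cls x)" by (simp add: Gcls)
    have 2: "tends Q.Y (\<lambda>j. \<sigma> j t) (f t)"
    proof (rule Q.Y.tends_cmp)
      show "nrm Q.Y (\<sigma> j t \<ominus>\<^bsub>Q.Y\<^esub> f t) \<le> (1/2)^j * nrm Q.Y (f t)" for j using good by blast
      show "(\<lambda>j. (1/2)^j * nrm Q.Y (f t)) \<longlonglongrightarrow> 0"
        by (intro tendsto_mult_left_zero LIMSEQ_realpow_zero) auto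
    qed (use \<sigma>(2) fc in auto)
    have eq: "Q.cls x = f t"
      by (rule Q.Y.tends_unique[OF 1 2]) (use \<sigma>(2) fc x(1) in auto)
    \<comment> \<open>Origin of the constant 12: the first lift costs 2 times at most 2, and the
      increments, bounded by \<open>4 * (1/2)^j\<close> times the norm of \<open>f t\<close>, sum to
      at most 8.\<close>
    have "nrm Z (G 0 t) \<le> 2 * nrm Q.Y (\<sigma> 0 t)" using \<rho>(3)[OF \<sigma>(2)] by (simp add: G_simps)
    moreover have "nrm Q.Y (\<sigma> 0 t) \<le> nrm Q.Y (f t) + nrm Q.Y (f t)"
      using Q.Y.norm_le_add_diff[OF \<sigma>(2) fc, of 0 t t] spec[OF good, of 0] by simp
    moreover have "nrm Z x \<le> nrm Z (G 0 t) + 8 * nrm Q.Y (f t)"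
      using Z.norm_le_add_diff[OF x(1) Gc, of 0 t] Z.norm_minus_commute[OF x(1) Gc, of 0 t] x(3)[of 0] by simp
    ultimately have "nrm Z x \<le> 12 * nrm Q.Y (f t)" by linarith
    then show ?thesis using x(1,2) eq by blast
  qed
  \<comment> \<open>Where the approximation fails, a null set, the value is \<zero>, so that
    \<open>L\<close> stays in the carrier.\<close>
  define L where "L t = (if \<exists>x. x \<in> carrier Z \<and> tends Z (\<lambda>j. G j t) x \<and> Q.cls x = f t \<and> nrm Z x \<le> 12 * nrm Q.Y (f t)
     then (SOME x. x \<in> carrier Z \<and> tends Z (\<lambda>j. G j t) x \<and> Q.cls x = f t \<and> nrm Z x \<le> 12 * nrm Q.Y (f t)) else \<zero>\<^bsub>Z\<^esub>)" for t
  have L: "L t \<in> carrier Z \<and> tends Z (\<lambda>j. G j t) (L t) \<and> Q.cls (L t) = f t \<and> nrm Z (L t) \<le> 12 * nrm Q.Y (f t)"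
    if good: "\<forall>j. nrm Q.Y (\<sigma> j t \<ominus>\<^bsub>Q.Y\<^esub> f t) \<le> (1/2)^j * nrm Q.Y (f t)" for t
    using someI_ex[OF lim[OF good]] lim[OF good] by (simp only: L_def if_True)
  have Lc: "L t \<in> carrier Z" for t
  proof (cases "\<exists>x. x \<in> carrier Z \<and> tends Z (\<lambda>j. G j t) x \<and> Q.cls x = f t \<and> nrm Z x \<le> 12 * nrm Q.Y (f t)")
    case True then show ?thesis using someI_ex[OF True] by (simp only: L_def if_True)
  next
    case False then show ?thesis unfolding L_def by (subst if_not_P) auto
  qed
  have Lsm: "strongly_measurable Z L"
  proof (rule Z.strongly_measurable_countably_valuedI[OF Lc Gcv Gc])
    show "AE t in lebesgue. tends Z (\<lambda>j. G j t) (L t)" using \<sigma>(3) by eventually_elim (simp add: L)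
  qed
  have cop: "op Z X (\<lambda>z. z n)" for n using coord_op by unfold_locales
  define g where "g n t = L t n" for n t
  have gL: "(\<lambda>n. g n t) = L t" for t by (simp add: g_def)
  have gsm: "strongly_measurable X (g n)" for n
    unfolding g_def[abs_def] by (rule op.strongly_measurable_op[OF cop Lsm])
  let ?b = "\<lambda>t. ennreal (12 powr p) * ennreal (nrm Q.Y (f t) powr p)"
  have b: "(\<integral>\<^sup>+t. ?b t \<partial>lebesgue) = ennreal (12 powr p) * (\<integral>\<^sup>+t. ennreal (nrm Q.Y (f t) powr p) \<partial>lebesgue)"
    using Q.Y.strongly_measurable_norm[OF Q.Y.Lp_sm[OF f]] by (intro nn_integral_cmult) measurable
  have bfin: "(\<integral>\<^sup>+t. ?b t \<partial>lebesgue) < \<infinity>"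
    unfolding b Q.Y.Lp_nn_integral[OF f] by (simp add: ennreal_mult_less_top)
  have "AE t in lebesgue. ennreal (nrm Z (\<lambda>n. g n t) powr p) \<le> ?b t"
    using \<sigma>(3)
  proof eventually_elim
    case (elim t)
    have "nrm Z (L t) powr p \<le> (12 * nrm Q.Y (f t)) powr p"
      using L[OF elim] p Z_norm_ge0 by (intro powr_mono2) auto
    then have "ennreal (nrm Z (L t) powr p) \<le> ennreal (12 powr p * nrm Q.Y (f t) powr p)" by (simp add: powr_mult ennreal_leI)
    then show ?case by (simp add: gL ennreal_mult)
  qed
  note sf = summable_familyI[OF gsm _ this bfin, unfolded gL, OF AE_I2[OF Lc]]
  have "AE t in lebesgue. (\<lambda>n. g n t) \<in> carrier Z \<and> Q.cls (\<lambda>n. g n t) = f t"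
    using \<sigma>(3) by eventually_elim (simp add: gL L)
  then have "lifts f g" using sf(1) by (simp add: lifts_def)
  then show ?thesis using sf(2) unfolding b by blast
qed

text \<open>The lift \<open>g3\<close> and the combination of \<open>g1\<close> and
  \<open>g2\<close> differ almost everywhere by an element of \<open>N\<close>, which
  \<open>H\<close> preserves. With \<open>a = 1\<close> and \<open>b = 0\<close> this is
  independence of the lift, otherwise linearity.\<close>

lemma lifts_comb:
  assumes "lifts f1 g1" "lifts f2 g2" "lifts (\<lambda>t. a \<odot>\<^bsub>Q.Y\<^esub> f1 t \<oplus>\<^bsub>Q.Y\<^esub> b \<odot>\<^bsub>Q.Y\<^esub> f2 t) g3"
  shows "AE t in lebesgue. to_Y (\<lambda>n. H (g3 n)) t = a \<odot>\<^bsub>Q.Y\<^esub> to_Y (\<lambda>n. H (g1 n)) t \<oplus>\<^bsub>Q.Y\<^esub> b \<odot>\<^bsub>Q.Y\<^esub> to_Y (\<lambda>n. H (g2 n)) t"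
proof -
  have s: "summable_family g1" "summable_family g2" "summable_family g3" using assms by (simp_all add: lifts_def)
  have l: "AE t in lebesgue. (\<lambda>n. g1 n t) \<in> carrier Z \<and> Q.cls (\<lambda>n. g1 n t) = f1 t"
    "AE t in lebesgue. (\<lambda>n. g2 n t) \<in> carrier Z \<and> Q.cls (\<lambda>n. g2 n t) = f2 t"
    "AE t in lebesgue. (\<lambda>n. g3 n t) \<in> carrier Z \<and> Q.cls (\<lambda>n. g3 n t) = a \<odot>\<^bsub>Q.Y\<^esub> f1 t \<oplus>\<^bsub>Q.Y\<^esub> b \<odot>\<^bsub>Q.Y\<^esub> f2 t"
    using assms by (simp_all add: lifts_def)
  define h where "h = (\<lambda>n t. a \<odot> g1 n t \<oplus> b \<odot> g2 n t)"
  define k where "k = (\<lambda>n t. 1 \<odot> g3 n t \<oplus> (-1) \<odot> h n t)"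
  have hs: "summable_family h" unfolding h_def by (rule summable_family_comb[OF s(1,2)])
  have ks: "summable_family k" unfolding k_def by (rule summable_family_comb[OF s(3) hs])
  have "AE t in lebesgue. (\<lambda>n. k n t) \<in> N" using l
  proof eventually_elim
    case (elim t)
    let ?g1 = "\<lambda>n. g1 n t" and ?g2 = "\<lambda>n. g2 n t" and ?g3 = "\<lambda>n. g3 n t"
    have z: "?g1 \<in> carrier Z" "?g2 \<in> carrier Z" "?g3 \<in> carrier Z" using elim by auto
    let ?h = "a \<odot>\<^bsub>Z\<^esub> ?g1 \<oplus>\<^bsub>Z\<^esub> b \<odot>\<^bsub>Z\<^esub> ?g2"
    have "Q.cls ?g3 = Q.cls ?h" using elim z by (simp add: Q.cls.add Q.cls.smult)
    then have "?g3 \<ominus>\<^bsub>Z\<^esub> ?h \<in> N" using z by (subst Q.cls_eq_iff[symmetric]) auto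
    moreover have "?g3 \<ominus>\<^bsub>Z\<^esub> ?h = (\<lambda>n. k n t)"
      using z Z_coord[OF z(3)] by (simp add: Z.minus_smult) (simp add: Z_simps k_def h_def)
    ultimately show ?case by simp
  qed
  from H_preserves_N[OF ks this] have HN: "AE t in lebesgue. (\<lambda>n. H (k n) t) \<in> N" .
  note L = summable_family_Lp
  have "AE t in lebesgue. H (k n) t = 1 \<odot> H (g3 n) t \<oplus> (-1) \<odot> (a \<odot> H (g1 n) t \<oplus> b \<odot> H (g2 n) t)" for n
  proof -
    have "AE t in lebesgue. H (k n) t = 1 \<odot> H (g3 n) t \<oplus> (-1) \<odot> H (h n) t"
      unfolding k_def by (rule H_comb[OF L[OF s(3)] L[OF hs]])
    moreover have "AE t in lebesgue. H (h n) t = a \<odot> H (g1 n) t \<oplus> b \<odot> H (g2 n) t"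
      unfolding h_def by (rule H_comb[OF L[OF s(1)] L[OF s(2)]])
    ultimately show ?thesis by eventually_elim simp
  qed
  then have "AE t in lebesgue. \<forall>n. H (k n) t = 1 \<odot> H (g3 n) t \<oplus> (-1) \<odot> (a \<odot> H (g1 n) t \<oplus> b \<odot> H (g2 n) t)"
    by (simp add: AE_all_countable)
  then show ?thesis
    using HN summable_family_Z[OF summable_family_H(1)[OF s(1)]] summable_family_Z[OF summable_family_H(1)[OF s(2)]]
      summable_family_Z[OF summable_family_H(1)[OF s(3)]]
  proof eventually_elim
    case (elim t)
    let ?g1 = "\<lambda>n. H (g1 n) t" and ?g2 = "\<lambda>n. H (g2 n) t" and ?g3 = "\<lambda>n. H (g3 n) t"
    let ?h = "a \<odot>\<^bsub>Z\<^esub> ?g1 \<oplus>\<^bsub>Z\<^esub> b \<odot>\<^bsub>Z\<^esub> ?g2"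
    have "(\<lambda>n. H (k n) t) = ?g3 \<ominus>\<^bsub>Z\<^esub> ?h"
      using elim(1,3,4,5) Z_coord[OF elim(5)] by (simp add: Z.minus_smult) (simp add: Z_simps)
    then have "Q.cls ?g3 = Q.cls ?h" using elim(2-5) by (subst Q.cls_eq_iff) auto
    then show ?case using elim(3-5) by (simp add: to_Y_def Q.cls.add Q.cls.smult)
  qed
qed

text \<open>Lift, transform each coordinate, project. The estimate on \<open>tot g\<close> belongs
  to the choice of the lift, since boundedness of \<open>HY\<close> depends on it.\<close>

definition HY :: "(real \<Rightarrow> (nat \<Rightarrow> 'a) set) \<Rightarrow> real \<Rightarrow> (nat \<Rightarrow> 'a) set" where
  "HY f = to_Y (\<lambda>n. H ((SOME g. lifts f g \<and>
     tot g \<le> ennreal (12 powr p) * (\<integral>\<^sup>+t. ennreal (nrm Q.Y (f t) powr p) \<partial>lebesgue)) n))"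

lemma UMD_extension: "UMD Q.Y"
proof -
  define l where "l f = (SOME g. lifts f g \<and>
     tot g \<le> ennreal (12 powr p) * (\<integral>\<^sup>+t. ennreal (nrm Q.Y (f t) powr p) \<partial>lebesgue))" for f
  have HY: "HY f = to_Y (\<lambda>n. H (l f n))" for f by (simp add: HY_def l_def)
  have l: "lifts f (l f)" "tot (l f) \<le> ennreal (12 powr p) * (\<integral>\<^sup>+t. ennreal (nrm Q.Y (f t) powr p) \<partial>lebesgue)"
    if "f \<in> Lp p Q.Y" for f using someI_ex[OF lift_exists[OF that]] unfolding l_def by blast+
  have sl: "summable_family (l f)" if "f \<in> Lp p Q.Y" for f using l(1)[OF that] by (simp add: lifts_def)
  have HYL: "HY f \<in> Lp p Q.Y" if f: "f \<in> Lp p Q.Y" for f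
    unfolding HY by (rule to_Y_Lp(1)[OF summable_family_H(1)[OF sl[OF f]]])
  have comb: "AE t in lebesgue. HY (\<lambda>s. a \<odot>\<^bsub>Q.Y\<^esub> f s \<oplus>\<^bsub>Q.Y\<^esub> b \<odot>\<^bsub>Q.Y\<^esub> g s) t = a \<odot>\<^bsub>Q.Y\<^esub> HY f t \<oplus>\<^bsub>Q.Y\<^esub> b \<odot>\<^bsub>Q.Y\<^esub> HY g t"
    if f: "f \<in> Lp p Q.Y" and g: "g \<in> Lp p Q.Y" for f g a b
    unfolding HY by (rule lifts_comb[OF l(1)[OF f] l(1)[OF g] l(1)]) (intro Q.Y.Lp_add(1) Q.Y.Lp_smult p0 f g)
  define C where "C = (K * 12 powr p) powr (1/p)"
  have bound: "Lp_norm p Q.Y (HY f) \<le> C * Lp_norm p Q.Y f" if f: "f \<in> Lp p Q.Y" for f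
  proof -
    let ?I = "LINT t|lebesgue. nrm Q.Y (f t) powr p" and ?J = "LINT t|lebesgue. nrm Q.Y (HY f t) powr p"
    have I0: "?I \<ge> 0" "?J \<ge> 0" by (simp_all add: integral_nonneg)
    have "ennreal ?J \<le> tot (\<lambda>n. H (l f n))"
      unfolding Q.Y.Lp_nn_integral[OF HYL[OF f], symmetric] unfolding HY
      by (rule to_Y_Lp(2)[OF summable_family_H(1)[OF sl[OF f]]])
    also have "\<dots> \<le> ennreal K * tot (l f)" by (rule summable_family_H(2)[OF sl[OF f]])
    also have "\<dots> \<le> ennreal K * (ennreal (12 powr p) * ennreal ?I)"
      using l(2)[OF f] unfolding Q.Y.Lp_nn_integral[OF f] by (rule mult_left_mono) simp
    also have "\<dots> = ennreal (K * 12 powr p * ?I)" using K0 I0 by (simp add: ennreal_mult mult.assoc)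
    finally have "?J \<le> K * 12 powr p * ?I" using K0 I0 by (subst (asm) ennreal_le_iff) auto
    then have "?J powr (1/p) \<le> (K * 12 powr p * ?I) powr (1/p)" using p I0 by (intro powr_mono2) auto
    then show ?thesis unfolding Lp_norm_def C_def by (simp only: powr_mult)
  qed
  have test: "AE t in lebesgue. HY (\<lambda>s. of_real (\<phi> s) \<odot>\<^bsub>Q.Y\<^esub> y) t = of_real (hilbert_transform \<phi> t) \<odot>\<^bsub>Q.Y\<^esub> y"
    if \<phi>: "test_function \<phi>" and y: "y \<in> carrier Q.Y" for \<phi> y
  proof -
    let ?f = "\<lambda>s. of_real (\<phi> s) \<odot>\<^bsub>Q.Y\<^esub> y"
    have f: "?f \<in> Lp p Q.Y" by (rule Q.Y.Lp_test[OF p0 \<phi> y])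
    obtain z where z: "z \<in> carrier Z" "y = Q.cls z" using y by (auto simp: Q.carrier_Y)
    define g where "g n t = of_real (\<phi> t) \<odot> z n" for n t
    have gL: "g n \<in> Lp p X" for n unfolding g_def[abs_def] by (rule Lp_test[OF p0 \<phi> Z_coord[OF z(1)]])
    have gz: "(\<lambda>n. g n t) = of_real (\<phi> t) \<odot>\<^bsub>Z\<^esub> z" for t by (simp add: g_def Z_simps)
    have zL: "(\<lambda>t. of_real (\<phi> t) \<odot>\<^bsub>Z\<^esub> z) \<in> Lp p Z" by (rule Z.Lp_test[OF p0 \<phi> z(1)])
    have gs: "summable_family g"
    proof (rule summable_familyI(1))
      show "AE t in lebesgue. (\<lambda>n. g n t) \<in> carrier Z" unfolding gz using z(1) by simp
      show "AE t in lebesgue. ennreal (nrm Z (\<lambda>n. g n t) powr p) \<le> ennreal (nrm Z (of_real (\<phi> t) \<odot>\<^bsub>Z\<^esub> z) powr p)"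
        unfolding gz by simp
      show "(\<integral>\<^sup>+t. ennreal (nrm Z (of_real (\<phi> t) \<odot>\<^bsub>Z\<^esub> z) powr p) \<partial>lebesgue) < \<infinity>"
        unfolding Z.Lp_nn_integral[OF zL] by simp
    qed (rule Lp_sm[OF gL])
    have lg: "lifts ?f g" unfolding lifts_def gz using gs z by (simp add: Q.cls.smult)
    \<comment> \<open>The explicit lift \<open>g\<close> need not be the one chosen in
      \<open>HY\<close>. This trivial combination lets \<open>lifts_comb\<close> identify the two
      results.\<close>
    have "lifts (\<lambda>t. 1 \<odot>\<^bsub>Q.Y\<^esub> ?f t \<oplus>\<^bsub>Q.Y\<^esub> 0 \<odot>\<^bsub>Q.Y\<^esub> ?f t) g" using lg y by simp
    from lifts_comb[OF l(1)[OF f] l(1)[OF f] this]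
    have 1: "AE t in lebesgue. to_Y (\<lambda>n. H (g n)) t = HY ?f t"
      unfolding HY using to_Y_cl by simp
    have "AE t in lebesgue. \<forall>n. H (g n) t = of_real (hilbert_transform \<phi> t) \<odot> z n"
      unfolding AE_all_countable g_def[abs_def] using H_test[OF \<phi> Z_coord[OF z(1)]] by blast
    then show ?thesis using 1
    proof eventually_elim
      case (elim t)
      have "(\<lambda>n. H (g n) t) = of_real (hilbert_transform \<phi> t) \<odot>\<^bsub>Z\<^esub> z" using elim(1) by (simp add: Z_simps)
      then have "to_Y (\<lambda>n. H (g n)) t = of_real (hilbert_transform \<phi> t) \<odot>\<^bsub>Q.Y\<^esub> y"
        using z by (simp add: to_Y_def Q.cls.smult)
      then show ?case using elim(2) by simp
    qed
  qed
  show ?thesis unfolding UMD_def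
  proof (rule exI[of _ p], rule conjI[OF p], rule exI[of _ HY], intro conjI ballI allI impI)
    show "\<exists>C. \<forall>f\<in>Lp p Q.Y. Lp_norm p Q.Y (HY f) \<le> C * Lp_norm p Q.Y f" using bound by blast
    show "HY \<in> Lp p Q.Y \<rightarrow> Lp p Q.Y" using HYL by blast
    show "AE t in lebesgue. HY (\<lambda>s. f s \<oplus>\<^bsub>Q.Y\<^esub> g s) t = HY f t \<oplus>\<^bsub>Q.Y\<^esub> HY g t" if f: "f \<in> Lp p Q.Y" and g: "g \<in> Lp p Q.Y" for f g
      using comb[OF f g, of 1 1] Q.Y.Lp_cl[OF f] Q.Y.Lp_cl[OF g] Q.Y.Lp_cl[OF HYL[OF f]] Q.Y.Lp_cl[OF HYL[OF g]] by simp
    show "AE t in lebesgue. HY (\<lambda>s. a \<odot>\<^bsub>Q.Y\<^esub> f s) t = a \<odot>\<^bsub>Q.Y\<^esub> HY f t" if f: "f \<in> Lp p Q.Y" for a f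
      using comb[OF f f, of a 0] Q.Y.Lp_cl[OF f] Q.Y.Lp_cl[OF HYL[OF f]] by simp
  qed (rule test)
qed

end

theorem proposition1p2:
  fixes X :: "('k::real_or_complex, 'a) normed_module"
    and T :: "real \<Rightarrow> 'a \<Rightarrow> 'a"
    and t0 c :: real
  assumes "banach_space X"
    and "C0_semigroup X T"
    and "t0 > 0" and "c > 0"
    and "\<forall>x\<in>carrier X. nrm X (T t0 x) \<ge> c * nrm X x"
  shows "(\<forall>\<alpha>>1. let \<nu> = 1 / t0 * ln (c / \<alpha>) in
            \<exists>m>0. \<forall>x\<in>carrier X. \<forall>t>0. nrm X (T t x) \<ge> m * exp (\<nu> * t) * nrm X x)
       \<and> (\<exists>(Y :: ('k, (nat \<Rightarrow> 'a) set) normed_module) \<iota> S.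
            banach_space Y \<and> closed_embedding X Y \<iota> \<and> C0_group Y S \<and>
            (\<forall>t\<ge>0. \<forall>x\<in>carrier X. S t (\<iota> x) = \<iota> (T t x)) \<and>
            (reflexive X \<longrightarrow> reflexive Y) \<and> (UMD X \<longrightarrow> UMD Y))"
proof
  interpret bounded_below_semigroup X T t0 c
    using assms by (intro bounded_below_semigroup.intro bounded_below_semigroup_axioms.intro) auto
  show "\<forall>\<alpha>>1. let \<nu> = 1 / t0 * ln (c / \<alpha>) in
            \<exists>m>0. \<forall>x\<in>carrier X. \<forall>t>0. nrm X (T t x) \<ge> m * exp (\<nu> * t) * nrm X x"
    unfolding Let_def using exponential_lower_bound by blast
  have ge: "group_extension X T t0 c p (\<lambda>n. (2 / c) ^ n)" if "p > 1" for p
    using that c by (intro group_extension.intro weighted_ellp.intro weighted_ellp_axioms.intro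
        group_extension_axioms.intro bounded_below_semigroup_axioms banach_space_axioms) auto
  show "\<exists>(Y :: ('k, (nat \<Rightarrow> 'a) set) normed_module) \<iota> S.
            banach_space Y \<and> closed_embedding X Y \<iota> \<and> C0_group Y S \<and>
            (\<forall>t\<ge>0. \<forall>x\<in>carrier X. S t (\<iota> x) = \<iota> (T t x)) \<and>
            (reflexive X \<longrightarrow> reflexive Y) \<and> (UMD X \<longrightarrow> UMD Y)"
  \<comment> \<open>The exponent must be fixed before Y is constructed, and it depends on whether X
    is UMD; without UMD the exponent 2 is taken and the implication on UMD is vacuous.\<close>
  proof (cases "UMD X")
    case True
    then obtain p H K where "Lp_hilbert X p H K" using UMD_Lp_hilbert[OF banach_space_axioms] by blast
    then interpret hil: Lp_hilbert X p H K .
    interpret G: group_extension X T t0 c p "\<lambda>n. (2 / c) ^ n" by (rule ge[OF hil.p1])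
    interpret U: group_extension_hilbert X T t0 c p "\<lambda>n. (2 / c) ^ n" H K by unfold_locales
    show ?thesis
      using G.Q.Y_banach G.emb_closed G.S_group G.S_emb G.reflexive_extension U.UMD_extension by blast
  next
    case False
    interpret G: group_extension X T t0 c 2 "\<lambda>n. (2 / c) ^ n" by (rule ge) simp
    show ?thesis
      using G.Q.Y_banach G.emb_closed G.S_group G.S_emb G.reflexive_extension False by blast
  qed
qed

end
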